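(* Let $t>0$. For every $a>0$, $$\Pr\{A_t\le a\}=e^{-2/a}\,E\Big[\exp\Big(\frac{2M_t}{a+A_t}\Big)\Big].$$ Moreover, the random variable $A_t$ has a continuous, positive probability density function $g_t(a)$, $a>0$, given by $$g_t(a)=\frac{2}{a^2}\Pr\{A_t\le a\}-\frac{2}{a^2}\Pr\Big\{\frac{A_t}{M_t}\le a\Big\}.$$
   Context: $(B_t)_{t\ge 0}$ is a standard one-dimensional Brownian motion started at $0$, $M_t=\exp(B_t-t/2)$, and $A_t=\int_0^t M_s\,ds$. *)

theory Defs
  imports "HOL-Probability.Probability"
begin

(* Indexed by real times, of which only those \<ge> 0 are constrained. Continuity is required
   for every sample point, which makes path functionals such as the time integral below
   measurable without assuming that M is complete. The second argument of normal_density
   is the standard deviation. *)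
locale standard_brownian_motion = prob_space M for M :: "'a measure" +
  fixes B :: "real \<Rightarrow> 'a \<Rightarrow> real"
  assumes measurable_at: "\<And>t. 0 \<le> t \<Longrightarrow> B t \<in> borel_measurable M"
    and starts_at_zero: "AE \<omega> in M. B 0 \<omega> = 0"
    and independent_increments:
      "\<And>(n::nat) ts. 0 \<le> ts 0 \<Longrightarrow> (\<And>i. i < n \<Longrightarrow> ts i < ts (Suc i)) \<Longrightarrow>
        indep_vars (\<lambda>_. borel) (\<lambda>i \<omega>. B (ts (Suc i)) \<omega> - B (ts i) \<omega>) {..<n}"
    and gaussian_increments:
      "\<And>s t. 0 \<le> s \<Longrightarrow> s < t \<Longrightarrow>
        distributed M lborel (\<lambda>\<omega>. B t \<omega> - B s \<omega>) (normal_density 0 (sqrt (t - s)))"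
    and continuous_paths: "\<And>\<omega>. \<omega> \<in> space M \<Longrightarrow> continuous_on {0..} (\<lambda>t. B t \<omega>)"

definition geometric_bm :: "(real \<Rightarrow> 'a \<Rightarrow> real) \<Rightarrow> real \<Rightarrow> 'a \<Rightarrow> real" where
  "geometric_bm B t \<omega> = exp (B t \<omega> - t / 2)"

definition integrated_gbm :: "(real \<Rightarrow> 'a \<Rightarrow> real) \<Rightarrow> real \<Rightarrow> 'a \<Rightarrow> real" where
  "integrated_gbm B t \<omega> = (LBINT s:{0..t}. geometric_bm B s \<omega>)"

end

theory Submission
  imports Defs "HOL-Real_Asymp.Real_Asymp"
begin

text \<open>Write \<open>W = M\<^sub>t / A\<^sub>t\<^sup>2\<close>. Perturbing the path adaptedly by \<open>\<delta> log M\<^sub>s = 2 A\<^sub>s\<close> changes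
  \<open>A\<^sub>t\<close> by \<open>A\<^sub>t\<^sup>2\<close> and leaves \<open>W\<close> fixed, while the corresponding Girsanov weight is
  \<open>2 (M\<^sub>t - 1)\<close>. This gives the integration by parts formula
  \<open>E [A\<^sub>t\<^sup>2 \<partial>\<^sub>a u(W, A\<^sub>t)] = 2 E [(M\<^sub>t - 1) u(W, A\<^sub>t)]\<close>. It is obtained without stochastic calculus:
  shifting the \<open>j\<close>-th of \<open>n\<close> Gaussian increments by its variance multiplies the law by
  \<open>M\<^sub>j\<^sub>+\<^sub>1 / M\<^sub>j\<close>, and summing \<open>M\<^sub>j (M\<^sub>j\<^sub>+\<^sub>1 / M\<^sub>j - 1)\<close> over \<open>j\<close> telescopes to \<open>M\<^sub>t - 1\<close>.

  The formula says that, conditionally on \<open>W = w\<close>, the law of \<open>A\<^sub>t\<close> has a density proportional to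
  \<open>exp (- 2 w a - 2 / a) / a\<^sup>2\<close>, a generalized inverse Gaussian law. In terms of
  \<open>z = 1 / a\<close> this is \<open>exp (- 2 w / z - 2 z) dz\<close>, and the translation \<open>z \<mapsto> z + 1 / a\<close> yields the formula
  for \<open>P (A\<^sub>t \<le> a)\<close>. The fundamental theorem of calculus in \<open>a\<close> expresses the density of \<open>A\<^sub>t\<close> by
  \<open>E [(1 - M\<^sub>t); A\<^sub>t \<le> a]\<close>, and \<open>E [M\<^sub>t; A\<^sub>t \<le> a] = P (A\<^sub>t / M\<^sub>t \<le> a)\<close> by Girsanov's theorem and time
  reversal.\<close>

section \<open>Tilted Gaussian vectors\<close>

text \<open>For test functions \<open>K w * S x * exp (2 * w * x + 2 / x)\<close> the exponential is
  an integrating factor: because \<open>M\<^sub>t = W * A\<^sub>t\<^sup>2\<close>, all terms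
  containing \<open>S\<close> itself cancel in the integration by parts formula, and the expectation
  of \<open>K (W) * A\<^sub>t\<^sup>2 * S' (A\<^sub>t)\<close> times the exponential is zero. Hence
  the law of \<open>(W, A\<^sub>t)\<close>, weighted by that exponential, is a product of a measure
  in \<open>w\<close> and \<open>dx / x\<^sup>2\<close>. The obstacle is size: the exponential is
  unbounded as \<open>x\<close> tends to 0 and as \<open>w * x\<close> grows, and no tail estimate
  is at hand beforehand. So test functions are cut off in both variables, the mixing measure
  \<open>\<eta>\<close> in \<open>w\<close> is only shown to be sigma-finite and carries the
  normalising constants, and the kernel identities are stated with nonnegative integrals. The
  exponential moment in the theorem is then finite because it has been evaluated.\<close>

lemma (in prob_space) indep_vars_image_inj_on:
  assumes f: "inj_on f I" and X: "indep_vars (\<lambda>_. N) X (f ` I)"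
  shows "indep_vars (\<lambda>_. N) (\<lambda>i. X (f i)) I"
  unfolding indep_vars_def2
proof (intro conjI ballI)
  show "random_variable N (X (f i))" if "i \<in> I" for i
    using X that by (auto simp: indep_vars_def2)
  define F where "F j = {X j -` A \<inter> space M |A. A \<in> sets N}" for j
  have F: "indep_sets F (f ` I)" using X by (simp add: indep_vars_def2 F_def[abs_def])
  have "indep_sets (\<lambda>i. F (f i)) I"
    unfolding indep_sets_def
  proof (intro conjI ballI allI impI)
    show "F (f i) \<subseteq> events" if "i \<in> I" for i
      using F that by (auto simp: indep_sets_def)
    fix J A assume J: "J \<subseteq> I" "J \<noteq> {}" "finite J" and A: "A \<in> (\<Pi> i\<in>J. F (f i))"
    have fJ: "inj_on f J" using f J(1) inj_on_subset by blast
    have inv: "the_inv_into J f (f j) = j" if "j \<in> J" for j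
      by (rule the_inv_into_f_f[OF fJ that])
    have "prob (\<Inter>k\<in>f ` J. A (the_inv_into J f k)) = (\<Prod>k\<in>f ` J. prob (A (the_inv_into J f k)))"
      using A J by (intro indep_setsD[OF F]) (auto simp: inv)
    then show "prob (\<Inter>j\<in>J. A j) = (\<Prod>j\<in>J. prob (A j))"
      by (simp add: prod.reindex[OF fJ] inv)
  qed
  then show "indep_sets (\<lambda>i. {X (f i) -` A \<inter> space M |A. A \<in> sets N}) I"
    by (simp add: F_def[abs_def])
qed

text \<open>By independence both joint laws are product measures, and a product of one-dimensional
  densities reweights each factor separately. It is enough to compare the two sides on rectangles,
  where the integral factorises.\<close>

lemma density_distr_PiM_eq_distr_PiM:
  fixes X :: "'i \<Rightarrow> 'a \<Rightarrow> real" and Y :: "'i \<Rightarrow> 'a \<Rightarrow> real" and u :: "'i \<Rightarrow> real \<Rightarrow> ennreal"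
  assumes "prob_space M" and I: "finite I" "I \<noteq> {}"
    and X: "prob_space.indep_vars M (\<lambda>_. borel) X I"
    and Y: "prob_space.indep_vars M (\<lambda>_. borel) Y I"
    and u [measurable]: "\<And>i. i \<in> I \<Longrightarrow> u i \<in> borel_measurable borel"
    and eq: "\<And>i. i \<in> I \<Longrightarrow> density (distr M borel (X i)) (u i) = distr M borel (Y i)"
  shows "density (distr M (Pi\<^sub>M I (\<lambda>_. borel)) (\<lambda>\<omega>. \<lambda>i\<in>I. X i \<omega>)) (\<lambda>x. \<Prod>i\<in>I. u i (x i)) =
         distr M (Pi\<^sub>M I (\<lambda>_. borel)) (\<lambda>\<omega>. \<lambda>i\<in>I. Y i \<omega>)"
proof -
  interpret prob_space M by fact
  have rv: "random_variable borel (X i)" "random_variable borel (Y i)" if "i \<in> I" for i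
    using X Y that by (auto simp: indep_vars_def)
  \<comment> \<open>Outside \<open>I\<close> the point mass at 0 is a placeholder: the product
    locale wants a probability measure at every index.\<close>
  define D where "D i = (if i \<in> I then distr M borel (X i) else return borel 0)" for i
  define D' where "D' i = (if i \<in> I then distr M borel (Y i) else return borel 0)" for i
  have pD: "prob_space (D i)" "prob_space (D' i)" for i
    using rv by (auto simp: D_def D'_def intro!: prob_space_distr prob_space_return)
  interpret D: product_prob_space D I
    by (intro product_prob_spaceI pD)
  interpret D': product_prob_space D' I
    by (intro product_prob_spaceI pD)
  have [simp, measurable_cong]: "sets (D i) = sets borel" "sets (D' i) = sets borel" for i
    by (auto simp: D_def D'_def)
  have sD [simp, measurable_cong]: "sets (Pi\<^sub>M I D) = sets (Pi\<^sub>M I (\<lambda>_. borel))"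
      "sets (Pi\<^sub>M I D') = sets (Pi\<^sub>M I (\<lambda>_. borel))"
    by (intro sets_PiM_cong refl; simp)+
  have dX: "distr M (Pi\<^sub>M I (\<lambda>_. borel)) (\<lambda>\<omega>. \<lambda>i\<in>I. X i \<omega>) = Pi\<^sub>M I D"
    using X indep_vars_iff_distr_eq_PiM'[OF I(2), where X = X and M' = "\<lambda>_. borel"] rv
    by (simp add: D_def cong: PiM_cong)
  have dY: "distr M (Pi\<^sub>M I (\<lambda>_. borel)) (\<lambda>\<omega>. \<lambda>i\<in>I. Y i \<omega>) = Pi\<^sub>M I D'"
    using Y indep_vars_iff_distr_eq_PiM'[OF I(2), where X = Y and M' = "\<lambda>_. borel"] rv
    by (simp add: D'_def cong: PiM_cong)
  have "density (Pi\<^sub>M I D) (\<lambda>x. \<Prod>i\<in>I. u i (x i)) = Pi\<^sub>M I D'"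
  proof (rule D'.PiM_eqI[OF I(1)])
    fix A assume A [measurable]: "\<And>i. i \<in> I \<Longrightarrow> A i \<in> sets (D' i)"
    have [measurable]: "Pi\<^sub>E I A \<in> sets (Pi\<^sub>M I (\<lambda>_. borel))"
      using A I by (intro sets_PiM_I_finite) auto
    have "emeasure (density (Pi\<^sub>M I D) (\<lambda>x. \<Prod>i\<in>I. u i (x i))) (Pi\<^sub>E I A) =
          (\<integral>\<^sup>+x. (\<Prod>i\<in>I. u i (x i)) * indicator (Pi\<^sub>E I A) x \<partial>Pi\<^sub>M I D)"
      by (subst emeasure_density) auto
    also have "\<dots> = (\<integral>\<^sup>+x. (\<Prod>i\<in>I. u i (x i) * indicator (A i) (x i)) \<partial>Pi\<^sub>M I D)"
    proof (rule nn_integral_cong)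
      fix x assume "x \<in> space (Pi\<^sub>M I D)"
      then have "x \<in> extensional I" by (auto simp: space_PiM PiE_def)
      then have "indicator (Pi\<^sub>E I A) x = (\<Prod>i\<in>I. indicator (A i) (x i) :: ennreal)"
        using I by (auto simp: indicator_def PiE_iff prod_zero)
      then show "(\<Prod>i\<in>I. u i (x i)) * indicator (Pi\<^sub>E I A) x = (\<Prod>i\<in>I. u i (x i) * indicator (A i) (x i))"
        by (simp add: prod.distrib)
    qed
    also have "\<dots> = (\<Prod>i\<in>I. \<integral>\<^sup>+x. u i x * indicator (A i) x \<partial>D i)"
      using A by (intro D.product_nn_integral_prod I) auto
    also have "\<dots> = (\<Prod>i\<in>I. emeasure (D' i) (A i))"
    proof (rule prod.cong[OF refl])
      fix i assume i: "i \<in> I"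
      have "emeasure (D' i) (A i) = emeasure (density (D i) (u i)) (A i)"
        using eq[OF i] i by (simp add: D_def D'_def)
      then show "(\<integral>\<^sup>+x. u i x * indicator (A i) x \<partial>D i) = emeasure (D' i) (A i)"
        using A[OF i] u[OF i] by (simp add: emeasure_density)
    qed
    finally show "emeasure (density (Pi\<^sub>M I D) (\<lambda>x. \<Prod>i\<in>I. u i (x i))) (Pi\<^sub>E I A) =
      (\<Prod>i\<in>I. emeasure (D' i) (A i))" .
  qed simp
  then show ?thesis by (simp add: dX dY)
qed

text \<open>Completing the square, \<open>- x\<^sup>2 / (2 * d) + (x - d / 2) = - (x - d)\<^sup>2 /
  (2 * d)\<close>: the exponential tilt moves a centred normal law of variance \<open>d\<close> by
  \<open>d\<close>. The second claim is the symmetry of that law; it is what allows a reflected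
  increment in the time reversal.\<close>

lemma density_exp_normal:
  assumes "prob_space M" and d: "d > 0"
    and X: "distributed M lborel X (normal_density 0 (sqrt d))"
  shows "density (distr M borel X) (\<lambda>x. ennreal (exp (x - d / 2))) = distr M borel (\<lambda>\<omega>. X \<omega> + d)"
    and "distr M borel (\<lambda>\<omega>. d - X \<omega>) = distr M borel (\<lambda>\<omega>. X \<omega> + d)"
proof -
  interpret prob_space M by fact
  have eq: "normal_density 0 (sqrt d) x * exp (x - d / 2) = normal_density d (sqrt d) x" for x
  proof -
    have "- x\<^sup>2 / (2 * d) + (x - d / 2) = - (x - d)\<^sup>2 / (2 * d)"
      using d by (simp add: power2_eq_square field_simps)
    then have "exp (- x\<^sup>2 / (2 * d)) * exp (x - d / 2) = exp (- (x - d)\<^sup>2 / (2 * d))"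
      by (simp flip: exp_add)
    then show ?thesis using d
      by (simp add: normal_density_def)
  qed
  have bl: "distr M borel Z = distr M lborel Z" for Z :: "'a \<Rightarrow> real"
    by (intro distr_cong) auto
  have "distributed M lborel (\<lambda>\<omega>. d + 1 * X \<omega>) (normal_density (d + 1 * 0) (\<bar>1\<bar> * sqrt d))"
    using X d by (intro normal_density_affine) auto
  then have 1: "distr M borel (\<lambda>\<omega>. X \<omega> + d) = density lborel (normal_density d (sqrt d))"
    by (simp add: bl distributed_def add.commute)
  have "distributed M lborel (\<lambda>\<omega>. d + (-1) * X \<omega>) (normal_density (d + (-1) * 0) (\<bar>-1\<bar> * sqrt d))"
    using X d by (intro normal_density_affine) auto
  then have 2: "distr M borel (\<lambda>\<omega>. d - X \<omega>) = density lborel (normal_density d (sqrt d))"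
    by (simp add: bl distributed_def)
  have "density (distr M borel X) (\<lambda>x. ennreal (exp (x - d / 2))) =
        density lborel (\<lambda>x. ennreal (normal_density 0 (sqrt d) x) * ennreal (exp (x - d / 2)))"
    using X by (simp add: bl distributed_def density_density_eq)
  also have "\<dots> = density lborel (normal_density d (sqrt d))"
    by (intro density_cong AE_I2) (auto simp: eq normal_density_nonneg simp flip: ennreal_mult')
  finally show "density (distr M borel X) (\<lambda>x. ennreal (exp (x - d / 2))) = distr M borel (\<lambda>\<omega>. X \<omega> + d)"
    using 1 by simp
  show "distr M borel (\<lambda>\<omega>. d - X \<omega>) = distr M borel (\<lambda>\<omega>. X \<omega> + d)"
    using 1 2 by simp
qed

text \<open>The Girsanov theorem for finitely many steps. A singleton \<open>J\<close> gives the
  perturbation behind the integration by parts formula. When all steps are tilted, the resulting law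
  is also that of the reflected increments in reversed order, since the steps are independent and
  identically distributed.\<close>

lemma indep_gaussian_tilt:
  fixes X :: "nat \<Rightarrow> 'a \<Rightarrow> real"
  assumes P: "prob_space M" and d: "d > 0" and n: "n > 0"
    and X: "prob_space.indep_vars M (\<lambda>_. borel) X {..<n}"
    and N: "\<And>i. i < n \<Longrightarrow> distributed M lborel (X i) (normal_density 0 (sqrt d))"
    and J: "J \<subseteq> {..<n}"
  shows "density (distr M (Pi\<^sub>M {..<n} (\<lambda>_. borel)) (\<lambda>\<omega>. \<lambda>i\<in>{..<n}. X i \<omega>))
           (\<lambda>x. ennreal (\<Prod>i\<in>J. exp (x i - d / 2))) =
         distr M (Pi\<^sub>M {..<n} (\<lambda>_. borel)) (\<lambda>\<omega>. \<lambda>i\<in>{..<n}. X i \<omega> + (if i \<in> J then d else 0))"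
    and "density (distr M (Pi\<^sub>M {..<n} (\<lambda>_. borel)) (\<lambda>\<omega>. \<lambda>i\<in>{..<n}. X i \<omega>))
           (\<lambda>x. ennreal (\<Prod>i<n. exp (x i - d / 2))) =
         distr M (Pi\<^sub>M {..<n} (\<lambda>_. borel)) (\<lambda>\<omega>. \<lambda>i\<in>{..<n}. d - X (n - Suc i) \<omega>)"
proof -
  interpret prob_space M by fact
  have fJ: "finite J" using J finite_subset by blast
  have rv [measurable]: "random_variable borel (X i)" if "i < n" for i
    using X that by (auto simp: indep_vars_def)
  define u where "u i x = (if i \<in> J then ennreal (exp (x - d / 2)) else 1)" for i :: nat and x
  have u: "ennreal (\<Prod>i\<in>J. exp (x i - d / 2)) = (\<Prod>i\<in>{..<n}. u i (x i))" for x
  proof -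
    have "(\<Prod>i\<in>{..<n}. u i (x i)) = (\<Prod>i\<in>J. u i (x i))"
      using J by (intro prod.mono_neutral_right) (auto simp: u_def)
    then show ?thesis by (simp add: u_def prod_ennreal)
  qed
  have [measurable]: "u i \<in> borel_measurable borel" for i
    unfolding u_def by measurable
  show "density (distr M (Pi\<^sub>M {..<n} (\<lambda>_. borel)) (\<lambda>\<omega>. \<lambda>i\<in>{..<n}. X i \<omega>))
           (\<lambda>x. ennreal (\<Prod>i\<in>J. exp (x i - d / 2))) =
         distr M (Pi\<^sub>M {..<n} (\<lambda>_. borel)) (\<lambda>\<omega>. \<lambda>i\<in>{..<n}. X i \<omega> + (if i \<in> J then d else 0))"
    unfolding u
  proof (rule density_distr_PiM_eq_distr_PiM[OF P _ _ X])
    show "indep_vars (\<lambda>_. borel) (\<lambda>i \<omega>. X i \<omega> + (if i \<in> J then d else 0)) {..<n}"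
      by (rule indep_vars_compose2[OF X]) auto
    fix i assume "i \<in> {..<n}"
    then show "density (distr M borel (X i)) (u i) = distr M borel (\<lambda>\<omega>. X i \<omega> + (if i \<in> J then d else 0))"
      using density_exp_normal(1)[OF P d N, of i]
      by (auto simp: u_def[abs_def] density_1)
  qed (use n in auto)
  have pr: "ennreal (\<Prod>i<n. exp (x i - d / 2)) = (\<Prod>i\<in>{..<n}. ennreal (exp (x i - d / 2)))" for x :: "nat \<Rightarrow> real"
    by (simp add: prod_ennreal)
  show "density (distr M (Pi\<^sub>M {..<n} (\<lambda>_. borel)) (\<lambda>\<omega>. \<lambda>i\<in>{..<n}. X i \<omega>))
           (\<lambda>x. ennreal (\<Prod>i<n. exp (x i - d / 2))) =
         distr M (Pi\<^sub>M {..<n} (\<lambda>_. borel)) (\<lambda>\<omega>. \<lambda>i\<in>{..<n}. d - X (n - Suc i) \<omega>)"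
    unfolding pr
  proof (rule density_distr_PiM_eq_distr_PiM[OF P _ _ X])
    have bij: "inj_on (\<lambda>i. n - Suc i) {..<n}"
      by (auto simp: inj_on_def)
    have img: "(\<lambda>i. n - Suc i) ` {..<n} = {..<n}"
      by (rule card_subset_eq) (auto simp: card_image[OF bij])
    have "indep_vars (\<lambda>_. borel) (\<lambda>i. X (n - Suc i)) {..<n}"
    proof -
      have "indep_vars (\<lambda>_. borel) X ((\<lambda>i. n - Suc i) ` {..<n})" using X by (simp add: img)
      from indep_vars_image_inj_on[OF bij this] show ?thesis .
    qed
    then show "indep_vars (\<lambda>_. borel) (\<lambda>i \<omega>. d - X (n - Suc i) \<omega>) {..<n}"
      by (rule indep_vars_compose2) auto
    fix i assume "i \<in> {..<n}"
    then have i: "i < n" "n - Suc i < n" by auto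
    \<comment> \<open>All steps have the same law, so step \<open>i\<close> may be matched with step
      \<open>n - Suc i\<close> in the reversed order.\<close>
    have eqd: "distr M borel (X i) = distr M borel (X (n - Suc i))"
    proof -
      have "distr M borel (X k) = density lborel (normal_density 0 (sqrt d))" if "k < n" for k
      proof -
        have "distr M borel (X k) = distr M lborel (X k)" by (intro distr_cong) auto
        with N[OF that] show ?thesis by (simp add: distributed_def)
      qed
      with i show ?thesis by simp
    qed
    show "density (distr M borel (X i)) (\<lambda>x. ennreal (exp (x - d / 2))) = distr M borel (\<lambda>\<omega>. d - X (n - Suc i) \<omega>)"
      using density_exp_normal[OF P d N[OF i(2)]] eqd by simp
  qed (use n in auto)
qed

section \<open>Discrete geometric random walks\<close>

text \<open>The drift \<open>- d / 2\<close> per step makes each factor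
  \<open>exp (x j - d / 2)\<close> exactly the tilt density of one step of variance
  \<open>d\<close>.\<close>

definition discrete_gbm :: "real \<Rightarrow> (nat \<Rightarrow> real) \<Rightarrow> nat \<Rightarrow> real" where
  "discrete_gbm d x i = exp (\<Sum>j<i. x j - d / 2)"

text \<open>A left-endpoint Riemann sum: \<open>discrete_integral d x (Suc j)\<close> does not
  involve \<open>x j\<close>, so a shift of step \<open>j\<close> leaves it fixed.\<close>

definition discrete_integral :: "real \<Rightarrow> (nat \<Rightarrow> real) \<Rightarrow> nat \<Rightarrow> real" where
  "discrete_integral d x n = (\<Sum>i<n. d * discrete_gbm d x i)"

lemma discrete_gbm_pos [simp]: "discrete_gbm d x i > 0"
  by (simp add: discrete_gbm_def)

lemma discrete_gbm_nonneg [simp]: "discrete_gbm d x i \<ge> 0"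
  by (simp add: discrete_gbm_def)

lemma discrete_integral_pos: "d > 0 \<Longrightarrow> n > 0 \<Longrightarrow> discrete_integral d x n > 0"
  unfolding discrete_integral_def by (intro sum_pos) auto

lemma discrete_integral_mono:
  assumes "d \<ge> 0" "m \<le> n"
  shows "discrete_integral d x m \<le> discrete_integral d x n"
  unfolding discrete_integral_def using assms
  by (intro sum_mono2 mult_nonneg_nonneg less_imp_le[OF discrete_gbm_pos]) auto

lemma discrete_gbm_cong:
  "(\<And>j. j < i \<Longrightarrow> x j = y j) \<Longrightarrow> discrete_gbm d x i = discrete_gbm d y i"
  by (simp add: discrete_gbm_def)

lemma discrete_integral_cong:
  "(\<And>j. Suc j < n \<Longrightarrow> x j = y j) \<Longrightarrow> discrete_integral d x n = discrete_integral d y n"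
  unfolding discrete_integral_def by (intro sum.cong refl arg_cong2[of _ _ _ _ "(*)"] discrete_gbm_cong) auto

lemma discrete_gbm_restrict [simp]:
  "i \<le> n \<Longrightarrow> discrete_gbm d (\<lambda>j\<in>{..<n}. x j) i = discrete_gbm d x i"
  by (rule discrete_gbm_cong) auto

lemma discrete_integral_restrict [simp]:
  "i \<le> n \<Longrightarrow> discrete_integral d (\<lambda>j\<in>{..<n}. x j) i = discrete_integral d x i"
  by (rule discrete_integral_cong) auto

lemma discrete_gbm_Suc: "discrete_gbm d x (Suc i) = discrete_gbm d x i * exp (x i - d / 2)"
  by (simp add: discrete_gbm_def exp_add)

lemma discrete_gbm_prod: "discrete_gbm d x n = (\<Prod>i<n. exp (x i - d / 2))"
  by (simp add: discrete_gbm_def exp_sum)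

lemma discrete_gbm_shift:
  "discrete_gbm d (\<lambda>k. x k + (if k \<in> {j} then d else 0)) i =
   (if j < i then exp d * discrete_gbm d x i else discrete_gbm d x i)"
proof -
  have "(\<Sum>k<i. x k + (if k \<in> {j} then d else 0) - d / 2) = (\<Sum>k<i. x k - d / 2) + (if j < i then d else 0)"
    by (simp add: sum.distrib sum_subtractf)
  then show ?thesis by (simp add: discrete_gbm_def exp_add)
qed

text \<open>Summands up to index \<open>j\<close> see only the steps before \<open>j\<close>; every
  later one contains the shifted step and is multiplied by \<open>exp d\<close>.\<close>

lemma discrete_integral_shift:
  assumes "j < n"
  shows "discrete_integral d (\<lambda>k. x k + (if k \<in> {j} then d else 0)) n =
    discrete_integral d x (Suc j) + exp d * (discrete_integral d x n - discrete_integral d x (Suc j))"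
proof -
  have un: "{..<n} = {..<Suc j} \<union> {Suc j..<n}" using assms by auto
  have split: "(\<Sum>i<n. f i) = (\<Sum>i<Suc j. f i) + (\<Sum>i\<in>{Suc j..<n}. f i)" for f :: "nat \<Rightarrow> real"
    unfolding un by (rule sum.union_disjoint) auto
  show ?thesis
    unfolding discrete_integral_def split[of "\<lambda>i. d * _ i"]
    unfolding discrete_gbm_shift by (simp add: sum_distrib_left algebra_simps)
qed

lemma borel_measurable_discrete_gbm [measurable]:
  "i \<le> n \<Longrightarrow> (\<lambda>x. discrete_gbm d x i) \<in> borel_measurable (Pi\<^sub>M {..<n} (\<lambda>_. borel))"
  unfolding discrete_gbm_def
  by (intro borel_measurable_exp[THEN measurable_compose_rev] borel_measurable_sum
      borel_measurable_diff measurable_component_singleton) auto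

lemma borel_measurable_discrete_integral [measurable]:
  "i \<le> n \<Longrightarrow> (\<lambda>x. discrete_integral d x i) \<in> borel_measurable (Pi\<^sub>M {..<n} (\<lambda>_. borel))"
  unfolding discrete_integral_def
  by (intro borel_measurable_sum borel_measurable_times borel_measurable_discrete_gbm) auto

section \<open>Tilting, integration by parts and reversal for finitely many Gaussian steps\<close>

locale gaussian_steps = prob_space M for M :: "'a measure" +
  fixes X :: "nat \<Rightarrow> 'a \<Rightarrow> real" and d :: real and n :: nat
  assumes d: "d > 0" and n: "n > 0"
    and indep: "indep_vars (\<lambda>_. borel) X {..<n}"
    and normal: "\<And>i. i < n \<Longrightarrow> distributed M lborel (X i) (normal_density 0 (sqrt d))"
begin

abbreviation (input) "G \<equiv> \<lambda>i \<omega>. discrete_gbm d (\<lambda>j. X j \<omega>) i"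
abbreviation (input) "A \<equiv> \<lambda>i \<omega>. discrete_integral d (\<lambda>j. X j \<omega>) i"

lemma measurable_X [measurable]: "(\<lambda>\<omega>. \<lambda>i\<in>{..<n}. X i \<omega>) \<in> measurable M (Pi\<^sub>M {..<n} (\<lambda>_. borel))"
  using indep by (intro measurable_restrict) (auto simp: indep_vars_def)

lemma rv_G [measurable]: "i \<le> n \<Longrightarrow> random_variable borel (G i)"
  using measurable_compose[OF measurable_X borel_measurable_discrete_gbm[of i n d]] by simp

lemma rv_A [measurable]: "i \<le> n \<Longrightarrow> random_variable borel (A i)"
  using measurable_compose[OF measurable_X borel_measurable_discrete_integral[of i n d]] by simp

text \<open>Restates the change of measure for expectations. The tilt is integrable because, as the
  density of a probability law with respect to another, it has total mass 1.\<close>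

lemma expectation_tilt:
  fixes F :: "(nat \<Rightarrow> real) \<Rightarrow> real"
  assumes J: "J \<subseteq> {..<n}" and F [measurable]: "F \<in> borel_measurable (Pi\<^sub>M {..<n} (\<lambda>_. borel))"
  shows "expectation (\<lambda>\<omega>. (\<Prod>i\<in>J. exp (X i \<omega> - d / 2)) * F (\<lambda>i\<in>{..<n}. X i \<omega>)) =
    expectation (\<lambda>\<omega>. F (\<lambda>i\<in>{..<n}. X i \<omega> + (if i \<in> J then d else 0)))"
    and "expectation (\<lambda>\<omega>. G n \<omega> * F (\<lambda>i\<in>{..<n}. X i \<omega>)) =
    expectation (\<lambda>\<omega>. F (\<lambda>i\<in>{..<n}. d - X (n - Suc i) \<omega>))"
    and "integrable M (\<lambda>\<omega>. \<Prod>i\<in>J. exp (X i \<omega> - d / 2))"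
proof -
  let ?T = "Pi\<^sub>M {..<n} (\<lambda>_. borel :: real measure)"
  let ?D = "distr M ?T (\<lambda>\<omega>. \<lambda>i\<in>{..<n}. X i \<omega>)"
  note tilt = indep_gaussian_tilt[OF prob_space_axioms d n indep normal]
  have rv [measurable]: "random_variable borel (X i)" if "i < n" for i
    using indep that by (auto simp: indep_vars_def)
  have m [measurable]: "(\<lambda>x. \<Prod>i\<in>J. exp (x i - d / 2)) \<in> borel_measurable ?T" if "J \<subseteq> {..<n}" for J
    using that by (intro borel_measurable_prod borel_measurable_exp[THEN measurable_compose_rev]
        borel_measurable_diff measurable_component_singleton) auto
  have restr: "(\<Prod>i\<in>J. exp ((\<lambda>i\<in>{..<n}. X i \<omega>) i - d / 2)) = (\<Prod>i\<in>J. exp (X i \<omega> - d / 2))"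
    if "J \<subseteq> {..<n}" for J \<omega>
    using that by (intro prod.cong) auto
  have key: "expectation (\<lambda>\<omega>. (\<Prod>i\<in>J. exp (X i \<omega> - d / 2)) * F (\<lambda>i\<in>{..<n}. X i \<omega>)) =
      (\<integral>x. F x \<partial>density ?D (\<lambda>x. ennreal (\<Prod>i\<in>J. exp (x i - d / 2))))" if J: "J \<subseteq> {..<n}" for J
  proof -
    have "(\<integral>x. F x \<partial>density ?D (\<lambda>x. ennreal (\<Prod>i\<in>J. exp (x i - d / 2)))) =
          (\<integral>x. (\<Prod>i\<in>J. exp (x i - d / 2)) * F x \<partial>?D)"
      using J by (subst integral_density) (auto intro!: prod_nonneg)
    also have "\<dots> = expectation (\<lambda>\<omega>. (\<Prod>i\<in>J. exp ((\<lambda>i\<in>{..<n}. X i \<omega>) i - d / 2)) * F (\<lambda>i\<in>{..<n}. X i \<omega>))"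
      using J by (subst integral_distr) auto
    finally show ?thesis by (simp only: restr[OF J])
  qed
  show "expectation (\<lambda>\<omega>. (\<Prod>i\<in>J. exp (X i \<omega> - d / 2)) * F (\<lambda>i\<in>{..<n}. X i \<omega>)) =
    expectation (\<lambda>\<omega>. F (\<lambda>i\<in>{..<n}. X i \<omega> + (if i \<in> J then d else 0)))"
    unfolding key[OF J] tilt(1)[OF _ J, simplified] by (subst integral_distr) (auto intro!: measurable_restrict)
  show "expectation (\<lambda>\<omega>. G n \<omega> * F (\<lambda>i\<in>{..<n}. X i \<omega>)) =
    expectation (\<lambda>\<omega>. F (\<lambda>i\<in>{..<n}. d - X (n - Suc i) \<omega>))"
    unfolding discrete_gbm_prod key[OF order.refl] tilt(2)[OF _ J, simplified]
    by (subst integral_distr) (auto intro!: measurable_restrict)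
  have "(\<integral>\<^sup>+\<omega>. ennreal (\<Prod>i\<in>J. exp (X i \<omega> - d / 2)) \<partial>M) =
        (\<integral>\<^sup>+x. ennreal (\<Prod>i\<in>J. exp (x i - d / 2)) \<partial>?D)"
    using measurable_compose[OF m[OF J] measurable_ennreal]
    by (subst nn_integral_distr[OF measurable_X]) (simp_all only: restr[OF J] measurable_distr_eq1)
  also have "\<dots> = emeasure (density ?D (\<lambda>x. ennreal (\<Prod>i\<in>J. exp (x i - d / 2)))) (space ?T)"
    using J by (subst emeasure_density) (auto intro!: nn_integral_cong simp: indicator_def)
  also have "\<dots> = 1"
    unfolding tilt(1)[OF _ J, simplified]
    by (intro prob_space.emeasure_space_1[of "distr _ _ _", simplified] prob_space_distr) (auto intro!: measurable_restrict)
  finally show "integrable M (\<lambda>\<omega>. \<Prod>i\<in>J. exp (X i \<omega> - d / 2))"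
    using J by (intro integrableI_nonneg AE_I2 prod_nonneg) (auto intro!: borel_measurable_prod)
qed

lemma integrable_G: "i \<le> n \<Longrightarrow> integrable M (G i)"
  unfolding discrete_gbm_prod by (intro expectation_tilt(3)[where F = "\<lambda>_. 0"]) auto

text \<open>Since \<open>G (Suc j)\<close> is \<open>G j\<close> times the tilt density of step
  \<open>j\<close>, the expectation of \<open>G (Suc j) * h\<close> equals that of
  \<open>G j\<close> times \<open>h\<close> at the shifted path. Subtracting the expectation of
  \<open>G j * h\<close> and summing over \<open>j\<close>, the left-hand side telescopes to
  \<open>G n - 1\<close>.\<close>

lemma discrete_integration_by_parts:
  fixes h :: "real \<Rightarrow> real \<Rightarrow> real"
  assumes h [measurable]: "(\<lambda>p. h (fst p) (snd p)) \<in> borel_measurable borel"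
    and bound: "\<And>m x. m > 0 \<Longrightarrow> x > 0 \<Longrightarrow> \<bar>h m x\<bar> \<le> C"
  shows "expectation (\<lambda>\<omega>. (G n \<omega> - 1) * h (G n \<omega>) (A n \<omega>)) =
    expectation (\<lambda>\<omega>. \<Sum>j<n. G j \<omega> *
      (h (exp d * G n \<omega>) (A (Suc j) \<omega> + exp d * (A n \<omega> - A (Suc j) \<omega>)) - h (G n \<omega>) (A n \<omega>)))"
proof -
  have h2 [measurable (raw)]: "(\<lambda>x. h (f x) (g x)) \<in> borel_measurable N"
    if "f \<in> borel_measurable N" "g \<in> borel_measurable N" for f g and N :: "'b measure"
    using measurable_compose[OF borel_measurable_Pair[OF that] h] by simp
  have h3 [measurable (raw)]: "(\<lambda>x. h (f x) (g x)) \<in> borel_measurable N"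
    if "f \<in> borel_measurable N" "g \<in> borel_measurable N" for f g and N :: "(nat \<Rightarrow> real) measure"
    using measurable_compose[OF borel_measurable_Pair[OF that] h] by simp
  have int: "integrable M (\<lambda>\<omega>. G j \<omega> * h (f \<omega>) (g \<omega>))"
    if "j \<le> n" "\<And>\<omega>. f \<omega> > 0" "\<And>\<omega>. g \<omega> > 0" "f \<in> borel_measurable M" "g \<in> borel_measurable M" for j f g
  proof (rule Bochner_Integration.integrable_bound)
    show "integrable M (\<lambda>\<omega>. C * G j \<omega>)" using integrable_G[OF that(1)] by simp
    show "(\<lambda>\<omega>. G j \<omega> * h (f \<omega>) (g \<omega>)) \<in> borel_measurable M"
      using that rv_G[OF that(1)] by measurable
    have "\<bar>h (f \<omega>) (g \<omega>)\<bar> \<le> C" "0 \<le> C" for \<omega>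
      using bound[OF that(2,3)[of \<omega>]] by auto
    then show "AE \<omega> in M. norm (G j \<omega> * h (f \<omega>) (g \<omega>)) \<le> norm (C * G j \<omega>)"
      by (intro AE_I2) (simp add: abs_mult mult.commute mult_left_mono less_imp_le)
  qed
  have Apos: "A n \<omega> > 0" for \<omega> using d n by (rule discrete_integral_pos)
  have Bpos: "A (Suc j) \<omega> + exp d * (A n \<omega> - A (Suc j) \<omega>) > 0" if "j < n" for j \<omega>
    using discrete_integral_pos[OF d, of "Suc j" "\<lambda>j. X j \<omega>"] d that
      discrete_integral_mono[of d "Suc j" n "\<lambda>j. X j \<omega>"] by (intro add_pos_nonneg) auto
  have int1: "integrable M (\<lambda>\<omega>. G j \<omega> * h (G n \<omega>) (A n \<omega>))" if "j \<le> n" for j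
    using that Apos by (intro int) auto
  have int2: "integrable M (\<lambda>\<omega>. G j \<omega> * h (exp d * G n \<omega>) (A (Suc j) \<omega> + exp d * (A n \<omega> - A (Suc j) \<omega>)))"
    if "j < n" for j
    using that Bpos by (intro int) auto
  have step: "expectation (\<lambda>\<omega>. G (Suc j) \<omega> * h (G n \<omega>) (A n \<omega>)) =
      expectation (\<lambda>\<omega>. G j \<omega> * h (exp d * G n \<omega>) (A (Suc j) \<omega> + exp d * (A n \<omega> - A (Suc j) \<omega>)))"
    if j: "j < n" for j
  proof -
    \<comment> \<open>The prefactor depends on the steps before \<open>j\<close> only, so the shift
      of step \<open>j\<close> passes through it. This is where the perturbation has to be
      adapted.\<close>
    define F where "F x = discrete_gbm d x j * h (discrete_gbm d x n) (discrete_integral d x n)" for x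
    have [measurable]: "F \<in> borel_measurable (Pi\<^sub>M {..<n} (\<lambda>_. borel))"
      using j unfolding F_def
      by (intro borel_measurable_times borel_measurable_discrete_gbm h3 borel_measurable_discrete_integral) auto
    have "expectation (\<lambda>\<omega>. (\<Prod>i\<in>{j}. exp (X i \<omega> - d / 2)) * F (\<lambda>i\<in>{..<n}. X i \<omega>)) =
      expectation (\<lambda>\<omega>. F (\<lambda>i\<in>{..<n}. X i \<omega> + (if i \<in> {j} then d else 0)))"
      using j by (intro expectation_tilt(1)) auto
    then show ?thesis
      using j by (simp add: F_def discrete_gbm_Suc discrete_gbm_shift discrete_integral_shift mult_ac
          del: singleton_iff insert_iff)
  qed
  have tel: "G n \<omega> - 1 = (\<Sum>j<n. G (Suc j) \<omega> - G j \<omega>)" for \<omega>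
    by (subst sum_lessThan_telescope) (simp add: discrete_gbm_def)
  have "expectation (\<lambda>\<omega>. (G n \<omega> - 1) * h (G n \<omega>) (A n \<omega>)) =
    expectation (\<lambda>\<omega>. \<Sum>j<n. G (Suc j) \<omega> * h (G n \<omega>) (A n \<omega>) - G j \<omega> * h (G n \<omega>) (A n \<omega>))"
    unfolding tel sum_distrib_right left_diff_distrib ..
  also have "\<dots> = (\<Sum>j<n. expectation (\<lambda>\<omega>. G (Suc j) \<omega> * h (G n \<omega>) (A n \<omega>)) -
                        expectation (\<lambda>\<omega>. G j \<omega> * h (G n \<omega>) (A n \<omega>)))"
    using int1 by (subst Bochner_Integration.integral_sum) (auto intro!: sum.cong)
  also have "\<dots> = (\<Sum>j<n. expectation (\<lambda>\<omega>. G j \<omega> *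
       (h (exp d * G n \<omega>) (A (Suc j) \<omega> + exp d * (A n \<omega> - A (Suc j) \<omega>)) - h (G n \<omega>) (A n \<omega>))))"
    using step int1 int2 by (intro sum.cong) (auto simp: right_diff_distrib)
  also have "\<dots> = expectation (\<lambda>\<omega>. \<Sum>j<n. G j \<omega> *
      (h (exp d * G n \<omega>) (A (Suc j) \<omega> + exp d * (A n \<omega> - A (Suc j) \<omega>)) - h (G n \<omega>) (A n \<omega>)))"
    using int1 int2 by (subst Bochner_Integration.integral_sum) (auto simp: right_diff_distrib)
  finally show ?thesis .
qed

text \<open>Along the reflected and reversed steps the walk at time \<open>Suc i\<close> equals
  \<open>G (n - Suc i) / G n\<close>. The sum on the left must therefore run over right endpoints:
  reversal turns it into the left-endpoint sum \<open>A n\<close>, divided by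
  \<open>G n\<close>.\<close>

lemma discrete_reversal:
  fixes f :: "real \<Rightarrow> real"
  assumes f [measurable]: "f \<in> borel_measurable borel"
  shows "expectation (\<lambda>\<omega>. G n \<omega> * f (\<Sum>i<n. d * G (Suc i) \<omega>)) = expectation (\<lambda>\<omega>. f (A n \<omega> / G n \<omega>))"
proof -
  define F where "F x = f (\<Sum>i<n. d * discrete_gbm d x (Suc i))" for x
  have [measurable]: "F \<in> borel_measurable (Pi\<^sub>M {..<n} (\<lambda>_. borel))"
    unfolding F_def by measurable
  have rev: "discrete_gbm d (\<lambda>i\<in>{..<n}. d - x (n - Suc i)) (Suc i) =
      discrete_gbm d x (n - Suc i) / discrete_gbm d x n" if i: "i < n" for x i
  proof -
    have "discrete_gbm d (\<lambda>i\<in>{..<n}. d - x (n - Suc i)) (Suc i) = exp (\<Sum>j<Suc i. d / 2 - x (n - Suc j))"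
      using i by (subst discrete_gbm_restrict) (auto simp: discrete_gbm_def intro!: sum.cong)
    also have "(\<Sum>j<Suc i. d / 2 - x (n - Suc j)) = (\<Sum>k\<in>{n - Suc i..<n}. d / 2 - x k)"
      using i by (intro sum.reindex_bij_witness[of _ "\<lambda>k. n - Suc k" "\<lambda>k. n - Suc k"]) auto
    also have "\<dots> = (\<Sum>k<n - Suc i. x k - d / 2) - (\<Sum>k<n. x k - d / 2)"
    proof -
      have "{..<n} = {..<n - Suc i} \<union> {n - Suc i..<n}" using i by auto
      then have "(\<Sum>k<n. x k - d / 2) = (\<Sum>k<n - Suc i. x k - d / 2) + (\<Sum>k\<in>{n - Suc i..<n}. x k - d / 2)"
        by (metis sum.union_disjoint finite_lessThan finite_atLeastLessThan ivl_disj_int_one(2))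
      then show ?thesis by (simp add: sum_subtractf)
    qed
    finally show ?thesis by (simp add: discrete_gbm_def exp_diff)
  qed
  have "(\<Sum>i<n. d * discrete_gbm d (\<lambda>i\<in>{..<n}. d - x (n - Suc i)) (Suc i)) =
      discrete_integral d x n / discrete_gbm d x n" for x
  proof -
    have "(\<Sum>i<n. d * discrete_gbm d (\<lambda>i\<in>{..<n}. d - x (n - Suc i)) (Suc i)) =
        (\<Sum>i<n. d * (discrete_gbm d x (n - Suc i) / discrete_gbm d x n))"
      by (intro sum.cong refl) (simp only: rev lessThan_iff)
    also have "\<dots> = (\<Sum>i<n. d * (discrete_gbm d x i / discrete_gbm d x n))"
      by (rule sum.nat_diff_reindex)
    finally show ?thesis by (simp add: discrete_integral_def sum_divide_distrib)
  qed
  from this[of "\<lambda>j. X j _"]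
  have 1: "F (\<lambda>i\<in>{..<n}. d - X (n - Suc i) \<omega>) = f (A n \<omega> / G n \<omega>)" for \<omega>
    by (simp only: F_def)
  have 2: "F (\<lambda>i\<in>{..<n}. X i \<omega>) = f (\<Sum>i<n. d * G (Suc i) \<omega>)" for \<omega>
    unfolding F_def by (intro arg_cong[of _ _ f] sum.cong) auto
  show ?thesis
    using expectation_tilt(2)[of "{}" F] by (simp add: 1 2)
qed

end

section \<open>Passage to the limit for test functions\<close>

text \<open>On each cell the mean value theorem for the primitive expresses the exact contribution
  by a value of \<open>f\<close> inside the cell, which uniform continuity compares with the value
  at the left endpoint.\<close>

lemma riemann_sum_tendsto:
  fixes f :: "real \<Rightarrow> real"
  assumes f: "continuous_on {0..t} f" and t: "t > 0"
  shows "(\<lambda>n. \<Sum>i<n. t / real n * f (real i * t / real n)) \<longlonglongrightarrow> (LBINT s:{0..t}. f s)"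
proof -
  define F where "F x = integral {0..x} f" for x
  have F': "(F has_real_derivative f x) (at x within {0..t})" if "x \<in> {0..t}" for x
    using integral_has_real_derivative[OF f that] by (simp add: F_def[abs_def])
  have Ft: "(LBINT s:{0..t}. f s) = F t"
    unfolding F_def using f by (intro set_borel_integral_eq_integral borel_integrable_atLeastAtMost')
  have uc: "uniformly_continuous_on {0..t} f"
    using f by (intro compact_uniformly_continuous) auto
  show ?thesis
    unfolding Ft
  proof (rule LIMSEQ_I)
    fix e :: real assume e: "e > 0"
    \<comment> \<open>The \<open>n\<close> cell errors of size \<open>t / real n * e'\<close> add up
      to \<open>e / 2\<close>, which leaves a strict inequality at the end.\<close>
    define e' where "e' = e / (2 * t)"
    have "e' > 0" using e t by (simp add: e'_def)
    with uc obtain r where r: "r > 0"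
      "\<And>x y. x \<in> {0..t} \<Longrightarrow> y \<in> {0..t} \<Longrightarrow> dist y x < r \<Longrightarrow> dist (f y) (f x) < e'"
      unfolding uniformly_continuous_on_def by metis
    obtain N :: nat where N: "t / r < real N" using reals_Archimedean2 by blast
    show "\<exists>no. \<forall>n\<ge>no. norm ((\<Sum>i<n. t / real n * f (real i * t / real n)) - F t) < e"
    proof (intro exI[of _ "Suc N"] allI impI)
      fix n assume n: "n \<ge> Suc N"
      define p where "p i = real i * t / real n" for i
      have n0: "real n > 0" using n by simp
      have "t / r < real n" using N n by simp
      then have step: "t / real n < r" using r(1) n0 by (simp add: field_simps)
      have pS: "p (Suc i) = p i + t / real n" for i by (simp add: p_def distrib_right add_divide_distrib)
      have p: "0 \<le> p i" "p (Suc i) \<le> t" "p i < p (Suc i)" if "i < n" for i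
      proof -
        have "real (Suc i) * t \<le> real n * t" using that t by (intro mult_right_mono) auto
        then show "p (Suc i) \<le> t" using n0 by (simp add: p_def field_simps)
      qed (use t n0 in \<open>auto simp: p_def field_simps\<close>)
      have bound: "\<bar>t / real n * f (p i) - (F (p (Suc i)) - F (p i))\<bar> \<le> t / real n * e'" if i: "i < n" for i
      proof -
        have "\<exists>x. p i < x \<and> x < p (Suc i) \<and> F (p (Suc i)) - F (p i) = (p (Suc i) - p i) * f x"
        proof -
          have "continuous_on {p i..p (Suc i)} F"
            using p[OF i] by (intro continuous_on_subset[OF DERIV_continuous_on[OF F']]) auto
          moreover have "(F has_derivative (\<lambda>h. h * f x)) (at x)" if "p i < x" "x < p (Suc i)" for x
            using F'[of x] that p[OF i] by (simp add: at_within_Icc_at has_field_derivative_def mult_commute_abs)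
          ultimately show ?thesis
            using mvt[OF p(3)[OF i], of F "\<lambda>x h. h * f x"] by metis
        qed
        then obtain x where x: "p i < x" "x < p (Suc i)" "F (p (Suc i)) - F (p i) = (p (Suc i) - p i) * f x"
          by blast
        have "dist (f x) (f (p i)) < e'"
          using x p[OF i] step by (intro r(2)) (auto simp: dist_real_def pS)
        then have "\<bar>f (p i) - f x\<bar> \<le> e'" by (simp add: dist_real_def)
        then have "t / real n * \<bar>f (p i) - f x\<bar> \<le> t / real n * e'"
          using t by (intro mult_left_mono) auto
        moreover have "t / real n * f (p i) - (F (p (Suc i)) - F (p i)) = t / real n * (f (p i) - f x)"
          by (simp only: x(3)) (simp add: pS algebra_simps)
        ultimately show ?thesis using t by (simp add: abs_mult)
      qed
      have "F t = (\<Sum>i<n. F (p (Suc i)) - F (p i))"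
        using n0 by (subst sum_lessThan_telescope) (simp add: p_def F_def)
      then have "\<bar>(\<Sum>i<n. t / real n * f (p i)) - F t\<bar> = \<bar>\<Sum>i<n. t / real n * f (p i) - (F (p (Suc i)) - F (p i))\<bar>"
        by (simp add: sum_subtractf)
      also have "\<dots> \<le> (\<Sum>i<n. t / real n * e')"
        by (intro order_trans[OF sum_abs] sum_mono bound) auto
      also have "\<dots> = e / 2" using n0 t by (simp add: e'_def)
      also have "\<dots> < e" using e by simp
      finally show "norm ((\<Sum>i<n. t / real n * f (real i * t / real n)) - F t) < e"
        by (simp add: p_def)
    qed
  qed
qed

text \<open>\<open>uw\<close> and \<open>ux\<close> are the partial derivatives of \<open>u\<close>,
  encoded by the chain rule along curves because \<open>u\<close> is only ever differentiated along
  the path of a shift. The cutoff in \<open>vanish\<close> concerns the derivatives; together with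
  \<open>bounds\<close> it yields estimates uniform in the number of steps.\<close>

locale test_function =
  fixes u uw ux :: "real \<Rightarrow> real \<Rightarrow> real" and C v b :: real
  assumes chain: "\<And>w x w' x' s. (w has_real_derivative w') (at s) \<Longrightarrow> (x has_real_derivative x') (at s) \<Longrightarrow>
      w s > 0 \<Longrightarrow> x s > 0 \<Longrightarrow>
      ((\<lambda>s. u (w s) (x s)) has_real_derivative (uw (w s) (x s) * w' + ux (w s) (x s) * x')) (at s)"
    and isCont_u: "\<And>w x. w > 0 \<Longrightarrow> x > 0 \<Longrightarrow> isCont (\<lambda>p. u (fst p) (snd p)) (w, x)"
    and isCont_uw: "\<And>w x. w > 0 \<Longrightarrow> x > 0 \<Longrightarrow> isCont (\<lambda>p. uw (fst p) (snd p)) (w, x)"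
    and isCont_ux: "\<And>w x. w > 0 \<Longrightarrow> x > 0 \<Longrightarrow> isCont (\<lambda>p. ux (fst p) (snd p)) (w, x)"
    and bounds: "\<And>w x. w > 0 \<Longrightarrow> x > 0 \<Longrightarrow> \<bar>u w x\<bar> \<le> C \<and> \<bar>uw w x\<bar> \<le> C \<and> \<bar>ux w x\<bar> \<le> C"
    and vanish: "\<And>w x. w > 0 \<Longrightarrow> x > 0 \<Longrightarrow> w > v \<or> x > b \<Longrightarrow> uw w x = 0 \<and> ux w x = 0"
    and measurable_u: "(\<lambda>p. u (fst p) (snd p)) \<in> borel_measurable borel"
    and v: "v > 0" and b: "b > 0"
begin

text \<open>The test function in the coordinates (final value, integral), where the shift of one
  step acts by multiplication with \<open>exp d\<close>.\<close>

definition h :: "real \<Rightarrow> real \<Rightarrow> real" where "h m x = u (m / x\<^sup>2) x"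

text \<open>The derivative at \<open>s = 0\<close> of \<open>h (exp s * m) (x - z + exp s * z)\<close>, where \<open>w = m / x\<^sup>2\<close>.\<close>
definition D :: "real \<Rightarrow> real \<Rightarrow> real \<Rightarrow> real" where
  "D w x z = w * uw w x + z * (ux w x - 2 * w * uw w x / x)"

lemma C_nonneg: "C \<ge> 0" using bounds[of 1 1] by auto

text \<open>Grouped as \<open>w * uw w x * (1 - 2 * z / x) + z * ux w x\<close>, the estimate
  contains no inverse power of \<open>x\<close>: the bracket has modulus at most 1 for
  \<open>0 \<le> z \<le> x\<close>, and \<open>w\<close> and \<open>z\<close> are bounded by
  \<open>v\<close> and \<open>b\<close> where the derivatives are nonzero.\<close>

lemma abs_D_le:
  assumes w: "w > 0" and z: "0 \<le> z" "z \<le> x" and x: "x > 0"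
  shows "\<bar>D w x z\<bar> \<le> (if x \<le> b then (v + b) * C else 0)"
proof (cases "w > v \<or> x > b")
  case True
  then show ?thesis using vanish[OF w x True] C_nonneg v b by (auto simp: D_def)
next
  case False
  have "D w x z = (w * uw w x) * (1 - 2 * z / x) + z * ux w x"
    using x by (simp add: D_def field_simps)
  also have "\<bar>\<dots>\<bar> \<le> \<bar>w * uw w x\<bar> * \<bar>1 - 2 * z / x\<bar> + \<bar>z * ux w x\<bar>"
    by (metis abs_mult abs_triangle_ineq)
  also have "\<dots> \<le> (v * C) * 1 + b * C"
  proof (intro add_mono mult_mono)
    show "\<bar>w * uw w x\<bar> \<le> v * C" "\<bar>z * ux w x\<bar> \<le> b * C"
      using bounds[OF w x] False w z unfolding abs_mult by (auto intro!: mult_mono)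
    have "z / x \<le> 1" "0 \<le> z / x" using z x by auto
    then show "\<bar>1 - 2 * z / x\<bar> \<le> 1" by (auto simp: abs_le_iff)
    show "0 \<le> v * C" using v C_nonneg by simp
  qed auto
  finally show ?thesis using False by (simp add: algebra_simps)
qed

text \<open>The mean value theorem on the interval from 0 to \<open>d\<close> along the curve
  \<open>s \<mapsto> (exp s * m, y + exp s * c)\<close>, which joins the original path to the
  shifted one; \<open>c\<close> is the part of the integral after the shifted step.\<close>

lemma h_increment:
  assumes m: "m > 0" and y: "y > 0" and c: "c \<ge> 0" and d: "d > 0"
  obtains s where "0 < s" "s < d"
    "h (exp d * m) (y + exp d * c) - h m (y + c) =
      d * D (exp s * m / (y + exp s * c)\<^sup>2) (y + exp s * c) (exp s * c)"
proof -
  define f where "f s = h (exp s * m) (y + exp s * c)" for s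
  have pos: "y + exp s * c > 0" for s using y c by (simp add: add_pos_nonneg)
  have f': "(f has_real_derivative D (exp s * m / (y + exp s * c)\<^sup>2) (y + exp s * c) (exp s * c)) (at s)" for s
  proof -
    let ?x = "y + exp s * c" and ?w = "exp s * m / (y + exp s * c)\<^sup>2"
    have "((\<lambda>s. u (exp s * m / (y + exp s * c)\<^sup>2) (y + exp s * c)) has_real_derivative
        (uw ?w ?x * (?w * (1 - 2 * (exp s * c) / ?x)) + ux ?w ?x * (exp s * c))) (at s)"
    proof (rule chain)
      show "((\<lambda>s. exp s * m / (y + exp s * c)\<^sup>2) has_real_derivative ?w * (1 - 2 * (exp s * c) / ?x)) (at s)"
      proof -
        have eq: "(E * m * X\<^sup>2 - E * m * (2 * X * z)) / (X\<^sup>2 * X\<^sup>2) = E * m / X\<^sup>2 * (1 - 2 * z / X)" if "X > 0" for E X z :: real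
          using that by (simp add: field_simps power2_eq_square)
        have "((\<lambda>s. exp s * m / (y + exp s * c)\<^sup>2) has_real_derivative
            (exp s * m * ?x\<^sup>2 - exp s * m * (2 * ?x * (exp s * c))) / (?x\<^sup>2 * ?x\<^sup>2)) (at s)"
          using pos[of s] by (auto intro!: derivative_eq_intros)
        then show ?thesis unfolding eq[OF pos[of s]] .
      qed
      show "((\<lambda>s. y + exp s * c) has_real_derivative exp s * c) (at s)"
        by (auto intro!: derivative_eq_intros)
      show "?w > 0" using pos[of s] m by simp
      show "?x > 0" by (rule pos)
    qed
    moreover have "uw ?w ?x * (?w * (1 - 2 * (exp s * c) / ?x)) + ux ?w ?x * (exp s * c) = D ?w ?x (exp s * c)"
      by (simp add: D_def algebra_simps)
    ultimately show ?thesis by (simp add: f_def[abs_def] h_def)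
  qed
  from MVT2[OF d, of f, OF f'] obtain s where "0 < s" "s < d"
    "f d - f 0 = (d - 0) * D (exp s * m / (y + exp s * c)\<^sup>2) (y + exp s * c) (exp s * c)"
    by blast
  then show ?thesis by (intro that[of s]) (auto simp: f_def)
qed

text \<open>Here \<open>e j\<close> stands for \<open>d\<close> times the walk at \<open>j\<close>,
  so \<open>e j / d\<close> is the weight in the discrete formula and the factor \<open>d\<close> of
  the mean value theorem cancels. The partial sum \<open>y j\<close> includes index
  \<open>j\<close>, the last term that the shift of step \<open>j\<close> leaves alone.\<close>

lemma weighted_sum_increments:
  fixes e :: "nat \<Rightarrow> real" and n :: nat
  defines "S \<equiv> \<Sum>i<n. e i" and "y \<equiv> \<lambda>j. \<Sum>i<Suc j. e i"
  assumes n: "n > 0" and m: "m > 0" and d: "d > 0" and e: "\<And>i. e i > 0"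
  obtains s where "\<And>j. j < n \<Longrightarrow> 0 < s j \<and> s j < d"
    "(\<Sum>j<n. e j / d * (h (exp d * m) (y j + exp d * (S - y j)) - h m S)) =
     (\<Sum>j<n. e j * D (exp (s j) * m / (y j + exp (s j) * (S - y j))\<^sup>2) (y j + exp (s j) * (S - y j)) (exp (s j) * (S - y j)))"
proof -
  have y: "y j > 0" for j unfolding y_def using e by (intro sum_pos) auto
  have yS: "y j \<le> S" if "j < n" for j
    unfolding y_def S_def using e that by (intro sum_mono2) (auto intro: less_imp_le)
  have "\<exists>s. 0 < s \<and> s < d \<and> h (exp d * m) (y j + exp d * (S - y j)) - h m S =
      d * D (exp s * m / (y j + exp s * (S - y j))\<^sup>2) (y j + exp s * (S - y j)) (exp s * (S - y j))"
    if "j < n" for j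
    using h_increment[OF m y[of j] _ d, of "S - y j"] yS[OF that] by (smt (verit))
  then obtain s where s: "\<And>j. j < n \<Longrightarrow> 0 < s j \<and> s j < d \<and> h (exp d * m) (y j + exp d * (S - y j)) - h m S =
      d * D (exp (s j) * m / (y j + exp (s j) * (S - y j))\<^sup>2) (y j + exp (s j) * (S - y j)) (exp (s j) * (S - y j))"
    by metis
  show ?thesis
    using s d by (intro that[of s]) (auto intro!: sum.cong)
qed

text \<open>The total weight is \<open>S\<close>, and every summand vanishes once
  \<open>S > b\<close>. This constant bound, uniform in the number of steps, is the majorant for the
  passage to the limit.\<close>

lemma abs_weighted_sum_increments_le:
  fixes e :: "nat \<Rightarrow> real" and n :: nat
  defines "S \<equiv> \<Sum>i<n. e i" and "y \<equiv> \<lambda>j. \<Sum>i<Suc j. e i"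
  assumes n: "n > 0" and m: "m > 0" and d: "d > 0" and e: "\<And>i. e i > 0"
  shows "\<bar>\<Sum>j<n. e j / d * (h (exp d * m) (y j + exp d * (S - y j)) - h m S)\<bar> \<le> b * ((v + b) * C)"
proof -
  obtain s where s: "\<And>j. j < n \<Longrightarrow> 0 < s j \<and> s j < d"
    and eq: "(\<Sum>j<n. e j / d * (h (exp d * m) (y j + exp d * (S - y j)) - h m S)) =
     (\<Sum>j<n. e j * D (exp (s j) * m / (y j + exp (s j) * (S - y j))\<^sup>2) (y j + exp (s j) * (S - y j)) (exp (s j) * (S - y j)))"
    unfolding S_def y_def by (rule weighted_sum_increments[where e = e, OF n m d]) (use e in blast)+
  have y: "y j > 0" for j unfolding y_def using e by (intro sum_pos) auto
  have yS: "y j \<le> S" if "j < n" for j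
    unfolding y_def S_def using e that by (intro sum_mono2) (auto intro: less_imp_le)
  have S0: "S > 0" unfolding S_def using n e by (intro sum_pos) auto
  have C': "(v + b) * C \<ge> 0" using v b C_nonneg by simp
  have "\<bar>D (exp (s j) * m / (y j + exp (s j) * (S - y j))\<^sup>2) (y j + exp (s j) * (S - y j)) (exp (s j) * (S - y j))\<bar>
      \<le> (if S \<le> b then (v + b) * C else 0)" if j: "j < n" for j
  proof -
    \<comment> \<open>An intermediate point never decreases the integral, because
      \<open>exp (s j)\<close> exceeds 1. So the cutoff at \<open>b\<close>, imposed at the
      intermediate point, is a cutoff for \<open>S\<close> as well.\<close>
    have "1 * (S - y j) \<le> exp (s j) * (S - y j)"
      using s[OF j] yS[OF j] by (intro mult_right_mono) auto
    then have "S \<le> y j + exp (s j) * (S - y j)" by simp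
    moreover have "\<bar>D (exp (s j) * m / (y j + exp (s j) * (S - y j))\<^sup>2) (y j + exp (s j) * (S - y j)) (exp (s j) * (S - y j))\<bar>
      \<le> (if y j + exp (s j) * (S - y j) \<le> b then (v + b) * C else 0)"
      using y[of j] yS[OF j] m by (intro abs_D_le) (auto intro!: divide_pos_pos zero_less_power add_pos_nonneg)
    ultimately show ?thesis using C' by (auto split: if_splits)
  qed
  then have "\<bar>\<Sum>j<n. e j * D (exp (s j) * m / (y j + exp (s j) * (S - y j))\<^sup>2) (y j + exp (s j) * (S - y j)) (exp (s j) * (S - y j))\<bar>
     \<le> (\<Sum>j<n. e j * (if S \<le> b then (v + b) * C else 0))"
    using e by (intro order_trans[OF sum_abs] sum_mono) (auto simp: abs_mult less_imp_le)
  also have "\<dots> = S * (if S \<le> b then (v + b) * C else 0)"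
    by (simp add: S_def sum_distrib_right)
  also have "\<dots> \<le> b * ((v + b) * C)"
    using C' b by (auto intro: mult_right_mono)
  finally show ?thesis by (simp only: eq)
qed

text \<open>In the limit all intermediate points may be replaced by
  \<open>(m0 / a\<^sup>2, a)\<close>, leaving \<open>\<Sum>k. e k * (p + c k * r)\<close> with
  \<open>c k\<close> the part of \<open>S\<close> beyond index \<open>k\<close>. This is a discrete
  version of the double integral of the path over pairs of ordered times, hence the factor
  \<open>a\<^sup>2 / 2\<close>.\<close>

lemma tendsto_weighted_sum_increments:
  fixes e :: "nat \<Rightarrow> nat \<Rightarrow> real" and d m :: "nat \<Rightarrow> real"
  defines "S \<equiv> \<lambda>n. \<Sum>i<n. e n i" and "y \<equiv> \<lambda>n j. \<Sum>i<Suc j. e n i"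
  assumes e: "\<And>n i. n > 0 \<Longrightarrow> e n i > 0" and d: "\<And>n. n > 0 \<Longrightarrow> d n > 0"
    and m: "\<And>n. m n > 0"
    and d_lim: "d \<longlonglongrightarrow> 0" and m_lim: "m \<longlonglongrightarrow> m0" and m0: "m0 > 0"
    and S_lim: "S \<longlonglongrightarrow> a" and a: "a > 0"
    and sq: "(\<lambda>n. \<Sum>i<n. (e n i)\<^sup>2) \<longlonglongrightarrow> 0"
  shows "(\<lambda>n. \<Sum>j<n. e n j / d n * (h (exp (d n) * m n) (y n j + exp (d n) * (S n - y n j)) - h (m n) (S n)))
    \<longlonglongrightarrow> a\<^sup>2 / 2 * ux (m0 / a\<^sup>2) a"
proof -
  define p where "p w x = w * uw w x" for w x
  define r where "r w x = ux w x - 2 * w * uw w x / x" for w x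
  let ?w0 = "m0 / a\<^sup>2"
  let ?T = "\<lambda>n. \<Sum>j<n. e n j / d n * (h (exp (d n) * m n) (y n j + exp (d n) * (S n - y n j)) - h (m n) (S n))"
  have w0: "?w0 > 0" using m0 a by simp
  have "\<forall>n. \<exists>s. n > 0 \<longrightarrow> (\<forall>j<n. 0 < s j \<and> s j < d n) \<and> ?T n =
     (\<Sum>j<n. e n j * D (exp (s j) * m n / (y n j + exp (s j) * (S n - y n j))\<^sup>2) (y n j + exp (s j) * (S n - y n j)) (exp (s j) * (S n - y n j)))"
  proof
    fix n
    show "\<exists>s. n > 0 \<longrightarrow> (\<forall>j<n. 0 < s j \<and> s j < d n) \<and> ?T n =
     (\<Sum>j<n. e n j * D (exp (s j) * m n / (y n j + exp (s j) * (S n - y n j))\<^sup>2) (y n j + exp (s j) * (S n - y n j)) (exp (s j) * (S n - y n j)))"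
    proof (cases "n > 0")
      case True
      show ?thesis
        unfolding S_def y_def
        by (rule weighted_sum_increments[where e = "e n", OF True m[of n] d[OF True]]) (use e True in blast)+
    qed simp
  qed
  from choice[OF this] obtain s where s': "\<forall>n. n > 0 \<longrightarrow> (\<forall>j<n. 0 < s n j \<and> s n j < d n) \<and> ?T n =
     (\<Sum>j<n. e n j * D (exp (s n j) * m n / (y n j + exp (s n j) * (S n - y n j))\<^sup>2) (y n j + exp (s n j) * (S n - y n j)) (exp (s n j) * (S n - y n j)))" ..
  have s: "0 < s n j \<and> s n j < d n" if "j < n" for n j
  proof -
    have "n > 0" using that by simp
    with s' that show ?thesis by blast
  qed
  have T: "?T n =
     (\<Sum>j<n. e n j * D (exp (s n j) * m n / (y n j + exp (s n j) * (S n - y n j))\<^sup>2) (y n j + exp (s n j) * (S n - y n j)) (exp (s n j) * (S n - y n j)))"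
    if "n > 0" for n using s' that by blast
  define c where "c n j = S n - y n j" for n j
  define x where "x n j = y n j + exp (s n j) * c n j" for n j
  define w where "w n j = exp (s n j) * m n / (x n j)\<^sup>2" for n j
  define Q where "Q n j = D (w n j) (x n j) (exp (s n j) * c n j) - (p ?w0 a + c n j * r ?w0 a)" for n j
  have y: "y n j > 0" if "n > 0" for n j unfolding y_def using e[OF that] by (intro sum_pos) auto
  have c: "0 \<le> c n j" "c n j \<le> S n" if "j < n" for n j
  proof -
    have "n > 0" using that by auto
    have "y n j \<le> S n"
      unfolding y_def S_def using e that by (intro sum_mono2) (auto intro: less_imp_le)
    then show "0 \<le> c n j" "c n j \<le> S n" using y[OF \<open>n > 0\<close>, of j] by (auto simp: c_def)
  qed
  \<comment> \<open>For each \<open>n\<close> an index with the largest error is selected. The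
    uniform estimate over all indices then reduces to continuity along one sequence.\<close>
  have "\<exists>j. \<forall>n>0. j n < n \<and> (\<forall>k<n. \<bar>Q n k\<bar> \<le> \<bar>Q n (j n)\<bar>)"
  proof -
    have "\<exists>j. n > 0 \<longrightarrow> j < n \<and> (\<forall>k<n. \<bar>Q n k\<bar> \<le> \<bar>Q n j\<bar>)" for n
    proof (cases "n > 0")
      case True
      then have "Max ((\<lambda>k. \<bar>Q n k\<bar>) ` {..<n}) \<in> (\<lambda>k. \<bar>Q n k\<bar>) ` {..<n}"
        by (intro Max_in) auto
      then obtain j where "j < n" "Max ((\<lambda>k. \<bar>Q n k\<bar>) ` {..<n}) = \<bar>Q n j\<bar>" by auto
      moreover have "\<bar>Q n k\<bar> \<le> Max ((\<lambda>k. \<bar>Q n k\<bar>) ` {..<n})" if "k < n" for k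
        using that by (intro Max_ge) auto
      ultimately show ?thesis by auto
    qed simp
    then show ?thesis by (intro choice_iff[THEN iffD1]) simp
  qed
  then obtain j where j': "\<forall>n>0. j n < n \<and> (\<forall>k<n. \<bar>Q n k\<bar> \<le> \<bar>Q n (j n)\<bar>)" ..
  have j: "j n < n" if "n > 0" for n using j' that by blast
  have jmax: "\<bar>Q n k\<bar> \<le> \<bar>Q n (j n)\<bar>" if "k < n" for n k
  proof -
    have "n > 0" using that by simp
    with j' that show ?thesis by blast
  qed
  have ev: "eventually (\<lambda>n. n > 0) sequentially" by (rule eventually_gt_at_top)
  have s_lim: "(\<lambda>n. s n (j n)) \<longlonglongrightarrow> 0"
    by (rule real_tendsto_sandwich[OF _ _ tendsto_const d_lim];
        rule eventually_mono[OF ev]) (use s j in \<open>auto intro: less_imp_le\<close>)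
  have exp_lim: "(\<lambda>n. exp (s n (j n))) \<longlonglongrightarrow> 1"
    using tendsto_exp[OF s_lim] by simp
  have null: "(\<lambda>n. (exp (s n (j n)) - 1) * S n) \<longlonglongrightarrow> 0"
    using tendsto_mult[OF tendsto_diff[OF exp_lim tendsto_const[of 1]] S_lim] by simp
  have null': "(\<lambda>n. (exp (s n (j n)) - 1) * c n (j n)) \<longlonglongrightarrow> 0"
    by (rule Lim_null_comparison[OF eventually_mono[OF ev] null])
      (use c j s in \<open>auto simp: abs_mult less_imp_le intro!: mult_mono\<close>)
  have x_lim: "(\<lambda>n. x n (j n)) \<longlonglongrightarrow> a"
  proof -
    have "x n (j n) = S n + (exp (s n (j n)) - 1) * c n (j n)" for n
      by (simp add: x_def c_def algebra_simps)
    then show ?thesis using tendsto_add[OF S_lim null'] by simp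
  qed
  have w_lim: "(\<lambda>n. w n (j n)) \<longlonglongrightarrow> ?w0"
    unfolding w_def using a
    using tendsto_divide[OF tendsto_mult[OF exp_lim m_lim] tendsto_power[OF x_lim, of 2]] by simp
  have pcont: "isCont (\<lambda>q. p (fst q) (snd q)) (?w0, a)"
    unfolding p_def using isCont_uw[OF w0 a] by (intro continuous_intros)
  have rcont: "isCont (\<lambda>q. r (fst q) (snd q)) (?w0, a)"
    unfolding r_def using isCont_uw[OF w0 a] isCont_ux[OF w0 a] a by (intro continuous_intros) auto
  have p_lim: "(\<lambda>n. p (w n (j n)) (x n (j n))) \<longlonglongrightarrow> p ?w0 a"
    using isCont_tendsto_compose[OF pcont tendsto_Pair[OF w_lim x_lim]] by simp
  have r_lim: "(\<lambda>n. r (w n (j n)) (x n (j n))) \<longlonglongrightarrow> r ?w0 a"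
    using isCont_tendsto_compose[OF rcont tendsto_Pair[OF w_lim x_lim]] by simp
  have cr: "(\<lambda>n. c n (j n) * (r (w n (j n)) (x n (j n)) - r ?w0 a)) \<longlonglongrightarrow> 0"
  proof (rule Lim_null_comparison)
    show "(\<lambda>n. S n * \<bar>r (w n (j n)) (x n (j n)) - r ?w0 a\<bar>) \<longlonglongrightarrow> 0"
      using tendsto_mult[OF S_lim tendsto_rabs[OF tendsto_diff[OF r_lim tendsto_const[of "r ?w0 a"]]]] by simp
    show "\<forall>\<^sub>F n in sequentially. norm (c n (j n) * (r (w n (j n)) (x n (j n)) - r ?w0 a))
        \<le> S n * \<bar>r (w n (j n)) (x n (j n)) - r ?w0 a\<bar>"
      by (rule eventually_mono[OF ev]) (use c j in \<open>auto simp: abs_mult intro!: mult_right_mono\<close>)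
  qed
  have Q_lim: "(\<lambda>n. Q n (j n)) \<longlonglongrightarrow> 0"
  proof -
    have "Q n k = (p (w n k) (x n k) - p ?w0 a) + ((exp (s n k) - 1) * c n k) * r (w n k) (x n k)
        + c n k * (r (w n k) (x n k) - r ?w0 a)" for n k
    proof -
      have "D w x z = p w x + z * r w x" for w x z by (simp add: D_def p_def r_def)
      then show ?thesis by (simp add: Q_def algebra_simps)
    qed
    moreover have "(\<lambda>n. (p (w n (j n)) (x n (j n)) - p ?w0 a) + ((exp (s n (j n)) - 1) * c n (j n)) * r (w n (j n)) (x n (j n))
        + c n (j n) * (r (w n (j n)) (x n (j n)) - r ?w0 a)) \<longlonglongrightarrow> (p ?w0 a - p ?w0 a) + 0 * r ?w0 a + 0"
      by (intro tendsto_intros p_lim r_lim cr null')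
    ultimately show ?thesis by simp
  qed
  have main: "(\<lambda>n. \<Sum>k<n. e n k * (p ?w0 a + c n k * r ?w0 a)) \<longlonglongrightarrow> a\<^sup>2 / 2 * ux ?w0 a"
  proof -
    \<comment> \<open>The left-hand side sums \<open>e n k * e n i\<close> over pairs
      \<open>k < i\<close>; the full square counts each pair twice and adds the diagonal.\<close>
    have "(\<Sum>k<n. e n k * c n k) = ((S n)\<^sup>2 - (\<Sum>i<n. (e n i)\<^sup>2)) / 2" for n
    proof -
      have "(\<Sum>k<N. e n k * ((\<Sum>i<N. e n i) - (\<Sum>i<Suc k. e n i))) = ((\<Sum>i<N. e n i)\<^sup>2 - (\<Sum>i<N. (e n i)\<^sup>2)) / 2" for N
      proof (induction N)
        case (Suc N)
        have "(\<Sum>k<Suc N. e n k * ((\<Sum>i<Suc N. e n i) - (\<Sum>i<Suc k. e n i))) =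
          (\<Sum>k<N. e n k * ((\<Sum>i<N. e n i) - (\<Sum>i<Suc k. e n i)) + e n k * e n N)"
          by (simp add: algebra_simps)
        also have "\<dots> = ((\<Sum>i<N. e n i)\<^sup>2 - (\<Sum>i<N. (e n i)\<^sup>2)) / 2 + (\<Sum>k<N. e n k) * e n N"
          by (simp only: sum.distrib Suc.IH sum_distrib_right)
        also have "\<dots> = ((\<Sum>i<Suc N. e n i)\<^sup>2 - (\<Sum>i<Suc N. (e n i)\<^sup>2)) / 2"
          by (simp add: power2_eq_square field_simps)
        finally show ?case .
      qed simp
      then show ?thesis by (simp add: c_def y_def S_def)
    qed
    then have "(\<Sum>k<n. e n k * (p ?w0 a + c n k * r ?w0 a)) =
        S n * p ?w0 a + ((S n)\<^sup>2 - (\<Sum>i<n. (e n i)\<^sup>2)) / 2 * r ?w0 a" for n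
      by (simp add: distrib_left sum.distrib S_def flip: sum_distrib_right mult.assoc)
    moreover have "(\<lambda>n. S n * p ?w0 a + ((S n)\<^sup>2 - (\<Sum>i<n. (e n i)\<^sup>2)) / 2 * r ?w0 a)
        \<longlonglongrightarrow> a * p ?w0 a + (a\<^sup>2 - 0) / 2 * r ?w0 a"
      by (intro tendsto_intros S_lim sq) auto
    \<comment> \<open>The contributions of \<open>uw\<close> cancel: to first order the combined
      perturbation keeps \<open>m / x\<^sup>2\<close> fixed. This is why the ratio is the right
      companion variable.\<close>
    moreover have "a * p ?w0 a + (a\<^sup>2 - 0) / 2 * r ?w0 a = a\<^sup>2 / 2 * ux ?w0 a"
      using a by (simp add: p_def r_def field_simps power2_eq_square)
    ultimately show ?thesis by (simp only:)
  qed
  have "(\<lambda>n. ?T n - (\<Sum>k<n. e n k * (p ?w0 a + c n k * r ?w0 a))) \<longlonglongrightarrow> 0"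
  proof (rule Lim_null_comparison)
    show "(\<lambda>n. S n * \<bar>Q n (j n)\<bar>) \<longlonglongrightarrow> 0"
      using tendsto_mult[OF S_lim tendsto_rabs[OF Q_lim]] by simp
    show "\<forall>\<^sub>F n in sequentially. norm (?T n - (\<Sum>k<n. e n k * (p ?w0 a + c n k * r ?w0 a))) \<le> S n * \<bar>Q n (j n)\<bar>"
    proof (rule eventually_mono[OF ev])
      fix n :: nat assume n: "n > 0"
      have "?T n - (\<Sum>k<n. e n k * (p ?w0 a + c n k * r ?w0 a)) = (\<Sum>k<n. e n k * Q n k)"
        unfolding T[OF n] by (simp add: Q_def w_def x_def c_def right_diff_distrib sum_subtractf)
      also have "norm \<dots> \<le> (\<Sum>k<n. e n k * \<bar>Q n (j n)\<bar>)"
        using e[OF n] jmax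
        by (intro order_trans[OF norm_sum] sum_mono) (auto simp: abs_mult less_imp_le)
      also have "\<dots> = S n * \<bar>Q n (j n)\<bar>" by (simp add: S_def sum_distrib_right)
      finally show "norm (?T n - (\<Sum>k<n. e n k * (p ?w0 a + c n k * r ?w0 a))) \<le> S n * \<bar>Q n (j n)\<bar>" .
    qed
  qed
  from tendsto_add[OF this main] show ?thesis by simp
qed

end

section \<open>Integration by parts and time reversal for Brownian motion\<close>

context standard_brownian_motion
begin

abbreviation (input) "inc t n \<equiv> \<lambda>j \<omega>. B (real (Suc j) * t / real n) \<omega> - B (real j * t / real n) \<omega>"
abbreviation (input) "dG t n \<equiv> \<lambda>i \<omega>. discrete_gbm (t / real n) (\<lambda>j. inc t n j \<omega>) i"
abbreviation (input) "dA t n \<equiv> \<lambda>i \<omega>. discrete_integral (t / real n) (\<lambda>j. inc t n j \<omega>) i"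

lemma gaussian_steps_increments:
  assumes t: "t > 0" and n: "n > 0"
  shows "gaussian_steps M (inc t n) (t / real n) n"
proof
  show "t / real n > 0" "n > 0" using t n by auto
  show "indep_vars (\<lambda>_. borel) (inc t n) {..<n}"
    using t n by (intro independent_increments) (auto simp: divide_strict_right_mono)
  fix i assume "i < n"
  have "real (Suc i) * t / real n - real i * t / real n = t / real n"
    by (simp add: distrib_right add_divide_distrib)
  then show "distributed M lborel (inc t n i) (normal_density 0 (sqrt (t / real n)))"
    using gaussian_increments[of "real i * t / real n" "real (Suc i) * t / real n"] t n
    by (simp add: divide_strict_right_mono)
qed

lemma discrete_gbm_eq_geometric_bm:
  assumes "B 0 \<omega> = 0"
  shows "dG t n i \<omega> = geometric_bm B (real i * t / real n) \<omega>"
proof -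
  have "(\<Sum>j<i. inc t n j \<omega>) = B (real i * t / real n) \<omega>"
    using assms sum_lessThan_telescope[of "\<lambda>j. B (real j * t / real n) \<omega>" i] by simp
  then show ?thesis
    by (simp add: discrete_gbm_def geometric_bm_def sum_subtractf)
qed

lemma geometric_bm_pos [simp]: "geometric_bm B t \<omega> > 0"
  by (simp add: geometric_bm_def)

lemma geometric_bm_nonzero [simp]: "geometric_bm B t \<omega> \<noteq> 0"
  by (simp add: geometric_bm_def)

lemma measurable_geometric_bm [measurable]: "0 \<le> t \<Longrightarrow> random_variable borel (geometric_bm B t)"
  using measurable_at[of t] unfolding geometric_bm_def by simp

lemma continuous_on_geometric_bm:
  "\<omega> \<in> space M \<Longrightarrow> continuous_on {0..t} (\<lambda>s. geometric_bm B s \<omega>)"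
  unfolding geometric_bm_def
  by (intro continuous_intros continuous_on_subset[OF continuous_paths]) auto

lemma riemann_sum_geometric_bm:
  assumes "t > 0" "\<omega> \<in> space M"
  shows "(\<lambda>n. \<Sum>i<n. t / real n * geometric_bm B (real i * t / real n) \<omega>) \<longlonglongrightarrow> integrated_gbm B t \<omega>"
  unfolding integrated_gbm_def using assms
  by (intro riemann_sum_tendsto continuous_on_geometric_bm)

lemma measurable_integrated_gbm [measurable]:
  assumes "t > 0"
  shows "random_variable borel (integrated_gbm B t)"
  by (rule borel_measurable_LIMSEQ_real[OF riemann_sum_geometric_bm])
    (use assms in \<open>auto intro!: borel_measurable_sum borel_measurable_times measurable_geometric_bm\<close>)

text \<open>A continuous positive path has a positive minimum on the compact interval, and
  \<open>t\<close> times this minimum bounds every Riemann sum with at least one cell from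
  below.\<close>

lemma integrated_gbm_pos:
  assumes t: "t > 0" and \<omega>: "\<omega> \<in> space M"
  shows "integrated_gbm B t \<omega> > 0"
proof -
  obtain s where s: "s \<in> {0..t}" "\<And>r. r \<in> {0..t} \<Longrightarrow> geometric_bm B s \<omega> \<le> geometric_bm B r \<omega>"
    using continuous_attains_inf[of "{0..t}" "\<lambda>s. geometric_bm B s \<omega>"] continuous_on_geometric_bm[OF \<omega>, of t] t
    by auto
  have "t * geometric_bm B s \<omega> \<le> integrated_gbm B t \<omega>"
  proof (rule tendsto_lowerbound[OF riemann_sum_geometric_bm[OF t \<omega>]])
    show "\<forall>\<^sub>F n in sequentially. t * geometric_bm B s \<omega> \<le>
        (\<Sum>i<n. t / real n * geometric_bm B (real i * t / real n) \<omega>)"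
      using eventually_gt_at_top[of 0]
    proof eventually_elim
      fix n :: nat assume n: "n > 0"
      have "t * geometric_bm B s \<omega> = (\<Sum>i<n. t / real n * geometric_bm B s \<omega>)" using n by simp
      also have "\<dots> \<le> (\<Sum>i<n. t / real n * geometric_bm B (real i * t / real n) \<omega>)"
        using t by (intro sum_mono mult_left_mono s) (auto simp: field_simps)
      finally show "t * geometric_bm B s \<omega> \<le> (\<Sum>i<n. t / real n * geometric_bm B (real i * t / real n) \<omega>)" .
    qed
  qed simp
  moreover have "t * geometric_bm B s \<omega> > 0" using t by simp
  ultimately show ?thesis by linarith
qed

text \<open>With a single step of length \<open>t\<close>, the walk at its final time agrees almost
  surely with the process at \<open>t\<close>, and it is a tilt density.\<close>

lemma integrable_geometric_bm:
  assumes t: "t > 0"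
  shows "integrable M (geometric_bm B t)"
proof -
  interpret gaussian_steps M "inc t 1" "t / real 1" 1
    using t by (intro gaussian_steps_increments) auto
  have "AE \<omega> in M. dG t 1 1 \<omega> = geometric_bm B t \<omega>"
    using starts_at_zero by eventually_elim (simp only: discrete_gbm_eq_geometric_bm, simp)
  then show ?thesis
    using integrable_G[of 1] t by (subst integrable_cong_AE[symmetric]) auto
qed

lemma discrete_integral_tendsto:
  assumes "t > 0" "\<omega> \<in> space M" "B 0 \<omega> = 0"
  shows "(\<lambda>n. dA t n n \<omega>) \<longlonglongrightarrow> integrated_gbm B t \<omega>"
  unfolding discrete_integral_def discrete_gbm_eq_geometric_bm[OF assms(3)]
  using assms by (intro riemann_sum_geometric_bm)

text \<open>A sum of squares is at most the largest term times the sum: the largest is at most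
  \<open>t / real n\<close> times the maximum of the path, and the sum converges.\<close>

lemma discrete_squares_tendsto:
  assumes t: "t > 0" and \<omega>: "\<omega> \<in> space M" "B 0 \<omega> = 0"
  shows "(\<lambda>n. \<Sum>i<n. (t / real n * dG t n i \<omega>)\<^sup>2) \<longlonglongrightarrow> 0"
proof -
  obtain s where s: "s \<in> {0..t}" "\<And>r. r \<in> {0..t} \<Longrightarrow> geometric_bm B r \<omega> \<le> geometric_bm B s \<omega>"
    using continuous_attains_sup[of "{0..t}" "\<lambda>s. geometric_bm B s \<omega>"] continuous_on_geometric_bm[OF \<omega>(1), of t] t
    by auto
  show ?thesis
  proof (rule Lim_null_comparison)
    have "(\<lambda>n. t * inverse (real n) * geometric_bm B s \<omega> * dA t n n \<omega>) \<longlonglongrightarrow>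
        t * 0 * geometric_bm B s \<omega> * integrated_gbm B t \<omega>"
      by (intro tendsto_intros discrete_integral_tendsto t \<omega> lim_inverse_n)
    then show "(\<lambda>n. t / real n * geometric_bm B s \<omega> * dA t n n \<omega>) \<longlonglongrightarrow> 0"
      by (simp add: divide_inverse)
    show "\<forall>\<^sub>F n in sequentially. norm (\<Sum>i<n. (t / real n * dG t n i \<omega>)\<^sup>2)
        \<le> t / real n * geometric_bm B s \<omega> * dA t n n \<omega>"
    proof (rule always_eventually, rule allI)
      fix n
      have "(\<Sum>i<n. (t / real n * dG t n i \<omega>)\<^sup>2) \<le>
          (\<Sum>i<n. t / real n * geometric_bm B s \<omega> * (t / real n * dG t n i \<omega>))"
      proof (rule sum_mono)
        fix i assume i: "i \<in> {..<n}"
        have "dG t n i \<omega> \<le> geometric_bm B s \<omega>"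
          unfolding discrete_gbm_eq_geometric_bm[OF \<omega>(2)]
          using i t by (intro s) (auto simp: field_simps)
        then have "(t / real n * dG t n i \<omega>) * (t / real n * dG t n i \<omega>) \<le>
            (t / real n * geometric_bm B s \<omega>) * (t / real n * dG t n i \<omega>)"
          using t by (intro mult_right_mono mult_left_mono) (auto intro: less_imp_le)
        then show "(t / real n * dG t n i \<omega>)\<^sup>2 \<le> t / real n * geometric_bm B s \<omega> * (t / real n * dG t n i \<omega>)"
          by (simp only: power2_eq_square)
      qed
      also have "\<dots> = t / real n * geometric_bm B s \<omega> * dA t n n \<omega>"
        by (simp only: discrete_integral_def sum_distrib_left)
      finally show "norm (\<Sum>i<n. (t / real n * dG t n i \<omega>)\<^sup>2) \<le> t / real n * geometric_bm B s \<omega> * dA t n n \<omega>"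
        by (simp add: sum_nonneg)
    qed
  qed
qed

text \<open>Dominated convergence on both sides of the discrete formula. On the left the final value
  of the walk is almost surely the process at \<open>t\<close> for every number of steps, so only
  the Riemann sum varies and \<open>(M\<^sub>t + 1) * C\<close> is a majorant; on the right the
  majorant is constant.\<close>

lemma integration_by_parts:
  assumes "test_function u uw ux C v b" and t: "t > 0"
    and ux [measurable]: "(\<lambda>p. ux (fst p) (snd p)) \<in> borel_measurable borel"
  shows "expectation (\<lambda>\<omega>. (geometric_bm B t \<omega> - 1) *
        u (geometric_bm B t \<omega> / (integrated_gbm B t \<omega>)\<^sup>2) (integrated_gbm B t \<omega>)) =
    expectation (\<lambda>\<omega>. (integrated_gbm B t \<omega>)\<^sup>2 / 2 *
        ux (geometric_bm B t \<omega> / (integrated_gbm B t \<omega>)\<^sup>2) (integrated_gbm B t \<omega>))"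
proof -
  interpret test_function u uw ux C v b by fact
  let ?M = "geometric_bm B t" and ?A = "integrated_gbm B t"
  have u2 [measurable (raw)]: "(\<lambda>x. u (f x) (g x)) \<in> borel_measurable M"
    if "f \<in> borel_measurable M" "g \<in> borel_measurable M" for f g
    using measurable_compose[OF borel_measurable_Pair[OF that] measurable_u] by simp
  have ux2 [measurable (raw)]: "(\<lambda>x. ux (f x) (g x)) \<in> borel_measurable M"
    if "f \<in> borel_measurable M" "g \<in> borel_measurable M" for f g
    using measurable_compose[OF borel_measurable_Pair[OF that] ux] by simp
  have h_meas [measurable]: "(\<lambda>p. h (fst p) (snd p)) \<in> borel_measurable borel"
  proof -
    have "(\<lambda>p :: real \<times> real. (fst p / (snd p)\<^sup>2, snd p)) \<in> borel \<rightarrow>\<^sub>M borel"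
      unfolding borel_prod[symmetric] by measurable
    from measurable_compose[OF this measurable_u] show ?thesis by (simp add: h_def)
  qed
  have h2 [measurable (raw)]: "(\<lambda>x. h (f x) (g x)) \<in> borel_measurable M"
    if "f \<in> borel_measurable M" "g \<in> borel_measurable M" for f g
    using measurable_compose[OF borel_measurable_Pair[OF that] h_meas] by simp
  have t0 [simp]: "0 \<le> t" using t by simp
  note [measurable] = measurable_integrated_gbm[OF t] measurable_geometric_bm[OF t0]
  have h_bound: "\<bar>h m x\<bar> \<le> C" if "m > 0" "x > 0" for m x
    unfolding h_def using bounds[of "m / x\<^sup>2" x] that by simp
  have gs: "gaussian_steps M (inc t (Suc n)) (t / real (Suc n)) (Suc n)" for n
    using t by (intro gaussian_steps_increments) auto
  let ?L = "\<lambda>n \<omega>. (dG t (Suc n) (Suc n) \<omega> - 1) * h (dG t (Suc n) (Suc n) \<omega>) (dA t (Suc n) (Suc n) \<omega>)"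
  let ?T = "\<lambda>n \<omega>. \<Sum>j<n. dG t n j \<omega> *
      (h (exp (t / real n) * dG t n n \<omega>) (dA t n (Suc j) \<omega> + exp (t / real n) * (dA t n n \<omega> - dA t n (Suc j) \<omega>))
       - h (dG t n n \<omega>) (dA t n n \<omega>))"
  let ?R = "\<lambda>n. ?T (Suc n)"
  have Gn: "dG t (Suc n) (Suc n) \<omega> = ?M \<omega>" if "B 0 \<omega> = 0" for n \<omega>
    unfolding discrete_gbm_eq_geometric_bm[OF that] by (simp del: of_nat_Suc)
  have A_pos: "dA t n n \<omega> > 0" if "n > 0" for n \<omega>
    using that t by (intro discrete_integral_pos) auto
  have eq: "expectation (?L n) = expectation (?R n)" for n
    by (rule gaussian_steps.discrete_integration_by_parts[OF gs h_meas h_bound])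
  have rvG [measurable]: "random_variable borel (dG t (Suc n) i)" if "i \<le> Suc n" for n i
    using gaussian_steps.rv_G[OF gs that] .
  have rvA [measurable]: "random_variable borel (dA t (Suc n) i)" if "i \<le> Suc n" for n i
    using gaussian_steps.rv_A[OF gs that] .
  have L: "(\<lambda>n. expectation (?L n)) \<longlonglongrightarrow> expectation (\<lambda>\<omega>. (?M \<omega> - 1) * h (?M \<omega>) (?A \<omega>))"
  proof (rule integral_dominated_convergence)
    show "integrable M (\<lambda>\<omega>. (?M \<omega> + 1) * C)"
      using integrable_geometric_bm[OF t] by simp
    show "AE \<omega> in M. (\<lambda>n. ?L n \<omega>) \<longlonglongrightarrow> (?M \<omega> - 1) * h (?M \<omega>) (?A \<omega>)"
      using starts_at_zero AE_space
    proof eventually_elim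
      fix \<omega> assume \<omega>: "B 0 \<omega> = 0" "\<omega> \<in> space M"
      note A0 = integrated_gbm_pos[OF t \<omega>(2)]
      have A_lim: "(\<lambda>n. dA t (Suc n) (Suc n) \<omega>) \<longlonglongrightarrow> ?A \<omega>"
        using discrete_integral_tendsto[OF t \<omega>(2,1)] by (rule LIMSEQ_Suc)
      have "(\<lambda>n. (?M \<omega> / (dA t (Suc n) (Suc n) \<omega>)\<^sup>2, dA t (Suc n) (Suc n) \<omega>)) \<longlonglongrightarrow>
          (?M \<omega> / (?A \<omega>)\<^sup>2, ?A \<omega>)"
        using A0 by (intro tendsto_intros A_lim) auto
      from isCont_tendsto_compose[OF isCont_u this]
      have "(\<lambda>n. h (?M \<omega>) (dA t (Suc n) (Suc n) \<omega>)) \<longlonglongrightarrow> h (?M \<omega>) (?A \<omega>)"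
        using A0 by (simp add: h_def)
      then show "(\<lambda>n. ?L n \<omega>) \<longlonglongrightarrow> (?M \<omega> - 1) * h (?M \<omega>) (?A \<omega>)"
        unfolding Gn[OF \<omega>(1)] by (intro tendsto_intros)
    qed
    show "AE \<omega> in M. norm (?L n \<omega>) \<le> (?M \<omega> + 1) * C" for n
      using starts_at_zero
    proof eventually_elim
      fix \<omega> assume \<omega>: "B 0 \<omega> = 0"
      have "\<bar>?M \<omega> - 1\<bar> \<le> ?M \<omega> + 1" using geometric_bm_pos[of t \<omega>] by linarith
      moreover have "\<bar>h (?M \<omega>) (dA t (Suc n) (Suc n) \<omega>)\<bar> \<le> C"
        by (intro h_bound geometric_bm_pos A_pos) simp
      ultimately show "norm (?L n \<omega>) \<le> (?M \<omega> + 1) * C"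
        unfolding Gn[OF \<omega>] real_norm_def abs_mult by (intro mult_mono) auto
    qed
  qed measurable
  have R: "(\<lambda>n. expectation (?R n)) \<longlonglongrightarrow> expectation (\<lambda>\<omega>. (?A \<omega>)\<^sup>2 / 2 * ux (?M \<omega> / (?A \<omega>)\<^sup>2) (?A \<omega>))"
  proof (rule integral_dominated_convergence)
    have T_eq: "?T n \<omega> = (\<Sum>j<n. (t / real n * dG t n j \<omega>) / (t / real n) *
        (h (exp (t / real n) * dG t n n \<omega>) ((\<Sum>i<Suc j. t / real n * dG t n i \<omega>)
            + exp (t / real n) * ((\<Sum>i<n. t / real n * dG t n i \<omega>) - (\<Sum>i<Suc j. t / real n * dG t n i \<omega>)))
         - h (dG t n n \<omega>) (\<Sum>i<n. t / real n * dG t n i \<omega>)))" if n: "n > 0" for n \<omega>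
    proof -
      have "(t / real n * g) / (t / real n) = g" for g using t n by simp
      then show ?thesis by (simp only: discrete_integral_def)
    qed
    show "integrable M (\<lambda>_. b * ((v + b) * C))" by simp
    show "AE \<omega> in M. norm (?R n \<omega>) \<le> b * ((v + b) * C)" for n
      unfolding real_norm_def T_eq[OF zero_less_Suc] using t
      by (intro AE_I2 abs_weighted_sum_increments_le) auto
    show "AE \<omega> in M. (\<lambda>n. ?R n \<omega>) \<longlonglongrightarrow> (?A \<omega>)\<^sup>2 / 2 * ux (?M \<omega> / (?A \<omega>)\<^sup>2) (?A \<omega>)"
      using starts_at_zero AE_space
    proof eventually_elim
      fix \<omega> assume \<omega>: "B 0 \<omega> = 0" "\<omega> \<in> space M"
      have "(\<lambda>n. (\<Sum>j<n. (t / real n * dG t n j \<omega>) / (t / real n) *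
        (h (exp (t / real n) * dG t n n \<omega>) ((\<Sum>i<Suc j. t / real n * dG t n i \<omega>)
            + exp (t / real n) * ((\<Sum>i<n. t / real n * dG t n i \<omega>) - (\<Sum>i<Suc j. t / real n * dG t n i \<omega>)))
         - h (dG t n n \<omega>) (\<Sum>i<n. t / real n * dG t n i \<omega>))))
         \<longlonglongrightarrow> (?A \<omega>)\<^sup>2 / 2 * ux (?M \<omega> / (?A \<omega>)\<^sup>2) (?A \<omega>)"
      proof (rule tendsto_weighted_sum_increments)
        show "(\<lambda>n. t / real n) \<longlonglongrightarrow> 0" by (rule lim_const_over_n)
        \<comment> \<open>The sequence is constant for positive \<open>n\<close>; at
          \<open>n = 0\<close> the walk has no steps and equals 1, hence the detour through
          \<open>Suc n\<close>.\<close>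
        have "(\<lambda>n. dG t (Suc n) (Suc n) \<omega>) \<longlonglongrightarrow> ?M \<omega>" unfolding Gn[OF \<omega>(1)] by simp
        then show "(\<lambda>n. dG t n n \<omega>) \<longlonglongrightarrow> ?M \<omega>" by (rule LIMSEQ_imp_Suc)
        show "(\<lambda>n. \<Sum>i<n. t / real n * dG t n i \<omega>) \<longlonglongrightarrow> ?A \<omega>"
          using discrete_integral_tendsto[OF t \<omega>(2,1)] by (simp only: discrete_integral_def)
        show "(\<lambda>n. \<Sum>i<n. (t / real n * dG t n i \<omega>)\<^sup>2) \<longlonglongrightarrow> 0"
          by (rule discrete_squares_tendsto[OF t \<omega>(2,1)])
      qed (use t integrated_gbm_pos[OF t \<omega>(2)] in auto)
      from LIMSEQ_Suc[OF this] show "(\<lambda>n. ?R n \<omega>) \<longlonglongrightarrow> (?A \<omega>)\<^sup>2 / 2 * ux (?M \<omega> / (?A \<omega>)\<^sup>2) (?A \<omega>)"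
        by (simp only: T_eq[OF zero_less_Suc])
    qed
    show "(\<lambda>\<omega>. ?R n \<omega>) \<in> borel_measurable M" for n
      by (intro borel_measurable_sum borel_measurable_times borel_measurable_diff h2
          borel_measurable_add borel_measurable_const rvG rvA) auto
  qed measurable
  from LIMSEQ_unique[OF L R[folded eq]] show ?thesis by (simp add: h_def)
qed

text \<open>Shifting all increments by \<open>d\<close> is Girsanov's theorem for the density \<open>M\<^sub>t\<close>, and the shifted
  path run backwards in time turns \<open>A\<^sub>t\<close> into \<open>A\<^sub>t / M\<^sub>t\<close>.\<close>
lemma expectation_reversal:
  fixes f :: "real \<Rightarrow> real"
  assumes t: "t > 0" and f: "continuous_on UNIV f" and bound: "\<And>x. \<bar>f x\<bar> \<le> C"
  shows "expectation (\<lambda>\<omega>. geometric_bm B t \<omega> * f (integrated_gbm B t \<omega>)) =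
    expectation (\<lambda>\<omega>. f (integrated_gbm B t \<omega> / geometric_bm B t \<omega>))"
proof -
  let ?M = "geometric_bm B t" and ?A = "integrated_gbm B t"
  have t0 [simp]: "0 \<le> t" using t by simp
  note [measurable] = measurable_integrated_gbm[OF t] measurable_geometric_bm[OF t0]
  have fm [measurable]: "f \<in> borel_measurable borel"
    using f by (rule borel_measurable_continuous_onI)
  have gs: "gaussian_steps M (inc t (Suc n)) (t / real (Suc n)) (Suc n)" for n
    using t by (intro gaussian_steps_increments) auto
  have Gn: "dG t (Suc n) (Suc n) \<omega> = ?M \<omega>" if "B 0 \<omega> = 0" for n \<omega>
    unfolding discrete_gbm_eq_geometric_bm[OF that] by (simp del: of_nat_Suc)
  have rvG [measurable]: "random_variable borel (dG t (Suc n) i)" if "i \<le> Suc n" for n i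
    using gaussian_steps.rv_G[OF gs that] .
  have rvA [measurable]: "random_variable borel (dA t (Suc n) i)" if "i \<le> Suc n" for n i
    using gaussian_steps.rv_A[OF gs that] .
  have f_lim: "(\<lambda>n. f (X n)) \<longlonglongrightarrow> f l" if "X \<longlonglongrightarrow> l" for X l
    using continuous_on_tendsto_compose[OF f that] by simp
  let ?L = "\<lambda>n \<omega>. dG t (Suc n) (Suc n) \<omega> * f (\<Sum>i<Suc n. t / real (Suc n) * dG t (Suc n) (Suc i) \<omega>)"
  let ?R = "\<lambda>n \<omega>. f (dA t (Suc n) (Suc n) \<omega> / dG t (Suc n) (Suc n) \<omega>)"
  have eq: "expectation (?L n) = expectation (?R n)" for n
    by (rule gaussian_steps.discrete_reversal[OF gs fm])
  have L: "(\<lambda>n. expectation (?L n)) \<longlonglongrightarrow> expectation (\<lambda>\<omega>. ?M \<omega> * f (?A \<omega>))"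
  proof (rule integral_dominated_convergence)
    show "integrable M (\<lambda>\<omega>. ?M \<omega> * C)"
      using integrable_geometric_bm[OF t] by simp
    show "AE \<omega> in M. norm (?L n \<omega>) \<le> ?M \<omega> * C" for n
      using starts_at_zero
      by eventually_elim (unfold Gn, auto simp: abs_mult less_imp_le intro!: mult_left_mono bound)
    show "AE \<omega> in M. (\<lambda>n. ?L n \<omega>) \<longlonglongrightarrow> ?M \<omega> * f (?A \<omega>)"
      using starts_at_zero AE_space
    proof eventually_elim
      fix \<omega> assume \<omega>: "B 0 \<omega> = 0" "\<omega> \<in> space M"
      \<comment> \<open>Reversal produces right-endpoint sums. They differ from left-endpoint sums
        only by the two boundary terms, which vanish as the mesh shrinks.\<close>
      have shift: "(\<Sum>i<n. t / real n * dG t n (Suc i) \<omega>) = dA t n n \<omega> + t / real n * (?M \<omega> - 1)" if "n > 0" for n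
      proof -
        have "(\<Sum>i<n. t / real n * dG t n (Suc i) \<omega>) - dA t n n \<omega> =
            (\<Sum>i<n. t / real n * dG t n (Suc i) \<omega> - t / real n * dG t n i \<omega>)"
          by (simp only: discrete_integral_def sum_subtractf)
        also have "\<dots> = t / real n * dG t n n \<omega> - t / real n * dG t n 0 \<omega>"
          by (rule sum_lessThan_telescope)
        also have "dG t n n \<omega> = ?M \<omega>"
          using Gn[OF \<omega>(1), of "n - 1"] that by simp
        also have "dG t n 0 \<omega> = 1" by (simp add: discrete_gbm_def)
        finally show ?thesis by (simp add: right_diff_distrib)
      qed
      have "(\<lambda>n. dA t (Suc n) (Suc n) \<omega> + t / real (Suc n) * (?M \<omega> - 1)) \<longlonglongrightarrow> ?A \<omega> + 0 * (?M \<omega> - 1)"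
        by (intro tendsto_intros LIMSEQ_Suc[OF discrete_integral_tendsto] LIMSEQ_Suc[OF lim_const_over_n] t \<omega>)
      then have "(\<lambda>n. \<Sum>i<Suc n. t / real (Suc n) * dG t (Suc n) (Suc i) \<omega>) \<longlonglongrightarrow> ?A \<omega>"
        by (simp only: shift[OF zero_less_Suc] mult_zero_left add_0_right)
      from f_lim[OF this] show "(\<lambda>n. ?L n \<omega>) \<longlonglongrightarrow> ?M \<omega> * f (?A \<omega>)"
        unfolding Gn[OF \<omega>(1)] by (intro tendsto_intros)
    qed
    show "(\<lambda>\<omega>. ?L n \<omega>) \<in> borel_measurable M" for n
      by (intro borel_measurable_times measurable_compose[OF _ fm] borel_measurable_sum
          borel_measurable_const rvG) auto
  qed measurable
  have R: "(\<lambda>n. expectation (?R n)) \<longlonglongrightarrow> expectation (\<lambda>\<omega>. f (?A \<omega> / ?M \<omega>))"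
  proof (rule integral_dominated_convergence)
    show "integrable M (\<lambda>\<omega>. C)" by simp
    show "AE \<omega> in M. norm (?R n \<omega>) \<le> C" for n by (auto intro: bound)
    show "AE \<omega> in M. (\<lambda>n. ?R n \<omega>) \<longlonglongrightarrow> f (?A \<omega> / ?M \<omega>)"
      using starts_at_zero AE_space
    proof eventually_elim
      fix \<omega> assume \<omega>: "B 0 \<omega> = 0" "\<omega> \<in> space M"
      have "(\<lambda>n. dA t (Suc n) (Suc n) \<omega> / ?M \<omega>) \<longlonglongrightarrow> ?A \<omega> / ?M \<omega>"
        using geometric_bm_pos[of t \<omega>]
        by (intro tendsto_intros LIMSEQ_Suc[OF discrete_integral_tendsto] t \<omega>) auto
      from f_lim[OF this] show "(\<lambda>n. ?R n \<omega>) \<longlonglongrightarrow> f (?A \<omega> / ?M \<omega>)"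
        unfolding Gn[OF \<omega>(1)] .
    qed
  qed measurable
  from LIMSEQ_unique[OF L R[folded eq]] show ?thesis .
qed

end

section \<open>Product test functions\<close>

lemma continuous_bounded_Icc:
  fixes f :: "real \<Rightarrow> real"
  assumes "continuous_on UNIV f"
  shows "\<exists>c. \<forall>w\<in>{0..v}. \<bar>f w\<bar> \<le> c"
proof -
  have "compact (f ` {0..v})"
    using assms by (intro compact_continuous_image continuous_on_subset[OF assms]) auto
  then show ?thesis by (auto dest!: compact_imp_bounded simp: bounded_iff)
qed

text \<open>The supports of \<open>S\<close> in \<open>{x0..x1}\<close> and of \<open>K\<close>
  below \<open>v\<close> keep \<open>2 * w * x + 2 / x\<close> bounded for positive
  \<open>w\<close>, so the integrating factor becomes admissible despite its growth.\<close>

lemma test_function_product: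
  fixes K K' S S' :: "real \<Rightarrow> real"
  assumes K: "\<And>w. (K has_real_derivative K' w) (at w)" and K': "continuous_on UNIV K'"
    and K0: "\<And>w. w > v \<Longrightarrow> K w = 0 \<and> K' w = 0"
    and S: "\<And>x. x > 0 \<Longrightarrow> (S has_real_derivative S' x) (at x)" and S': "continuous_on UNIV S'"
    and S0: "\<And>x. x \<notin> {x0..x1} \<Longrightarrow> S x = 0 \<and> S' x = 0"
    and S_meas [measurable]: "S \<in> borel_measurable borel"
    and v: "v > 0" and x0: "0 < x0" "x0 \<le> x1"
  defines "u \<equiv> \<lambda>w x. K w * S x * exp (2 * w * x + 2 / x)"
    and "uw \<equiv> \<lambda>w x. (K' w + 2 * x * K w) * S x * exp (2 * w * x + 2 / x)"
    and "ux \<equiv> \<lambda>w x. K w * (S' x + S x * (2 * w - 2 / x\<^sup>2)) * exp (2 * w * x + 2 / x)"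
  shows "\<exists>C. test_function u uw ux C v x1" and "(\<lambda>p. ux (fst p) (snd p)) \<in> borel_measurable borel"
proof -
  have Kc: "continuous_on UNIV K" using K by (intro DERIV_continuous_on) (auto intro: DERIV_subset)
  have Sc: "continuous_on {0<..} S" using S by (intro DERIV_continuous_on) (auto intro: DERIV_subset)
  have [measurable]: "K \<in> borel_measurable borel" "K' \<in> borel_measurable borel" "S' \<in> borel_measurable borel"
    using Kc K' S' by (auto intro: borel_measurable_continuous_onI)
  obtain c1 where c1: "\<And>w. w \<in> {0..v} \<Longrightarrow> \<bar>K w\<bar> \<le> c1" using continuous_bounded_Icc[OF Kc] by blast
  obtain c2 where c2: "\<And>w. w \<in> {0..v} \<Longrightarrow> \<bar>K' w\<bar> \<le> c2" using continuous_bounded_Icc[OF K'] by blast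
  obtain c3 where c3: "\<And>w. w \<in> {0..x1} \<Longrightarrow> \<bar>S' w\<bar> \<le> c3" using continuous_bounded_Icc[OF S'] by blast
  have "compact (S ` {x0..x1})"
    using x0 by (intro compact_continuous_image continuous_on_subset[OF Sc]) auto
  then have "\<exists>c. \<forall>x\<in>{x0..x1}. \<bar>S x\<bar> \<le> c"
    by (auto dest!: compact_imp_bounded simp: bounded_iff)
  then obtain c4 where c4: "\<And>x. x \<in> {x0..x1} \<Longrightarrow> \<bar>S x\<bar> \<le> c4" by blast
  \<comment> \<open>\<open>k\<close> bounds \<open>K\<close> and \<open>K'\<close>, \<open>s\<close>
    bounds \<open>S\<close> and \<open>S'\<close>, \<open>E\<close> bounds the exponential, and
    \<open>R\<close>, at least 1, absorbs the algebraic factors created by differentiation. The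
    maximum with 0 covers points outside the supports.\<close>
  define k where "k = max 0 (max c1 c2)"
  define s where "s = max 0 (max c3 c4)"
  define E where "E = exp (2 * v * x1 + 2 / x0)"
  define R where "R = 1 + 2 * x1 + 2 * v + 2 / x0\<^sup>2"
  have kb: "\<bar>K w\<bar> \<le> k" "\<bar>K' w\<bar> \<le> k" if "0 < w" for w
    using c1[of w] c2[of w] K0[of w] that by (cases "w \<le> v"; force simp: k_def)+
  have sb: "\<bar>S x\<bar> \<le> s" "\<bar>S' x\<bar> \<le> s" for x
    using c4[of x] c3[of x] S0[of x] x0 by (cases "x \<in> {x0..x1}"; force simp: s_def)+
  have ks: "0 \<le> k" "0 \<le> s" by (auto simp: k_def s_def)
  have R: "R \<ge> 1" using x0 v by (simp add: R_def)
  have Eb: "exp (2 * w * x + 2 / x) \<le> E" if "0 < w" "w \<le> v" "x0 \<le> x" "x \<le> x1" for w x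
  proof -
    have "w * x \<le> v * x1" using that x0 by (intro mult_mono) auto
    moreover have "2 / x \<le> 2 / x0" using that x0 by (intro divide_left_mono) auto
    ultimately show ?thesis by (simp add: E_def)
  qed
  have E0: "E \<ge> 0" by (simp add: E_def)
  have bounds: "\<bar>u w x\<bar> \<le> k * R * s * E \<and> \<bar>uw w x\<bar> \<le> k * R * s * E \<and> \<bar>ux w x\<bar> \<le> k * R * s * E"
    if w: "w > 0" for w x
  proof (cases "w \<le> v \<and> x \<in> {x0..x1}")
    case False
    then have "u w x = 0 \<and> uw w x = 0 \<and> ux w x = 0"
      using K0[of w] S0[of x] by (auto simp: u_def uw_def ux_def)
    then show ?thesis using ks R E0 by simp
  next
    case True
    then have x: "x0 \<le> x" "x \<le> x1" "0 < x" using x0 by auto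
    have E: "exp (2 * w * x + 2 / x) \<le> E" using True w by (intro Eb) auto
    have "\<bar>K w * S x\<bar> \<le> k * s" unfolding abs_mult using kb[OF w] sb ks by (intro mult_mono) auto
    also have "\<dots> \<le> k * R * s" using ks R mult_right_mono[of 1 R "k * s"] by (simp add: mult_ac)
    finally have 1: "\<bar>K w * S x\<bar> \<le> k * R * s" .
    have "\<bar>K' w + 2 * x * K w\<bar> \<le> k + 2 * x1 * k"
    proof -
      have "\<bar>2 * x * K w\<bar> \<le> 2 * x1 * k" unfolding abs_mult using kb(1)[OF w] x ks by (intro mult_mono) auto
      then show ?thesis using kb(2)[OF w] by linarith
    qed
    also have "\<dots> \<le> k * R" using ks v x0 by (simp add: R_def algebra_simps)
    finally have 2: "\<bar>(K' w + 2 * x * K w) * S x\<bar> \<le> k * R * s"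
      unfolding abs_mult using sb ks R by (intro mult_mono) auto
    have "\<bar>2 * w - 2 / x\<^sup>2\<bar> \<le> 2 * v + 2 / x0\<^sup>2"
    proof -
      have "2 / x\<^sup>2 \<le> 2 / x0\<^sup>2" using x x0 by (intro divide_left_mono power_mono) auto
      moreover have "2 / x\<^sup>2 \<ge> 0" by simp
      moreover have "w \<le> v" using True by simp
      ultimately show ?thesis using w unfolding abs_le_iff by linarith
    qed
    then have "\<bar>S x * (2 * w - 2 / x\<^sup>2)\<bar> \<le> s * (2 * v + 2 / x0\<^sup>2)"
      unfolding abs_mult using sb ks by (intro mult_mono) auto
    then have "\<bar>S' x + S x * (2 * w - 2 / x\<^sup>2)\<bar> \<le> s + s * (2 * v + 2 / x0\<^sup>2)"
      using sb(2)[of x] by linarith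
    also have "\<dots> \<le> R * s" using ks x0 by (simp add: R_def algebra_simps)
    finally have 3: "\<bar>K w * (S' x + S x * (2 * w - 2 / x\<^sup>2))\<bar> \<le> k * R * s"
      unfolding abs_mult mult.assoc using kb(1)[OF w] ks R by (intro mult_mono) auto
    have *: "\<bar>z * exp (2 * w * x + 2 / x)\<bar> \<le> k * R * s * E" if "\<bar>z\<bar> \<le> k * R * s" for z
      unfolding abs_mult using that E ks R by (intro mult_mono) auto
    show ?thesis using *[OF 1] *[OF 2] *[OF 3] by (simp add: u_def uw_def ux_def)
  qed
  have S_isCont: "isCont (\<lambda>p. S (snd p)) (w, x)" if "x > 0" for w x :: real
    by (rule isCont_o2[where f = snd and g = S]) (auto intro!: continuous_intros DERIV_isCont[OF S] that)
  have K_isCont: "isCont (\<lambda>p. K (fst p)) q" "isCont (\<lambda>p. K' (fst p)) q" "isCont (\<lambda>p. S' (snd p)) q"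
    for q :: "real \<times> real"
    using Kc K' S'
    by (auto intro!: isCont_o2[where f = fst and g = K] isCont_o2[where f = fst and g = K']
        isCont_o2[where f = snd and g = S'] continuous_intros simp: continuous_on_eq_continuous_at)
  have "test_function u uw ux (k * R * s * E) v x1"
  proof
    fix w x :: "real \<Rightarrow> real" and w' x' t
    assume dw: "(w has_real_derivative w') (at t)" and dx: "(x has_real_derivative x') (at t)"
      and pos: "w t > 0" "x t > 0"
    have 1: "((\<lambda>t. K (w t)) has_real_derivative K' (w t) * w') (at t)"
      by (rule DERIV_chain2[OF K dw])
    have 2: "((\<lambda>t. S (x t)) has_real_derivative S' (x t) * x') (at t)"
      by (rule DERIV_chain2[OF S[OF pos(2)] dx])
    have 3: "((\<lambda>t. exp (2 * w t * x t + 2 / x t)) has_real_derivative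
        exp (2 * w t * x t + 2 / x t) * (2 * w' * x t + (2 * w t - 2 / (x t)\<^sup>2) * x')) (at t)"
      using pos by (auto intro!: derivative_eq_intros dw dx simp: power2_eq_square algebra_simps)
    show "((\<lambda>t. u (w t) (x t)) has_real_derivative uw (w t) (x t) * w' + ux (w t) (x t) * x') (at t)"
      unfolding u_def uw_def ux_def
      by (rule DERIV_cong[OF DERIV_mult[OF DERIV_mult[OF 1 2] 3]]) (simp add: algebra_simps)
  next
    fix w x :: real assume pos: "w > 0" "x > 0"
    show "isCont (\<lambda>p. u (fst p) (snd p)) (w, x)" "isCont (\<lambda>p. uw (fst p) (snd p)) (w, x)"
      "isCont (\<lambda>p. ux (fst p) (snd p)) (w, x)"
      unfolding u_def uw_def ux_def using pos
      by (intro continuous_intros S_isCont K_isCont; simp)+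
    show "\<bar>u w x\<bar> \<le> k * R * s * E \<and> \<bar>uw w x\<bar> \<le> k * R * s * E \<and> \<bar>ux w x\<bar> \<le> k * R * s * E"
      using bounds[OF pos(1)] .
    assume "w > v \<or> x > x1"
    then show "uw w x = 0 \<and> ux w x = 0"
      using K0[of w] S0[of x] by (auto simp: uw_def ux_def)
  next
    show "(\<lambda>p. u (fst p) (snd p)) \<in> borel_measurable borel"
      unfolding u_def borel_prod[symmetric] by measurable
    show "v > 0" "x1 > 0" using v x0 by auto
  qed
  then show "\<exists>C. test_function u uw ux C v x1" ..
  show "(\<lambda>p. ux (fst p) (snd p)) \<in> borel_measurable borel"
    unfolding ux_def borel_prod[symmetric] by measurable
qed

text \<open>Differentiating the integrating factor gives \<open>x\<^sup>2 * (2 * w - 2 / x\<^sup>2)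
  = 2 * (w * x\<^sup>2 - 1)\<close>, and \<open>w * x\<^sup>2\<close> is the value of the process at
  \<open>t\<close>. So the terms with \<open>S\<close> equal the other side of the integration by
  parts formula, and only the term with \<open>S'\<close> survives.\<close>

lemma (in standard_brownian_motion) expectation_derivative_eq_0:
  fixes K K' S S' :: "real \<Rightarrow> real"
  assumes t: "t > 0"
    and K: "\<And>w. (K has_real_derivative K' w) (at w)" and K': "continuous_on UNIV K'"
    and K0: "\<And>w. w > v \<Longrightarrow> K w = 0 \<and> K' w = 0"
    and S: "\<And>x. x > 0 \<Longrightarrow> (S has_real_derivative S' x) (at x)" and S': "continuous_on UNIV S'"
    and S0: "\<And>x. x \<notin> {x0..x1} \<Longrightarrow> S x = 0 \<and> S' x = 0"
    and S_meas [measurable]: "S \<in> borel_measurable borel"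
    and v: "v > 0" and x0: "0 < x0" "x0 \<le> x1"
  defines "A \<equiv> integrated_gbm B t" and "W \<equiv> \<lambda>\<omega>. geometric_bm B t \<omega> / (integrated_gbm B t \<omega>)\<^sup>2"
  shows "expectation (\<lambda>\<omega>. K (W \<omega>) * ((A \<omega>)\<^sup>2 * S' (A \<omega>)) * exp (2 * W \<omega> * A \<omega> + 2 / A \<omega>)) = 0"
proof -
  let ?u = "\<lambda>w x. K w * S x * exp (2 * w * x + 2 / x)"
  let ?ux = "\<lambda>w x. K w * (S' x + S x * (2 * w - 2 / x\<^sup>2)) * exp (2 * w * x + 2 / x)"
  let ?M = "geometric_bm B t"
  have "\<exists>C. test_function ?u
      (\<lambda>w x. (K' w + 2 * x * K w) * S x * exp (2 * w * x + 2 / x)) ?ux C v x1"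
    by (rule test_function_product(1)[OF K K' K0 S S' S0 S_meas v x0])
  then obtain C where C: "test_function ?u
      (\<lambda>w x. (K' w + 2 * x * K w) * S x * exp (2 * w * x + 2 / x)) ?ux C v x1" ..
  have ux_meas: "(\<lambda>p. ?ux (fst p) (snd p)) \<in> borel_measurable borel"
    by (rule test_function_product(2)[OF K K' K0 S S' S0 S_meas v x0])
  interpret test_function ?u "\<lambda>w x. (K' w + 2 * x * K w) * S x * exp (2 * w * x + 2 / x)" ?ux C v x1
    by (rule C)
  have t0 [simp]: "0 \<le> t" using t by simp
  note [measurable] = measurable_integrated_gbm[OF t] measurable_geometric_bm[OF t0]
  have [measurable]: "W \<in> borel_measurable M" "A \<in> borel_measurable M" unfolding W_def A_def by measurable
  have A_pos: "A \<omega> > 0" if "\<omega> \<in> space M" for \<omega> unfolding A_def by (rule integrated_gbm_pos[OF t that])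
  have W_pos: "W \<omega> > 0" if "\<omega> \<in> space M" for \<omega>
    unfolding W_def using integrated_gbm_pos[OF t that] by simp
  have M: "?M \<omega> = W \<omega> * (A \<omega>)\<^sup>2" if "\<omega> \<in> space M" for \<omega>
    using A_pos[OF that] by (simp add: W_def A_def)
  have Kc: "continuous_on UNIV K" using K by (intro DERIV_continuous_on) (auto intro: DERIV_subset)
  have [measurable]: "K \<in> borel_measurable borel" "K' \<in> borel_measurable borel" "S' \<in> borel_measurable borel"
    using Kc K' S' by (auto intro: borel_measurable_continuous_onI)
  have i1: "integrable M (\<lambda>\<omega>. (?M \<omega> - 1) * ?u (W \<omega>) (A \<omega>))"
  proof (rule Bochner_Integration.integrable_bound)
    show "integrable M (\<lambda>\<omega>. (?M \<omega> + 1) * C)"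
      using integrable_geometric_bm[OF t] by simp
    show "AE \<omega> in M. norm ((?M \<omega> - 1) * ?u (W \<omega>) (A \<omega>)) \<le> norm ((?M \<omega> + 1) * C)"
    proof (rule AE_I2)
      fix \<omega> assume \<omega>: "\<omega> \<in> space M"
      have "\<bar>?u (W \<omega>) (A \<omega>)\<bar> \<le> C" using bounds[OF W_pos[OF \<omega>] A_pos[OF \<omega>]] by blast
      moreover have "\<bar>?M \<omega> - 1\<bar> \<le> \<bar>?M \<omega> + 1\<bar>" using geometric_bm_pos[of t \<omega>] by linarith
      ultimately show "norm ((?M \<omega> - 1) * ?u (W \<omega>) (A \<omega>)) \<le> norm ((?M \<omega> + 1) * C)"
        unfolding real_norm_def abs_mult using C_nonneg by (intro mult_mono) auto
    qed
  qed measurable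
  let ?g = "\<lambda>\<omega>. K (W \<omega>) * ((A \<omega>)\<^sup>2 * S' (A \<omega>)) * exp (2 * W \<omega> * A \<omega> + 2 / A \<omega>)"
  let ?r = "\<lambda>\<omega>. (A \<omega>)\<^sup>2 / 2 * ?ux (W \<omega>) (A \<omega>)"
  have i2: "integrable M ?r"
  proof (rule Bochner_Integration.integrable_bound)
    show "integrable M (\<lambda>\<omega>. x1\<^sup>2 / 2 * C)" by simp
    show "AE \<omega> in M. norm (?r \<omega>) \<le> norm (x1\<^sup>2 / 2 * C)"
    proof (rule AE_I2)
      fix \<omega> assume \<omega>: "\<omega> \<in> space M"
      show "norm (?r \<omega>) \<le> norm (x1\<^sup>2 / 2 * C)"
      proof (cases "A \<omega> > x1")
        case True
        then show ?thesis using S0[of "A \<omega>"] by simp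
      next
        case False
        have "\<bar>?ux (W \<omega>) (A \<omega>)\<bar> \<le> C" using bounds[OF W_pos[OF \<omega>] A_pos[OF \<omega>]] by blast
        moreover have "\<bar>(A \<omega>)\<^sup>2 / 2\<bar> \<le> \<bar>x1\<^sup>2 / 2\<bar>"
          using False A_pos[OF \<omega>] by (simp add: power_mono)
        ultimately show ?thesis
          unfolding real_norm_def abs_mult using C_nonneg by (intro mult_mono) auto
      qed
    qed
  qed measurable
  have ibp: "expectation (\<lambda>\<omega>. (?M \<omega> - 1) * ?u (W \<omega>) (A \<omega>)) = expectation ?r"
    using integration_by_parts[OF C t ux_meas] by (simp only: W_def A_def)
  have "?g \<omega> = 2 * (?r \<omega> - (?M \<omega> - 1) * ?u (W \<omega>) (A \<omega>))" if \<omega>: "\<omega> \<in> space M" for \<omega>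
    using A_pos[OF \<omega>] unfolding M[OF \<omega>] by (simp add: field_simps)
  then have "expectation ?g = expectation (\<lambda>\<omega>. 2 * (?r \<omega> - (?M \<omega> - 1) * ?u (W \<omega>) (A \<omega>)))"
    by (intro Bochner_Integration.integral_cong) auto
  also have "\<dots> = 2 * (expectation ?r - expectation (\<lambda>\<omega>. (?M \<omega> - 1) * ?u (W \<omega>) (A \<omega>)))"
    by (simp only: integral_mult_right_zero Bochner_Integration.integral_diff[OF i2 i1])
  finally show ?thesis using ibp by simp
qed

text \<open>A primitive started at 0 vanishes to the left of the support and, because the total
  integral is zero, also to its right.\<close>

lemma primitive_with_compact_support:
  fixes g :: "real \<Rightarrow> real"
  assumes g: "continuous_on UNIV g" and g0: "\<And>x. x \<notin> {x0..x1} \<Longrightarrow> g x = 0"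
    and x0: "0 < x0" "x0 \<le> x1" and int: "integral {0..x1} g = 0"
  obtains S where "\<And>x. x > 0 \<Longrightarrow> (S has_real_derivative g x) (at x)"
    "\<And>x. x \<notin> {x0..x1} \<Longrightarrow> S x = 0" "S \<in> borel_measurable borel"
proof
  define F where "F x = integral {0..x} g" for x
  \<comment> \<open>The indicator lets measurability on the whole line follow from continuity on the
    open half line.\<close>
  define S where "S x = indicator {0<..} x *\<^sub>R F x" for x
  have F: "(F has_real_derivative g x) (at x)" if "x > 0" for x
  proof -
    have "((\<lambda>u. integral {0..u} g) has_real_derivative g x) (at x within {0..x + 1})"
      using that by (intro integral_has_real_derivative continuous_on_subset[OF g]) auto
    then show ?thesis
      using that by (simp add: F_def[abs_def] at_within_Icc_at)
  qed
  show "(S has_real_derivative g x) (at x)" if "x > 0" for x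
    using that
    by (intro has_field_derivative_transform_within_open[OF F[OF that], of "{0<..}"]) (auto simp: S_def)
  have "continuous_on {0<..} F"
    using F by (intro DERIV_continuous_on) (auto intro: DERIV_subset)
  then show "S \<in> borel_measurable borel"
    unfolding S_def[abs_def] by (intro borel_measurable_continuous_on_indicator) auto
  show "S x = 0" if x: "x \<notin> {x0..x1}" for x
  proof (cases "x < x0")
    case True
    then have "integral {0..x} g = integral {0..x} (\<lambda>_. 0)"
      by (intro Henstock_Kurzweil_Integration.integral_cong g0) auto
    then show ?thesis by (simp add: S_def F_def)
  next
    case False
    then have gt: "x > x1" using x by auto
    have "integral {0..x1} g + integral {x1..x} g = integral {0..x} g"
      using x0 gt
      by (intro Henstock_Kurzweil_Integration.integral_combine integrable_continuous_real continuous_on_subset[OF g]) auto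
    moreover have "integral {x1..x} g = integral {x1..x} (\<lambda>_. 0)"
    proof (rule integral_spike[of "{x1}"])
      show "0 = g y" if "y \<in> {x1..x} - {x1}" for y using that g0[of y] by auto
    qed auto
    ultimately show ?thesis using int by (simp add: S_def F_def)
  qed
qed

section \<open>Proportionality of weighted expectations to integrals against
  \<open>dx / x\<^sup>2\<close>\<close>

context standard_brownian_motion
begin

text \<open>Taking \<open>S' x = \<psi> x / x\<^sup>2\<close>, the functional \<open>\<psi>
  \<mapsto> expectation (K (W) * \<psi> (A) * exp (...))\<close> vanishes whenever the integral of
  \<open>\<psi> x / x\<^sup>2\<close> does. A linear functional vanishing on the kernel of another
  is a multiple of it; the multiple is eliminated by comparing two functions.\<close>

lemma expectation_proportional:
  fixes K K' \<phi> \<rho> :: "real \<Rightarrow> real"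
  assumes t: "t > 0"
    and K: "\<And>w. (K has_real_derivative K' w) (at w)" and K': "continuous_on UNIV K'"
    and K0: "\<And>w. w > v \<Longrightarrow> K w = 0 \<and> K' w = 0"
    and \<phi>: "continuous_on UNIV \<phi>" and \<rho>: "continuous_on UNIV \<rho>"
    and supp: "\<And>x. x \<notin> {x0..x1} \<Longrightarrow> \<phi> x = 0 \<and> \<rho> x = 0"
    and v: "v > 0" and x0: "0 < x0" "x0 \<le> x1"
  defines "A \<equiv> integrated_gbm B t" and "W \<equiv> \<lambda>\<omega>. geometric_bm B t \<omega> / (integrated_gbm B t \<omega>)\<^sup>2"
  shows "(LBINT x. \<rho> x / x\<^sup>2) * expectation (\<lambda>\<omega>. K (W \<omega>) * \<phi> (A \<omega>) * exp (2 * W \<omega> * A \<omega> + 2 / A \<omega>)) =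
    (LBINT x. \<phi> x / x\<^sup>2) * expectation (\<lambda>\<omega>. K (W \<omega>) * \<rho> (A \<omega>) * exp (2 * W \<omega> * A \<omega> + 2 / A \<omega>))"
proof -
  let ?E = "\<lambda>\<omega>. exp (2 * W \<omega> * A \<omega> + 2 / A \<omega>)"
  have t0 [simp]: "0 \<le> t" using t by simp
  note [measurable] = measurable_integrated_gbm[OF t] measurable_geometric_bm[OF t0]
  have [measurable]: "W \<in> borel_measurable M" "A \<in> borel_measurable M" unfolding W_def A_def by measurable
  have A_pos: "A \<omega> > 0" if "\<omega> \<in> space M" for \<omega> unfolding A_def by (rule integrated_gbm_pos[OF t that])
  have W_pos: "W \<omega> > 0" if "\<omega> \<in> space M" for \<omega>
    unfolding W_def using integrated_gbm_pos[OF t that] by simp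
  have Kc: "continuous_on UNIV K" using K by (intro DERIV_continuous_on) (auto intro: DERIV_subset)
  have [measurable]: "K \<in> borel_measurable borel" "\<phi> \<in> borel_measurable borel" "\<rho> \<in> borel_measurable borel"
    using Kc \<phi> \<rho> by (auto intro: borel_measurable_continuous_onI)
  have quot: "continuous_on UNIV (\<lambda>x. \<psi> x / x\<^sup>2)"
    if \<psi>: "continuous_on UNIV \<psi>" "\<And>x. x \<notin> {x0..x1} \<Longrightarrow> \<psi> x = 0" for \<psi> :: "real \<Rightarrow> real"
  proof -
    \<comment> \<open>Replacing the denominator below \<open>x0\<close>, where \<open>\<psi>\<close>
      is zero, gives a quotient that is visibly continuous on the whole line.\<close>
    have "(\<lambda>x. \<psi> x / x\<^sup>2) = (\<lambda>x. \<psi> x / (max x x0)\<^sup>2)"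
    proof
      fix x show "\<psi> x / x\<^sup>2 = \<psi> x / (max x x0)\<^sup>2" using that(2)[of x] by (cases "x \<in> {x0..x1}") (auto simp: max_def)
    qed
    moreover have "max x x0 \<noteq> 0" for x using x0 by (simp add: max_def)
    then have "continuous_on UNIV (\<lambda>x. \<psi> x / (max x x0)\<^sup>2)"
      by (intro continuous_intros \<psi>(1)) simp
    ultimately show ?thesis by (simp only:)
  qed
  have LB: "(LBINT x. \<psi> x / x\<^sup>2) = integral {0..x1} (\<lambda>x. \<psi> x / x\<^sup>2)"
    if \<psi>: "continuous_on UNIV \<psi>" "\<And>x. x \<notin> {x0..x1} \<Longrightarrow> \<psi> x = 0" for \<psi> :: "real \<Rightarrow> real"
  proof -
    have "(LBINT x. \<psi> x / x\<^sup>2) = (LBINT x:{0..x1}. \<psi> x / x\<^sup>2)"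
      unfolding set_lebesgue_integral_def
    proof (intro Bochner_Integration.integral_cong refl)
      fix x show "\<psi> x / x\<^sup>2 = indicat_real {0..x1} x *\<^sub>R (\<psi> x / x\<^sup>2)"
        by (cases "x \<in> {x0..x1}") (use \<psi>(2) x0 in auto)
    qed
    also have "\<dots> = integral {0..x1} (\<lambda>x. \<psi> x / x\<^sup>2)"
      by (intro set_borel_integral_eq_integral borel_integrable_atLeastAtMost' continuous_on_subset[OF quot[OF \<psi>]]) auto
    finally show ?thesis .
  qed
  have key: "expectation (\<lambda>\<omega>. K (W \<omega>) * \<psi> (A \<omega>) * ?E \<omega>) = 0"
    if \<psi>: "continuous_on UNIV \<psi>" "\<And>x. x \<notin> {x0..x1} \<Longrightarrow> \<psi> x = 0" "(LBINT x. \<psi> x / x\<^sup>2) = 0" for \<psi> :: "real \<Rightarrow> real"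
  proof -
    define g where "g x = \<psi> x / x\<^sup>2" for x
    have g: "continuous_on UNIV g" unfolding g_def[abs_def] by (rule quot[OF \<psi>(1,2)])
    have g0: "g x = 0" if "x \<notin> {x0..x1}" for x using \<psi>(2)[OF that] by (simp add: g_def)
    have int: "integral {0..x1} g = 0"
      using LB[OF \<psi>(1,2)] \<psi>(3) by (simp add: g_def[abs_def])
    obtain S where S: "\<And>x. x > 0 \<Longrightarrow> (S has_real_derivative g x) (at x)"
      "\<And>x. x \<notin> {x0..x1} \<Longrightarrow> S x = 0" "S \<in> borel_measurable borel"
      using primitive_with_compact_support[OF g g0 x0 int] by metis
    have S0: "S x = 0 \<and> g x = 0" if "x \<notin> {x0..x1}" for x using S(2) g0 that by auto
    have "expectation (\<lambda>\<omega>. K (W \<omega>) * ((A \<omega>)\<^sup>2 * g (A \<omega>)) * ?E \<omega>) = 0"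
      unfolding A_def W_def
      by (rule expectation_derivative_eq_0[OF t K K' K0 S(1) g S0 S(3) v x0])
    moreover have "(A \<omega>)\<^sup>2 * g (A \<omega>) = \<psi> (A \<omega>)" if "\<omega> \<in> space M" for \<omega>
      using A_pos[OF that] by (simp add: g_def)
    then have "expectation (\<lambda>\<omega>. K (W \<omega>) * ((A \<omega>)\<^sup>2 * g (A \<omega>)) * ?E \<omega>) = expectation (\<lambda>\<omega>. K (W \<omega>) * \<psi> (A \<omega>) * ?E \<omega>)"
      by (intro Bochner_Integration.integral_cong) auto
    ultimately show ?thesis by simp
  qed
  have int: "integrable M (\<lambda>\<omega>. K (W \<omega>) * \<psi> (A \<omega>) * ?E \<omega>)"
    if \<psi>: "continuous_on UNIV \<psi>" "\<And>x. x \<notin> {x0..x1} \<Longrightarrow> \<psi> x = 0" for \<psi> :: "real \<Rightarrow> real"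
  proof -
    have [measurable]: "\<psi> \<in> borel_measurable borel" using \<psi>(1) by (rule borel_measurable_continuous_onI)
    obtain c1 where c1: "\<And>w. w \<in> {0..v} \<Longrightarrow> \<bar>K w\<bar> \<le> c1" using continuous_bounded_Icc[OF Kc] by blast
    obtain c2 where c2: "\<And>w. w \<in> {0..x1} \<Longrightarrow> \<bar>\<psi> w\<bar> \<le> c2" using continuous_bounded_Icc[OF \<psi>(1)] by blast
    have c: "0 \<le> c1" "0 \<le> c2" using c1[of 0] c2[of 0] v x0 by auto
    show ?thesis
    proof (rule Bochner_Integration.integrable_bound)
      show "integrable M (\<lambda>_. c1 * c2 * exp (2 * (v * x1) + 2 / x0))" by simp
      show "AE \<omega> in M. norm (K (W \<omega>) * \<psi> (A \<omega>) * ?E \<omega>) \<le> norm (c1 * c2 * exp (2 * (v * x1) + 2 / x0))"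
      proof (rule AE_I2)
        fix \<omega> assume \<omega>: "\<omega> \<in> space M"
        note pos = A_pos[OF \<omega>] W_pos[OF \<omega>]
        show "norm (K (W \<omega>) * \<psi> (A \<omega>) * ?E \<omega>) \<le> norm (c1 * c2 * exp (2 * (v * x1) + 2 / x0))"
        proof (cases "W \<omega> \<le> v \<and> A \<omega> \<in> {x0..x1}")
          case False
          then have "K (W \<omega>) = 0 \<or> \<psi> (A \<omega>) = 0" using K0[of "W \<omega>"] \<psi>(2)[of "A \<omega>"] by auto
          then show ?thesis using c by auto
        next
          case True
          have "W \<omega> * A \<omega> \<le> v * x1" using True pos v by (intro mult_mono) auto
          moreover have "2 / A \<omega> \<le> 2 / x0" using True x0 by (intro divide_left_mono) auto
          ultimately have "?E \<omega> \<le> exp (2 * (v * x1) + 2 / x0)" by simp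
          moreover have "\<bar>K (W \<omega>)\<bar> \<le> c1" "\<bar>\<psi> (A \<omega>)\<bar> \<le> c2" using c1 c2 True pos x0 by auto
          ultimately show ?thesis using c by (auto simp: abs_mult intro!: mult_mono)
        qed
      qed
    qed measurable
  qed
  let ?I\<phi> = "LBINT x. \<phi> x / x\<^sup>2" and ?I\<rho> = "LBINT x. \<rho> x / x\<^sup>2"
  have lbint: "integrable lborel (\<lambda>x. \<psi> x / x\<^sup>2)"
    if \<psi>: "continuous_on UNIV \<psi>" "\<And>x. x \<notin> {x0..x1} \<Longrightarrow> \<psi> x = 0" for \<psi> :: "real \<Rightarrow> real"
  proof -
    have "set_integrable lborel {0..x1} (\<lambda>x. \<psi> x / x\<^sup>2)"
      by (intro borel_integrable_atLeastAtMost' continuous_on_subset[OF quot[OF \<psi>]]) auto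
    moreover have "(\<lambda>x. indicat_real {0..x1} x *\<^sub>R (\<psi> x / x\<^sup>2)) = (\<lambda>x. \<psi> x / x\<^sup>2)"
    proof
      fix x show "indicat_real {0..x1} x *\<^sub>R (\<psi> x / x\<^sup>2) = \<psi> x / x\<^sup>2"
        by (cases "x \<in> {x0..x1}") (use \<psi>(2) x0 in auto)
    qed
    ultimately show ?thesis by (simp add: set_integrable_def)
  qed
  have s: "\<And>x. x \<notin> {x0..x1} \<Longrightarrow> \<phi> x = 0" "\<And>x. x \<notin> {x0..x1} \<Longrightarrow> \<rho> x = 0" using supp by auto
  \<comment> \<open>The combination of \<open>\<phi>\<close> and \<open>\<rho>\<close> whose
    integral against \<open>dx / x\<^sup>2\<close> is zero.\<close>
  have "expectation (\<lambda>\<omega>. K (W \<omega>) * (?I\<rho> * \<phi> (A \<omega>) - ?I\<phi> * \<rho> (A \<omega>)) * ?E \<omega>) = 0"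
  proof (rule key)
    show "continuous_on UNIV (\<lambda>x. ?I\<rho> * \<phi> x - ?I\<phi> * \<rho> x)" by (intro continuous_intros \<phi> \<rho>)
    have "(LBINT x. (?I\<rho> * \<phi> x - ?I\<phi> * \<rho> x) / x\<^sup>2) = (LBINT x. ?I\<rho> * (\<phi> x / x\<^sup>2) - ?I\<phi> * (\<rho> x / x\<^sup>2))"
      by (intro Bochner_Integration.integral_cong) (auto simp: diff_divide_distrib)
    also have "\<dots> = ?I\<rho> * ?I\<phi> - ?I\<phi> * ?I\<rho>"
      by (subst Bochner_Integration.integral_diff)
        (intro integrable_mult_right lbint \<phi> \<rho> s, assumption | simp only: integral_mult_right_zero)+
    finally show "(LBINT x. (?I\<rho> * \<phi> x - ?I\<phi> * \<rho> x) / x\<^sup>2) = 0" by simp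
  qed (simp add: s)
  also have "(\<lambda>\<omega>. K (W \<omega>) * (?I\<rho> * \<phi> (A \<omega>) - ?I\<phi> * \<rho> (A \<omega>)) * ?E \<omega>) =
      (\<lambda>\<omega>. ?I\<rho> * (K (W \<omega>) * \<phi> (A \<omega>) * ?E \<omega>) - ?I\<phi> * (K (W \<omega>) * \<rho> (A \<omega>) * ?E \<omega>))"
    by (simp add: fun_eq_iff algebra_simps)
  finally show ?thesis
    using int[OF \<phi> s(1)] int[OF \<rho> s(2)] by simp
qed

end

section \<open>Approximation of indicator functions\<close>

lemma has_real_derivative_max_0_power2:
  "((\<lambda>y::real. (max 0 y)\<^sup>2) has_real_derivative 2 * max 0 y) (at y)"
proof -
  consider "y < 0" | "y = 0" | "y > 0" by linarith
  then show ?thesis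
  proof cases
    case 1
    have "((\<lambda>y::real. (max 0 y)\<^sup>2) has_real_derivative 0) (at y)"
      by (rule has_field_derivative_transform_within_open[where f = "\<lambda>_. 0" and S = "{..<0}"]) (use 1 in simp_all)
    then show ?thesis using 1 by simp
  next
    case 2
    have "(\<lambda>h::real. (max 0 h)\<^sup>2 / h) \<midarrow>0\<rightarrow> 0"
    proof (rule Lim_null_comparison)
      show "\<forall>\<^sub>F h in at 0. norm ((max 0 h)\<^sup>2 / h) \<le> \<bar>h\<bar>" for h :: real
        by (intro always_eventually allI) (auto simp: max_def power2_eq_square)
      show "(\<lambda>h::real. \<bar>h\<bar>) \<midarrow>0\<rightarrow> 0" by (rule tendsto_rabs_zero[OF tendsto_ident_at])
    qed
    then show ?thesis using 2 by (simp add: DERIV_def)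
  next
    case 3
    have "((\<lambda>y::real. y\<^sup>2) has_real_derivative 2 * y) (at y)"
      by (auto intro!: derivative_eq_intros)
    then have "((\<lambda>y::real. (max 0 y)\<^sup>2) has_real_derivative 2 * y) (at y)"
      by (rule has_field_derivative_transform_within_open[where f = "\<lambda>y. y\<^sup>2" and S = "{0<..}"]) (use 3 in simp_all)
    then show ?thesis using 3 by simp
  qed
qed

text \<open>Squared positive parts are continuously differentiable, as \<open>K\<close> must be. The
  function is 1 up to \<open>v\<close> and 0 beyond \<open>v + 1\<close> for every \<open>n\<close>,
  so one bounded range of \<open>w\<close> serves the whole sequence.\<close>

definition smooth_cutoff :: "real \<Rightarrow> nat \<Rightarrow> real \<Rightarrow> real" where
  "smooth_cutoff v n w = (max 0 (1 - real (Suc n) * (max 0 (w - v))\<^sup>2))\<^sup>2"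

definition smooth_cutoff' :: "real \<Rightarrow> nat \<Rightarrow> real \<Rightarrow> real" where
  "smooth_cutoff' v n w = 2 * max 0 (1 - real (Suc n) * (max 0 (w - v))\<^sup>2) * (- (real (Suc n) * (2 * max 0 (w - v))))"

lemma smooth_cutoff:
  shows "(smooth_cutoff v n has_real_derivative smooth_cutoff' v n w) (at w)"
    and "continuous_on UNIV (smooth_cutoff v n)" and "continuous_on UNIV (smooth_cutoff' v n)"
    and "w > v + 1 \<Longrightarrow> smooth_cutoff v n w = 0 \<and> smooth_cutoff' v n w = 0"
    and "0 \<le> smooth_cutoff v n w" and "smooth_cutoff v n w \<le> 1"
    and "(\<lambda>n. smooth_cutoff v n w) \<longlonglongrightarrow> indicator {..v} w"
proof -
  have "((\<lambda>w. max 0 (w - v) ^ 2) has_real_derivative 2 * max 0 (w - v) * 1) (at w)"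
    by (rule DERIV_chain2[OF has_real_derivative_max_0_power2]) (auto intro!: derivative_eq_intros)
  from DERIV_diff[OF DERIV_const[of 1] DERIV_cmult[OF this, of "real (Suc n)"]]
  have "((\<lambda>w. 1 - real (Suc n) * max 0 (w - v) ^ 2) has_real_derivative - (real (Suc n) * (2 * max 0 (w - v)))) (at w)"
    by simp
  from DERIV_chain2[OF has_real_derivative_max_0_power2 this]
  show "(smooth_cutoff v n has_real_derivative smooth_cutoff' v n w) (at w)"
    unfolding smooth_cutoff_def[abs_def] smooth_cutoff'_def .
  show "continuous_on UNIV (smooth_cutoff v n)" "continuous_on UNIV (smooth_cutoff' v n)"
    unfolding smooth_cutoff_def[abs_def] smooth_cutoff'_def[abs_def] by (intro continuous_intros)+
  show "smooth_cutoff v n w = 0 \<and> smooth_cutoff' v n w = 0" if "w > v + 1"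
  proof -
    have "1 * 1 \<le> real (Suc n) * (w - v)\<^sup>2"
      using that by (intro mult_mono) (auto intro: one_le_power)
    then show ?thesis using that by (auto simp: smooth_cutoff_def smooth_cutoff'_def max_def simp del: of_nat_Suc)
  qed
  show "0 \<le> smooth_cutoff v n w" by (simp add: smooth_cutoff_def)
  show "smooth_cutoff v n w \<le> 1"
    unfolding smooth_cutoff_def by (intro power_le_one) auto
  show "(\<lambda>n. smooth_cutoff v n w) \<longlonglongrightarrow> indicator {..v} w"
  proof (cases "w \<le> v")
    case True
    then show ?thesis by (simp add: smooth_cutoff_def)
  next
    case False
    then have pos: "(w - v)\<^sup>2 > 0" by simp
    obtain N :: nat where N: "1 / (w - v)\<^sup>2 < real N" using reals_Archimedean2 by blast
    have "\<forall>\<^sub>F n in sequentially. smooth_cutoff v n w = 0"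
      using eventually_ge_at_top[of N]
    proof eventually_elim
      fix n assume "N \<le> n"
      then have "1 / (w - v)\<^sup>2 < real (Suc n)" using N by simp
      then have "1 < real (Suc n) * (w - v)\<^sup>2" using pos by (simp only: divide_less_eq if_True)
      then show "smooth_cutoff v n w = 0"
        using False by (auto simp: smooth_cutoff_def max_def simp del: of_nat_Suc)
    qed
    then show ?thesis using False by (simp add: tendsto_eventually)
  qed
qed

text \<open>A continuous trapezoid: 0 up to \<open>1 / Suc n\<close>, 1 between
  \<open>2 / Suc n\<close> and \<open>q\<close> when that interval is nonempty, and 0 again from
  \<open>q + 1 / Suc n\<close> on. Piecewise linear is smooth enough, since it is the primitive of
  such a function over \<open>x\<^sup>2\<close> that enters as \<open>S\<close>.\<close>

definition plateau :: "real \<Rightarrow> nat \<Rightarrow> real \<Rightarrow> real" where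
  "plateau q n x = max 0 (min 1 (min (real (Suc n) * x - 1) (1 + real (Suc n) * (q - x))))"

lemma plateau:
  assumes q: "q > 0"
  shows "continuous_on UNIV (plateau q n)"
    and "x \<notin> {1 / real (Suc n)..q + 1} \<Longrightarrow> plateau q n x = 0"
    and "0 \<le> plateau q n x" and "plateau q n x \<le> 1"
    and "(\<lambda>n. plateau q n x) \<longlonglongrightarrow> indicator {0<..q} x"
proof -
  show "continuous_on UNIV (plateau q n)"
    unfolding plateau_def[abs_def] by (intro continuous_intros)
  show "0 \<le> plateau q n x" "plateau q n x \<le> 1" by (auto simp: plateau_def)
  show "plateau q n x = 0" if "x \<notin> {1 / real (Suc n)..q + 1}"
  proof (cases "x < 1 / real (Suc n)")
    case True
    then have "real (Suc n) * x < 1" by (simp add: field_simps)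
    then show ?thesis by (simp add: plateau_def del: of_nat_Suc)
  next
    case False
    then have "1 \<le> x - q" using that by auto
    then have "1 * 1 \<le> real (Suc n) * (x - q)" by (intro mult_mono) auto
    then have "1 + real (Suc n) * (q - x) \<le> 0" by (simp add: algebra_simps)
    then show ?thesis by (simp add: plateau_def del: of_nat_Suc)
  qed
  show "(\<lambda>n. plateau q n x) \<longlonglongrightarrow> indicator {0<..q} x"
  proof -
    have "\<forall>\<^sub>F n in sequentially. plateau q n x = indicator {0<..q} x"
    proof -
      consider "x \<le> 0" | "0 < x" "x \<le> q" | "x > q" by linarith
      then show ?thesis
      proof cases
        case 1
        have "plateau q n x = 0" for n
        proof -
          have "real (Suc n) * x \<le> 0" using 1 by (intro mult_nonneg_nonpos) auto
          then show ?thesis by (auto simp: plateau_def max_def min_def simp del: of_nat_Suc)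
        qed
        then show ?thesis using 1 by simp
      next
        case 2
        obtain N :: nat where N: "2 / x < real N" using reals_Archimedean2 by blast
        show ?thesis using eventually_ge_at_top[of N]
        proof eventually_elim
          fix n assume "N \<le> n"
          then have "2 / x < real (Suc n)" using N by simp
          then have "2 < real (Suc n) * x" using 2 by (simp add: divide_less_eq del: of_nat_Suc)
          moreover have "0 \<le> real (Suc n) * (q - x)" using 2 by simp
          ultimately show "plateau q n x = indicator {0<..q} x"
            using 2 by (simp add: plateau_def del: of_nat_Suc)
        qed
      next
        case 3
        obtain N :: nat where N: "1 / (x - q) < real N" using reals_Archimedean2 by blast
        show ?thesis using eventually_ge_at_top[of N]
        proof eventually_elim
          fix n assume "N \<le> n"
          then have "1 / (x - q) < real (Suc n)" using N by simp
          then have "1 < real (Suc n) * (x - q)" using 3 by (simp add: divide_less_eq del: of_nat_Suc)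
          then have "1 + real (Suc n) * (q - x) \<le> 0" by (simp add: algebra_simps)
          then show "plateau q n x = indicator {0<..q} x"
            using 3 by (simp add: plateau_def del: of_nat_Suc)
        qed
      qed
    qed
    then show ?thesis by (rule tendsto_eventually)
  qed
qed

text \<open>A fixed reference function supported away from 0; it measures the unknown
  proportionality factor and later normalises \<open>\<eta>\<close>.\<close>

definition tent :: "real \<Rightarrow> real" where "tent x = max 0 (1 - \<bar>x - 2\<bar>)"

lemma tent: "continuous_on UNIV tent" "x \<notin> {1..3} \<Longrightarrow> tent x = 0" "0 \<le> tent x" "tent x \<le> 1"
  unfolding tent_def[abs_def] by (intro continuous_intros) (auto simp: abs_if)

text \<open>The quadratic Taylor term of \<open>exp (2 / x)\<close> is \<open>2 / x\<^sup>2\<close>.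
  This controls the singularity of \<open>1 / x\<^sup>2\<close> at 0.\<close>

lemma exp_neg_inverse_le:
  fixes x :: real
  assumes "x > 0"
  shows "exp (- 2 / x) / x\<^sup>2 \<le> 1 / 2"
proof -
  have "(2 / x)\<^sup>2 / 2 \<le> exp (2 / x)"
  proof -
    have "1 + 2 / x + (2 / x)\<^sup>2 / 2 \<le> exp (2 / x)" "2 / x > 0"
      using exp_lower_Taylor_quadratic[of "2 / x"] assms by simp_all
    then show ?thesis by linarith
  qed
  then have "2 / x\<^sup>2 \<le> exp (2 / x)" by (simp add: power_divide)
  then have "2 / x\<^sup>2 * exp (- 2 / x) \<le> exp (2 / x) * exp (- 2 / x)"
    by (intro mult_right_mono) auto
  also have "\<dots> = 1" by (simp flip: exp_add)
  finally show ?thesis by (simp add: mult.commute)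
qed

lemma integral_tent_pos: "(LBINT x. tent x / x\<^sup>2) > 0" "integrable lborel (\<lambda>x. tent x / x\<^sup>2)"
proof -
  have [measurable]: "tent \<in> borel_measurable borel" using tent(1) by (rule borel_measurable_continuous_onI)
  show int: "integrable lborel (\<lambda>x. tent x / x\<^sup>2)"
  proof (rule Bochner_Integration.integrable_bound)
    show "integrable lborel (indicat_real {1..3::real})" by (simp add: integrable_indicator_iff)
    have "tent x / x\<^sup>2 \<le> 1" if "x \<in> {1..3}" for x
    proof -
      have "1 \<le> x\<^sup>2" using that by (auto intro: one_le_power)
      then show ?thesis using tent(4)[of x] by (simp add: divide_le_eq)
    qed
    then show "AE x in lborel. norm (tent x / x\<^sup>2) \<le> norm (indicat_real {1..3} x)"
      using tent(2,3) by (intro AE_I2) (auto simp: indicator_def)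
  qed measurable
  \<comment> \<open>On an interval of length 1 around the peak, \<open>tent\<close> is at least
    \<open>1 / 2\<close> and \<open>x\<^sup>2\<close> at most 9.\<close>
  have "1 / 18 = (LBINT x. indicat_real {3/2..5/2::real} x * (1 / 18))" by simp
  also have "\<dots> \<le> (LBINT x. tent x / x\<^sup>2)"
  proof (rule integral_mono[OF _ int])
    show "integrable lborel (\<lambda>x. indicat_real {3/2..5/2::real} x * (1 / 18))" by (simp add: integrable_indicator_iff)
    fix x :: real
    show "indicat_real {3/2..5/2} x * (1 / 18) \<le> tent x / x\<^sup>2"
    proof (cases "x \<in> {3/2..5/2}")
      case True
      have "x\<^sup>2 \<le> 3\<^sup>2" using True by (intro power_mono) auto
      moreover have "x\<^sup>2 > 0" using True by (intro zero_less_power) auto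
      moreover have "tent x \<ge> 1 / 2" using True by (auto simp: tent_def abs_if)
      ultimately have "(1 / 2) / 9 \<le> tent x / x\<^sup>2" by (intro frac_le) auto
      then show ?thesis using True by simp
    qed (auto simp: tent(3))
  qed
  finally show "(LBINT x. tent x / x\<^sup>2) > 0" by simp
qed

text \<open>Quadrants are stable under intersection, generate the Borel sets and exhaust the plane.
  Finiteness on each quadrant admits measures whose total mass may be infinite.\<close>

lemma measure_eqI_atMost_prod:
  fixes \<mu> \<nu> :: "(real \<times> real) measure"
  assumes sets: "sets \<mu> = sets borel" "sets \<nu> = sets borel"
    and eq: "\<And>v q. emeasure \<mu> {..(v, q)} = emeasure \<nu> {..(v, q)}"
    and fin: "\<And>v q. emeasure \<mu> {..(v, q)} \<noteq> \<infinity>"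
  shows "\<mu> = \<nu>"
proof (rule measure_eqI_generator_eq)
  let ?E = "range (\<lambda>a::real \<times> real. {..a})"
  have "{..a} \<inter> {..b} = {..inf a b}" for a b :: "real \<times> real" by auto
  then show "Int_stable ?E" unfolding Int_stable_def by blast
  show "?E \<subseteq> Pow UNIV" by simp
  show "sets \<mu> = sigma_sets UNIV ?E" "sets \<nu> = sigma_sets UNIV ?E"
    unfolding sets by (subst borel_eq_atMost; simp)+
  show "emeasure \<mu> X = emeasure \<nu> X" if "X \<in> ?E" for X using that eq by auto
  show "range (\<lambda>n. {..(real n, real n)}) \<subseteq> ?E" by auto
  show "(\<Union>n. {..(real n, real n)}) = UNIV"
  proof (rule sym, rule UNIV_eq_I)
    fix p :: "real \<times> real"
    obtain n :: nat where "max (fst p) (snd p) < real n" using reals_Archimedean2 by blast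
    then show "p \<in> (\<Union>n. {..(real n, real n)})" by (intro UN_I[of n]) (auto simp: less_eq_prod_def)
  qed
  show "emeasure \<mu> {..(real n, real n)} \<noteq> \<infinity>" for n by (rule fin)
qed

section \<open>The law of the integral given the ratio\<close>

lemma tendsto_integral_bounded_by_integrable:
  fixes f :: "nat \<Rightarrow> 'a \<Rightarrow> real"
  assumes "\<And>n. f n \<in> borel_measurable M" "g \<in> borel_measurable M" "integrable M w"
    and "\<And>x. x \<in> space M \<Longrightarrow> (\<lambda>n. f n x) \<longlonglongrightarrow> g x"
    and "\<And>n x. x \<in> space M \<Longrightarrow> \<bar>f n x\<bar> \<le> w x"
  shows "(\<lambda>n. integral\<^sup>L M (f n)) \<longlonglongrightarrow> integral\<^sup>L M g \<and> integrable M g"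
proof
  show "(\<lambda>n. integral\<^sup>L M (f n)) \<longlonglongrightarrow> integral\<^sup>L M g"
    by (rule integral_dominated_convergence[where w = w]) (use assms in auto)
  show "integrable M g"
    by (rule integrable_dominated_convergence[where w = w and s = f]) (use assms in auto)
qed

text \<open>The unnormalised generalized inverse Gaussian density of index \<open>- 1\<close>, with
  coefficients \<open>2 * w\<close> and \<open>2\<close> in the exponent. The normalising constant
  depends on \<open>w\<close> and is left to the mixing measure.\<close>

definition gig_kernel :: "real \<Rightarrow> real \<Rightarrow> real" where
  "gig_kernel w x = indicator {0<..} x * (exp (- 2 * w * x - 2 / x) / x\<^sup>2)"

lemma gig_kernel_nonneg [simp]: "gig_kernel w x \<ge> 0"
  by (simp add: gig_kernel_def)

lemma borel_measurable_gig_kernel [measurable (raw)]: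
  assumes [measurable]: "f \<in> borel_measurable N" "g \<in> borel_measurable N"
  shows "(\<lambda>x. gig_kernel (f x) (g x)) \<in> borel_measurable N"
  unfolding gig_kernel_def by measurable

context standard_brownian_motion
begin

text \<open>Comparing \<open>tent\<close> with \<open>plateau q n x * exp (- 2 / x)\<close> cancels
  the singular factor \<open>exp (2 / A)\<close> on one side. The other exponential stays bounded on
  the cutoffs, so indicators can be reached by dominated convergence.\<close>

lemma expectation_proportional_indicator:
  assumes t: "t > 0" and v: "v > 0" and q: "q > 0"
  defines "A \<equiv> integrated_gbm B t" and "W \<equiv> \<lambda>\<omega>. geometric_bm B t \<omega> / (integrated_gbm B t \<omega>)\<^sup>2"
  shows "(LBINT x. tent x / x\<^sup>2) * expectation (\<lambda>\<omega>. indicator {..v} (W \<omega>) * indicator {0<..q} (A \<omega>) * exp (2 * W \<omega> * A \<omega>)) =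
    (LBINT x. indicator {0<..q} x * (exp (- 2 / x) / x\<^sup>2)) *
      expectation (\<lambda>\<omega>. indicator {..v} (W \<omega>) * tent (A \<omega>) * exp (2 * W \<omega> * A \<omega> + 2 / A \<omega>))"
    and "integrable M (\<lambda>\<omega>. indicator {..v} (W \<omega>) * indicator {0<..q} (A \<omega>) * exp (2 * W \<omega> * A \<omega>))"
    and "integrable lborel (\<lambda>x. indicator {0<..q} x * (exp (- 2 / x) / x\<^sup>2))"
    and "integrable M (\<lambda>\<omega>. indicator {..v} (W \<omega>) * tent (A \<omega>) * exp (2 * W \<omega> * A \<omega> + 2 / A \<omega>))"
proof -
  have t0 [simp]: "0 \<le> t" using t by simp
  note [measurable] = measurable_integrated_gbm[OF t] measurable_geometric_bm[OF t0]
  have [measurable]: "W \<in> borel_measurable M" "A \<in> borel_measurable M" unfolding W_def A_def by measurable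
  have A_pos: "A \<omega> > 0" if "\<omega> \<in> space M" for \<omega> unfolding A_def by (rule integrated_gbm_pos[OF t that])
  have W_pos: "W \<omega> > 0" if "\<omega> \<in> space M" for \<omega>
    unfolding W_def using integrated_gbm_pos[OF t that] by simp
  let ?K = "smooth_cutoff v"
  \<comment> \<open>The maximum makes the exponential continuous at 0; it changes nothing where
    \<open>plateau\<close> is nonzero.\<close>
  define \<phi> where "\<phi> n x = plateau q n x * exp (- 2 / max x (1 / real (Suc n)))" for n x
  have \<phi>_cont: "continuous_on UNIV (\<phi> n)" for n
  proof -
    have "1 / real (Suc n) > 0" by simp
    then have "max x (1 / real (Suc n)) > 0" for x unfolding less_max_iff_disj by simp
    then have "max x (1 / real (Suc n)) \<noteq> 0" for x by (metis less_irrefl)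
    then show ?thesis
      unfolding \<phi>_def[abs_def] by (intro continuous_intros plateau(1)[OF q]) simp
  qed
  have [measurable]: "\<phi> n \<in> borel_measurable borel" "plateau q n \<in> borel_measurable borel"
    "?K n \<in> borel_measurable borel" "tent \<in> borel_measurable borel" for n
    using \<phi>_cont plateau(1)[OF q] smooth_cutoff(2) tent(1) by (auto intro: borel_measurable_continuous_onI)
  have \<phi>_eq: "\<phi> n x = plateau q n x * exp (- 2 / x)" for n x
    using plateau(2)[OF q, of x n] by (cases "x \<in> {1 / real (Suc n)..q + 1}") (auto simp: \<phi>_def max_def)
  have plateau0: "plateau q n x = 0" if "x \<le> 0 \<or> x > q + 1" for n x
  proof (rule plateau(2)[OF q])
    have "1 / real (Suc n) > 0" by simp
    then show "x \<notin> {1 / real (Suc n)..q + 1}" unfolding atLeastAtMost_iff using that by linarith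
  qed
  have proportional: "(LBINT x. tent x / x\<^sup>2) * expectation (\<lambda>\<omega>. ?K n (W \<omega>) * \<phi> n (A \<omega>) * exp (2 * W \<omega> * A \<omega> + 2 / A \<omega>)) =
    (LBINT x. \<phi> n x / x\<^sup>2) * expectation (\<lambda>\<omega>. ?K n (W \<omega>) * tent (A \<omega>) * exp (2 * W \<omega> * A \<omega> + 2 / A \<omega>))" for n
    unfolding W_def A_def
  proof (rule expectation_proportional[OF t smooth_cutoff(1) smooth_cutoff(3) smooth_cutoff(4) \<phi>_cont tent(1)])
    show "x \<notin> {1 / real (Suc n)..max 3 (q + 1)} \<Longrightarrow> \<phi> n x = 0 \<and> tent x = 0" for x
    proof -
      assume x: "x \<notin> {1 / real (Suc n)..max 3 (q + 1)}"
      have "1 / real (Suc n) \<le> 1" by simp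
      then have "x \<notin> {1..3}" using x unfolding atLeastAtMost_iff le_max_iff_disj by linarith
      moreover have "x \<notin> {1 / real (Suc n)..q + 1}" using x by auto
      ultimately show ?thesis using plateau(2)[OF q] tent(2) by (simp add: \<phi>_def)
    qed
    show "v + 1 > 0" "1 / real (Suc n) > 0" using v by auto
    have "1 / real (Suc n) \<le> 1" by simp
    then show "1 / real (Suc n) \<le> max 3 (q + 1)" by linarith
  qed
  let ?f1 = "\<lambda>n \<omega>. ?K n (W \<omega>) * plateau q n (A \<omega>) * exp (2 * W \<omega> * A \<omega>)"
  have f1: "expectation (\<lambda>\<omega>. ?K n (W \<omega>) * \<phi> n (A \<omega>) * exp (2 * W \<omega> * A \<omega> + 2 / A \<omega>)) = expectation (?f1 n)" for n
  proof (rule Bochner_Integration.integral_cong[OF refl])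
    fix \<omega>
    have "exp (- 2 / A \<omega>) * exp (2 * W \<omega> * A \<omega> + 2 / A \<omega>) = exp (2 * W \<omega> * A \<omega>)" by (simp flip: exp_add)
    then show "?K n (W \<omega>) * \<phi> n (A \<omega>) * exp (2 * W \<omega> * A \<omega> + 2 / A \<omega>) = ?f1 n \<omega>"
      by (simp add: \<phi>_eq mult.assoc)
  qed
  \<comment> \<open>A common majorant: a coefficient of modulus at most 1 that vanishes unless
    \<open>W \<le> v + 1\<close> and \<open>A \<le> b\<close> confines the product
    \<open>W * A\<close> to at most \<open>(v + 1) * b\<close>.\<close>
  have WA: "\<bar>c\<bar> * exp (2 * W \<omega> * A \<omega> + d) \<le> exp (2 * ((v + 1) * b) + d')"
    if "\<omega> \<in> space M" "\<bar>c\<bar> \<le> 1" "W \<omega> > v + 1 \<or> A \<omega> > b \<Longrightarrow> c = 0" "d \<le> d' \<or> c = 0" for \<omega> c b d d'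
  proof (cases "c = 0")
    case False
    then have "\<not> (W \<omega> > v + 1 \<or> A \<omega> > b)" using that(3) by blast
    then have "W \<omega> * A \<omega> \<le> (v + 1) * b"
      using A_pos[OF that(1)] W_pos[OF that(1)] v by (intro mult_mono) auto
    then have "exp (2 * W \<omega> * A \<omega> + d) \<le> exp (2 * ((v + 1) * b) + d')" using that(4) False by simp
    then have "\<bar>c\<bar> * exp (2 * W \<omega> * A \<omega> + d) \<le> 1 * exp (2 * ((v + 1) * b) + d')"
      using that(2) by (intro mult_mono) auto
    then show ?thesis by simp
  qed simp
  have lim1: "(\<lambda>n. expectation (?f1 n)) \<longlonglongrightarrow>
      expectation (\<lambda>\<omega>. indicator {..v} (W \<omega>) * indicator {0<..q} (A \<omega>) * exp (2 * W \<omega> * A \<omega>)) \<and>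
      integrable M (\<lambda>\<omega>. indicator {..v} (W \<omega>) * indicator {0<..q} (A \<omega>) * exp (2 * W \<omega> * A \<omega>))"
  proof (rule tendsto_integral_bounded_by_integrable[where f = ?f1 and w = "\<lambda>_. exp (2 * ((v + 1) * (q + 1)) + 0)"])
    show "(\<lambda>n. ?f1 n \<omega>) \<longlonglongrightarrow> indicator {..v} (W \<omega>) * indicator {0<..q} (A \<omega>) * exp (2 * W \<omega> * A \<omega>)" for \<omega>
      by (intro tendsto_intros smooth_cutoff(7) plateau(5)[OF q])
    show "?f1 n \<in> borel_measurable M" for n by measurable
    show "(\<lambda>\<omega>. indicator {..v} (W \<omega>) * indicator {0<..q} (A \<omega>) * exp (2 * W \<omega> * A \<omega>)) \<in> borel_measurable M"
      by measurable
    fix n \<omega> assume \<omega>: "\<omega> \<in> space M"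
    have "\<bar>?K n (W \<omega>) * plateau q n (A \<omega>)\<bar> \<le> 1 * 1"
      unfolding abs_mult using smooth_cutoff(5,6)[of v n] plateau(3,4)[OF q] by (intro mult_mono) auto
    then show "\<bar>?f1 n \<omega>\<bar> \<le> exp (2 * ((v + 1) * (q + 1)) + 0)"
      using WA[OF \<omega>, of "?K n (W \<omega>) * plateau q n (A \<omega>)" "q + 1" 0 0] smooth_cutoff(4)[of v "W \<omega>" n] plateau0[of "A \<omega>" n]
      by (auto simp: abs_mult)
  qed simp
  then show "integrable M (\<lambda>\<omega>. indicator {..v} (W \<omega>) * indicator {0<..q} (A \<omega>) * exp (2 * W \<omega> * A \<omega>))" by simp
  let ?f2 = "\<lambda>n \<omega>. ?K n (W \<omega>) * tent (A \<omega>) * exp (2 * W \<omega> * A \<omega> + 2 / A \<omega>)"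
  have lim2: "(\<lambda>n. expectation (?f2 n)) \<longlonglongrightarrow>
      expectation (\<lambda>\<omega>. indicator {..v} (W \<omega>) * tent (A \<omega>) * exp (2 * W \<omega> * A \<omega> + 2 / A \<omega>)) \<and>
      integrable M (\<lambda>\<omega>. indicator {..v} (W \<omega>) * tent (A \<omega>) * exp (2 * W \<omega> * A \<omega> + 2 / A \<omega>))"
  proof (rule tendsto_integral_bounded_by_integrable[where f = ?f2 and w = "\<lambda>_. exp (2 * ((v + 1) * 3) + 2)"])
    show "(\<lambda>n. ?f2 n \<omega>) \<longlonglongrightarrow> indicator {..v} (W \<omega>) * tent (A \<omega>) * exp (2 * W \<omega> * A \<omega> + 2 / A \<omega>)" for \<omega>
      by (intro tendsto_intros smooth_cutoff(7))
    show "?f2 n \<in> borel_measurable M" for n by measurable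
    show "(\<lambda>\<omega>. indicator {..v} (W \<omega>) * tent (A \<omega>) * exp (2 * W \<omega> * A \<omega> + 2 / A \<omega>)) \<in> borel_measurable M"
      by measurable
    fix n \<omega> assume \<omega>: "\<omega> \<in> space M"
    have "\<bar>?K n (W \<omega>) * tent (A \<omega>)\<bar> \<le> 1 * 1"
      unfolding abs_mult using smooth_cutoff(5,6)[of v n] tent(3,4) by (intro mult_mono) auto
    moreover have "2 / A \<omega> \<le> 2 \<or> tent (A \<omega>) = 0"
      using tent(2)[of "A \<omega>"] by (cases "A \<omega> \<in> {1..3}") (auto simp: divide_le_eq)
    moreover have "?K n (W \<omega>) * tent (A \<omega>) = 0" if "W \<omega> > v + 1 \<or> A \<omega> > 3"
      using that smooth_cutoff(4)[of v "W \<omega>" n] tent(2)[of "A \<omega>"] by auto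
    ultimately have "\<bar>?K n (W \<omega>) * tent (A \<omega>)\<bar> * exp (2 * W \<omega> * A \<omega> + 2 / A \<omega>) \<le> exp (2 * ((v + 1) * 3) + 2)"
      by (intro WA[OF \<omega>]) auto
    then show "\<bar>?f2 n \<omega>\<bar> \<le> exp (2 * ((v + 1) * 3) + 2)"
      by (simp add: abs_mult)
  qed simp
  then show "integrable M (\<lambda>\<omega>. indicator {..v} (W \<omega>) * tent (A \<omega>) * exp (2 * W \<omega> * A \<omega> + 2 / A \<omega>))" by simp
  have lim3: "(\<lambda>n. LBINT x. \<phi> n x / x\<^sup>2) \<longlonglongrightarrow> (LBINT x. indicator {0<..q} x * (exp (- 2 / x) / x\<^sup>2)) \<and>
      integrable lborel (\<lambda>x. indicator {0<..q} x * (exp (- 2 / x) / x\<^sup>2))"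
  proof (rule tendsto_integral_bounded_by_integrable[where f = "\<lambda>n x. \<phi> n x / x\<^sup>2" and w = "\<lambda>x. indicat_real {0..q + 1} x * (1 / 2)"])
    show "integrable lborel (\<lambda>x. indicat_real {0..q + 1} x * (1 / 2))"
      using q by (simp add: integrable_indicator_iff)
    have "(\<lambda>n. plateau q n x * (exp (- 2 / x) / x\<^sup>2)) \<longlonglongrightarrow> indicator {0<..q} x * (exp (- 2 / x) / x\<^sup>2)" for x :: real
      by (intro tendsto_intros plateau(5)[OF q])
    then show "(\<lambda>n. \<phi> n x / x\<^sup>2) \<longlonglongrightarrow> indicator {0<..q} x * (exp (- 2 / x) / x\<^sup>2)" for x
      by (simp add: \<phi>_eq)
    show "\<bar>\<phi> n x / x\<^sup>2\<bar> \<le> indicat_real {0..q + 1} x * (1 / 2)" for n x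
    proof (cases "0 < x \<and> x \<le> q + 1")
      case True
      have "plateau q n x * (exp (- 2 / x) / x\<^sup>2) \<le> 1 * (1 / 2)"
        using True plateau(3,4)[OF q] by (intro mult_mono exp_neg_inverse_le) auto
      moreover have "0 \<le> plateau q n x * (exp (- 2 / x) / x\<^sup>2)" using plateau(3)[OF q] by simp
      ultimately have "\<bar>plateau q n x * (exp (- 2 / x) / x\<^sup>2)\<bar> \<le> 1 * (1 / 2)"
        by (simp only: abs_of_nonneg)
      then show ?thesis using True by (simp add: \<phi>_eq)
    next
      case False
      then have "plateau q n x = 0" by (intro plateau0) auto
      then show ?thesis by (simp add: \<phi>_eq)
    qed
  qed measurable
  then show "integrable lborel (\<lambda>x. indicator {0<..q} x * (exp (- 2 / x) / x\<^sup>2))" by simp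
  show "(LBINT x. tent x / x\<^sup>2) * expectation (\<lambda>\<omega>. indicator {..v} (W \<omega>) * indicator {0<..q} (A \<omega>) * exp (2 * W \<omega> * A \<omega>)) =
    (LBINT x. indicator {0<..q} x * (exp (- 2 / x) / x\<^sup>2)) *
      expectation (\<lambda>\<omega>. indicator {..v} (W \<omega>) * tent (A \<omega>) * exp (2 * W \<omega> * A \<omega> + 2 / A \<omega>))"
    by (rule LIMSEQ_unique[OF tendsto_mult[OF tendsto_const lim1[THEN conjunct1]]
        tendsto_mult[OF lim3[THEN conjunct1] lim2[THEN conjunct1], folded proportional, unfolded f1]])
qed

text \<open>The law of \<open>(W, A)\<close> weighted by \<open>exp (2 * W * A)\<close> agrees on
  quadrants with a product measure, by proportionality. Removing the weight again couples the two
  variables through \<open>gig_kernel w x\<close>.\<close>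

lemma disintegration:
  assumes t: "t > 0"
  defines "A \<equiv> integrated_gbm B t" and "W \<equiv> \<lambda>\<omega>. geometric_bm B t \<omega> / (integrated_gbm B t \<omega>)\<^sup>2"
  obtains \<eta> :: "real measure" where "sigma_finite_measure \<eta>" "sets \<eta> = sets borel" "AE w in \<eta>. w > 0"
    "\<And>\<Psi>. \<Psi> \<in> borel_measurable borel \<Longrightarrow>
      (\<integral>\<^sup>+\<omega>. \<Psi> (W \<omega>, A \<omega>) \<partial>M) = (\<integral>\<^sup>+w. \<integral>\<^sup>+x. \<Psi> (w, x) * ennreal (gig_kernel w x) \<partial>lborel \<partial>\<eta>)"
proof -
  have t0 [simp]: "0 \<le> t" using t by simp
  note [measurable] = measurable_integrated_gbm[OF t] measurable_geometric_bm[OF t0]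
  have [measurable]: "W \<in> borel_measurable M" "A \<in> borel_measurable M" unfolding W_def A_def by measurable
  have A_pos: "A \<omega> > 0" if "\<omega> \<in> space M" for \<omega> unfolding A_def by (rule integrated_gbm_pos[OF t that])
  have W_pos: "W \<omega> > 0" if "\<omega> \<in> space M" for \<omega>
    unfolding W_def using integrated_gbm_pos[OF t that] by simp
  have [measurable]: "tent \<in> borel_measurable borel" using tent(1) by (rule borel_measurable_continuous_onI)
  define c where "c = (LBINT x. tent x / x\<^sup>2)"
  have c: "c > 0" unfolding c_def by (rule integral_tent_pos)
  \<comment> \<open>The \<open>w\<close>-factor read off from the right-hand side of the
    proportionality, divided by the integral \<open>c\<close> of the reference function.\<close>
  define \<eta> where "\<eta> = distr (density M (\<lambda>\<omega>. ennreal (tent (A \<omega>) * exp (2 * W \<omega> * A \<omega> + 2 / A \<omega>) / c))) borel W"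
  define lam where "lam = density lborel (\<lambda>x. ennreal (gig_kernel 0 x))"
  define \<nu> where "\<nu> = distr (density M (\<lambda>\<omega>. ennreal (exp (2 * W \<omega> * A \<omega>)))) (borel :: (real \<times> real) measure) (\<lambda>\<omega>. (W \<omega>, A \<omega>))"
  have [simp, measurable_cong]: "sets \<eta> = sets borel" "sets lam = sets borel" "sets \<nu> = sets borel"
    by (auto simp: \<eta>_def lam_def \<nu>_def)
  have pair_meas [measurable]: "(\<lambda>\<omega>. (W \<omega>, A \<omega>)) \<in> M \<rightarrow>\<^sub>M borel"
    unfolding borel_prod[symmetric] by measurable
  have \<eta>_emeasure: "emeasure \<eta> {..v} = (\<integral>\<^sup>+\<omega>. ennreal (tent (A \<omega>) * exp (2 * W \<omega> * A \<omega> + 2 / A \<omega>) / c) * indicator {..v} (W \<omega>) \<partial>M)" for v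
    unfolding \<eta>_def
    by (subst emeasure_distr, measurable, subst emeasure_density, measurable)
      (auto intro!: nn_integral_cong simp: indicator_def)
  have lam_emeasure: "emeasure lam {..q} = (\<integral>\<^sup>+x. ennreal (gig_kernel 0 x) * indicator {..q} x \<partial>lborel)" for q
    unfolding lam_def by (subst emeasure_density) auto
  have \<nu>_emeasure: "emeasure \<nu> {..(v, q)} = (\<integral>\<^sup>+\<omega>. ennreal (exp (2 * W \<omega> * A \<omega>)) * (indicator {..v} (W \<omega>) * indicator {..q} (A \<omega>)) \<partial>M)" for v q
  proof -
    have [measurable]: "{..(v, q)} \<in> sets borel" by simp
    show ?thesis
    unfolding \<nu>_def
    by (subst emeasure_distr, measurable, subst emeasure_density, measurable)
      (auto intro!: nn_integral_cong simp: indicator_def less_eq_prod_def)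
  qed
  have \<eta>_pos: "emeasure \<eta> {..v} = ennreal (expectation (\<lambda>\<omega>. indicator {..v} (W \<omega>) * tent (A \<omega>) * exp (2 * W \<omega> * A \<omega> + 2 / A \<omega>)) / c)" if "v > 0" for v
  proof -
    have "emeasure \<eta> {..v} = (\<integral>\<^sup>+\<omega>. ennreal (indicator {..v} (W \<omega>) * tent (A \<omega>) * exp (2 * W \<omega> * A \<omega> + 2 / A \<omega>) / c) \<partial>M)"
      unfolding \<eta>_emeasure by (intro nn_integral_cong) (simp add: indicator_def)
    also have "\<dots> = ennreal (expectation (\<lambda>\<omega>. indicator {..v} (W \<omega>) * tent (A \<omega>) * exp (2 * W \<omega> * A \<omega> + 2 / A \<omega>) / c))"
      using expectation_proportional_indicator(4)[OF t that zero_less_one] c tent(3)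
      by (intro nn_integral_eq_integral) (auto simp: W_def A_def)
    finally show ?thesis by simp
  qed
  have lam_pos: "emeasure lam {..q} = ennreal (LBINT x. indicator {0<..q} x * (exp (- 2 / x) / x\<^sup>2))" if "q > 0" for q
  proof -
    have "emeasure lam {..q} = (\<integral>\<^sup>+x. ennreal (indicator {0<..q} x * (exp (- 2 / x) / x\<^sup>2)) \<partial>lborel)"
      unfolding lam_emeasure by (intro nn_integral_cong) (simp add: indicator_def gig_kernel_def)
    also have "\<dots> = ennreal (LBINT x. indicator {0<..q} x * (exp (- 2 / x) / x\<^sup>2))"
      using expectation_proportional_indicator(3)[OF t zero_less_one that]
      by (intro nn_integral_eq_integral) auto
    finally show ?thesis .
  qed
  have \<nu>_pos: "emeasure \<nu> {..(v, q)} = ennreal (expectation (\<lambda>\<omega>. indicator {..v} (W \<omega>) * indicator {0<..q} (A \<omega>) * exp (2 * W \<omega> * A \<omega>)))"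
    if "v > 0" "q > 0" for v q
  proof -
    have "emeasure \<nu> {..(v, q)} = (\<integral>\<^sup>+\<omega>. ennreal (indicator {..v} (W \<omega>) * indicator {0<..q} (A \<omega>) * exp (2 * W \<omega> * A \<omega>)) \<partial>M)"
      unfolding \<nu>_emeasure using A_pos by (intro nn_integral_cong) (simp add: indicator_def)
    also have "\<dots> = ennreal (expectation (\<lambda>\<omega>. indicator {..v} (W \<omega>) * indicator {0<..q} (A \<omega>) * exp (2 * W \<omega> * A \<omega>)))"
      using expectation_proportional_indicator(2)[OF t that]
      by (intro nn_integral_eq_integral) (auto simp: W_def A_def)
    finally show ?thesis .
  qed
  have \<eta>_0: "emeasure \<eta> {..v} = 0" if "v \<le> 0" for v
  proof -
    have "emeasure \<eta> {..v} = (\<integral>\<^sup>+\<omega>. 0 \<partial>M)"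
      unfolding \<eta>_emeasure
    proof (rule nn_integral_cong)
      fix \<omega> assume "\<omega> \<in> space M"
      from W_pos[OF this] that have "\<not> W \<omega> \<le> v" by linarith
      then show "ennreal (tent (A \<omega>) * exp (2 * W \<omega> * A \<omega> + 2 / A \<omega>) / c) * indicator {..v} (W \<omega>) = 0" by simp
    qed
    then show ?thesis by simp
  qed
  have sf\<eta>: "sigma_finite_measure \<eta>"
  proof (rule sigma_finite_measure.intro, intro exI conjI ballI)
    show "countable (range (\<lambda>n::nat. {..real (Suc n)}))" by simp
    show "range (\<lambda>n::nat. {..real (Suc n)}) \<subseteq> sets \<eta>" by auto
    have "\<exists>n. x \<le> real (Suc n)" for x
      by (metis le_SucI less_imp_le of_nat_mono order_trans reals_Archimedean2 le_refl)
    then show "\<Union> (range (\<lambda>n::nat. {..real (Suc n)})) = space \<eta>" by (auto simp: \<eta>_def)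
    show "emeasure \<eta> a \<noteq> \<infinity>" if "a \<in> range (\<lambda>n::nat. {..real (Suc n)})" for a
      using that \<eta>_pos by auto
  qed
  have sflam: "sigma_finite_measure lam"
  proof (rule sigma_finite_measure.intro, intro exI conjI ballI)
    show "countable (range (\<lambda>n::nat. {..real (Suc n)}))" by simp
    show "range (\<lambda>n::nat. {..real (Suc n)}) \<subseteq> sets lam" by auto
    have "\<exists>n. x \<le> real (Suc n)" for x
      by (metis le_SucI less_imp_le of_nat_mono order_trans reals_Archimedean2 le_refl)
    then show "\<Union> (range (\<lambda>n::nat. {..real (Suc n)})) = space lam" by (auto simp: lam_def)
    show "emeasure lam a \<noteq> \<infinity>" if "a \<in> range (\<lambda>n::nat. {..real (Suc n)})" for a
      using that lam_pos by auto
  qed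
  interpret E: sigma_finite_measure \<eta> by (rule sf\<eta>)
  interpret L: sigma_finite_measure lam by (rule sflam)
  \<comment> \<open>For \<open>v > 0\<close> and \<open>q > 0\<close> this is the proportionality
    identity; on the other quadrants both sides vanish because \<open>W\<close> and \<open>A\<close>
    are positive.\<close>
  have \<nu>_eq: "\<nu> = \<eta> \<Otimes>\<^sub>M lam"
  proof (rule measure_eqI_atMost_prod)
    show "sets (\<eta> \<Otimes>\<^sub>M lam) = sets borel"
      unfolding borel_prod[symmetric] by (intro sets_pair_measure_cong) auto
    fix v q :: real
    have rect: "{..(v, q)} = {..v} \<times> {..q}" by (auto simp: less_eq_prod_def)
    have prod: "emeasure (\<eta> \<Otimes>\<^sub>M lam) {..(v, q)} = emeasure \<eta> {..v} * emeasure lam {..q}"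
      unfolding rect by (rule L.emeasure_pair_measure_Times) auto
    have zero: "emeasure \<nu> {..(v, q)} = 0" if "v \<le> 0 \<or> q \<le> 0"
    proof -
      have "emeasure \<nu> {..(v, q)} = (\<integral>\<^sup>+\<omega>. 0 \<partial>M)"
        unfolding \<nu>_emeasure
      proof (rule nn_integral_cong)
        fix \<omega> assume "\<omega> \<in> space M"
        from W_pos[OF this] A_pos[OF this] that have "\<not> W \<omega> \<le> v \<or> \<not> A \<omega> \<le> q" by linarith
        then show "ennreal (exp (2 * W \<omega> * A \<omega>)) * (indicator {..v} (W \<omega>) * indicator {..q} (A \<omega>)) = 0" by auto
      qed
      then show ?thesis by simp
    qed
    have lam_0: "emeasure lam {..q} = 0" if "q \<le> 0"
    proof -
      have "emeasure lam {..q} = (\<integral>\<^sup>+x. 0 \<partial>(lborel :: real measure))"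
        unfolding lam_emeasure using that by (intro nn_integral_cong) (auto simp: gig_kernel_def indicator_def)
      then show ?thesis by simp
    qed
    show "emeasure \<nu> {..(v, q)} = emeasure (\<eta> \<Otimes>\<^sub>M lam) {..(v, q)}"
    proof (cases "v > 0 \<and> q > 0")
      case True
      then have vq: "v > 0" "q > 0" by auto
      let ?e = "expectation (\<lambda>\<omega>. indicator {..v} (W \<omega>) * tent (A \<omega>) * exp (2 * W \<omega> * A \<omega> + 2 / A \<omega>))"
      let ?l = "LBINT x. indicator {0<..q} x * (exp (- 2 / x) / x\<^sup>2)"
      have "0 \<le> ?e" "0 \<le> ?l" using tent(3) by (auto intro!: Bochner_Integration.integral_nonneg)
      moreover have "expectation (\<lambda>\<omega>. indicator {..v} (W \<omega>) * indicator {0<..q} (A \<omega>) * exp (2 * W \<omega> * A \<omega>)) = ?e / c * ?l"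
        using expectation_proportional_indicator(1)[OF t vq] c by (simp add: W_def A_def c_def field_simps)
      ultimately show ?thesis
        unfolding prod \<nu>_pos[OF vq] \<eta>_pos[OF vq(1)] lam_pos[OF vq(2)] using c
        by (simp flip: ennreal_mult)
    next
      case False
      then show ?thesis unfolding prod using zero \<eta>_0 lam_0 by (auto simp: not_less)
    qed
    show "emeasure \<nu> {..(v, q)} \<noteq> \<infinity>"
      using \<nu>_pos zero by (cases "v > 0 \<and> q > 0") (auto simp: not_less)
  qed simp
  show thesis
  proof (rule that[OF sf\<eta>])
    show "sets \<eta> = sets borel" by simp
    have "{w \<in> space \<eta>. \<not> 0 < w} = {..0}" by (auto simp: \<eta>_def)
    then show "AE w in \<eta>. 0 < w" using \<eta>_0[of 0] by (intro AE_I[of _ _ "{..0}"]) auto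
    fix \<Psi> :: "real \<times> real \<Rightarrow> ennreal" assume \<Psi>': "\<Psi> \<in> borel_measurable borel"
    then have \<Psi>'' [measurable]: "\<Psi> \<in> borel_measurable (borel \<Otimes>\<^sub>M borel)" by (simp add: borel_prod)
    \<comment> \<open>The extra factor undoes the weight built into \<open>\<nu>\<close>; multiplied
      with \<open>gig_kernel 0 x\<close> it yields \<open>gig_kernel w x\<close>.\<close>
    define \<Phi> where "\<Phi> p = \<Psi> p * ennreal (exp (- 2 * fst p * snd p))" for p
    have \<Phi>_meas: "\<Phi> \<in> borel_measurable (borel \<Otimes>\<^sub>M borel)" unfolding \<Phi>_def by measurable
    then have \<Phi>_meas': "\<Phi> \<in> borel_measurable borel" by (simp add: borel_prod)
    have "(\<integral>\<^sup>+\<omega>. \<Psi> (W \<omega>, A \<omega>) \<partial>M) = (\<integral>\<^sup>+\<omega>. ennreal (exp (2 * W \<omega> * A \<omega>)) * \<Phi> (W \<omega>, A \<omega>) \<partial>M)"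
    proof (rule nn_integral_cong)
      fix \<omega>
      have "ennreal (exp (2 * W \<omega> * A \<omega>)) * ennreal (exp (- 2 * W \<omega> * A \<omega>)) = 1"
        by (simp flip: ennreal_mult exp_add)
      then show "\<Psi> (W \<omega>, A \<omega>) = ennreal (exp (2 * W \<omega> * A \<omega>)) * \<Phi> (W \<omega>, A \<omega>)"
        by (simp add: \<Phi>_def mult_ac)
    qed
    also have "\<dots> = (\<integral>\<^sup>+p. \<Phi> p \<partial>\<nu>)"
    proof -
      have "(\<lambda>\<omega>. \<Phi> (W \<omega>, A \<omega>)) \<in> borel_measurable M"
        by (rule measurable_compose[OF pair_meas \<Phi>_meas'])
      then show ?thesis
        unfolding \<nu>_def using \<Phi>_meas'
        by (subst nn_integral_distr) (auto simp: nn_integral_density)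
    qed
    also have "\<dots> = (\<integral>\<^sup>+w. \<integral>\<^sup>+x. \<Phi> (w, x) \<partial>lam \<partial>\<eta>)"
      unfolding \<nu>_eq using \<Phi>_meas by (subst L.nn_integral_fst[symmetric]) auto
    also have "\<dots> = (\<integral>\<^sup>+w. \<integral>\<^sup>+x. \<Psi> (w, x) * ennreal (gig_kernel w x) \<partial>lborel \<partial>\<eta>)"
    proof (rule nn_integral_cong)
      fix w
      have [measurable]: "(\<lambda>x. \<Phi> (w, x)) \<in> borel_measurable borel"
        using \<Phi>_meas by measurable
      have "gig_kernel 0 x * exp (- 2 * w * x) = gig_kernel w x" for x
      proof -
        have "exp (- 2 * 0 * x - 2 / x) * exp (- 2 * w * x) = exp (- 2 * w * x - 2 / x)"
          by (simp flip: exp_add)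
        moreover have "gig_kernel 0 x * exp (- 2 * w * x) =
            indicator {0<..} x * ((exp (- 2 * 0 * x - 2 / x) * exp (- 2 * w * x)) / x\<^sup>2)"
          by (simp add: gig_kernel_def)
        ultimately show ?thesis by (simp only: gig_kernel_def)
      qed
      from this[symmetric] have "ennreal (gig_kernel w x) = ennreal (gig_kernel 0 x) * ennreal (exp (- 2 * w * x))" for x
        by (simp only: ennreal_mult gig_kernel_nonneg exp_ge_zero)
      then have "ennreal (gig_kernel 0 x) * \<Phi> (w, x) = \<Psi> (w, x) * ennreal (gig_kernel w x)" for x
        by (simp add: \<Phi>_def mult_ac)
      then show "(\<integral>\<^sup>+x. \<Phi> (w, x) \<partial>lam) = (\<integral>\<^sup>+x. \<Psi> (w, x) * ennreal (gig_kernel w x) \<partial>lborel)"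
        unfolding lam_def by (subst nn_integral_density) auto
    qed
    finally show "(\<integral>\<^sup>+\<omega>. \<Psi> (W \<omega>, A \<omega>) \<partial>M) = (\<integral>\<^sup>+w. \<integral>\<^sup>+x. \<Psi> (w, x) * ennreal (gig_kernel w x) \<partial>lborel \<partial>\<eta>)" .
  qed
qed

end

section \<open>Two integral identities for the generalized inverse Gaussian kernel\<close>

lemma set_integrable_kernel:
  assumes w: "w > 0" and a: "a > 0"
  shows "set_integrable lborel {0<..<a} (gig_kernel w)"
    and "set_integrable lborel {0<..<a} (\<lambda>x. x\<^sup>2 * gig_kernel w x)"
proof -
  have le: "exp (- 2 * w * x - 2 / x) \<le> exp (- 2 / x)" if "x > 0" for x using w that by simp
  have fin: "emeasure lborel {0<..<a} < \<infinity>" using a by simp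
  show "set_integrable lborel {0<..<a} (gig_kernel w)"
    unfolding set_integrable_def
  proof (rule integrableI_bounded_set_indicator[where B = "1 / 2"])
    have "norm (gig_kernel w x) \<le> 1 / 2" if "x \<in> {0<..<a}" for x
    proof -
      have "exp (- 2 * w * x - 2 / x) / x\<^sup>2 \<le> exp (- 2 / x) / x\<^sup>2"
        using that by (intro divide_right_mono le) auto
      also have "\<dots> \<le> 1 / 2" using that by (intro exp_neg_inverse_le) auto
      finally show ?thesis using that by (simp add: gig_kernel_def)
    qed
    then show "AE x in lborel. x \<in> {0<..<a} \<longrightarrow> norm (gig_kernel w x) \<le> 1 / 2" by auto
  qed (use fin in auto)
  show "set_integrable lborel {0<..<a} (\<lambda>x. x\<^sup>2 * gig_kernel w x)"
    unfolding set_integrable_def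
  proof (rule integrableI_bounded_set_indicator[where B = 1])
    have "norm (x\<^sup>2 * gig_kernel w x) \<le> 1" if "x \<in> {0<..<a}" for x
    proof -
      have "0 \<le> w * x" "0 \<le> 2 / x" using that w by auto
      then have "exp (- 2 * w * x - 2 / x) \<le> exp 0" by (subst exp_le_cancel_iff) linarith
      then show ?thesis using that by (simp add: gig_kernel_def)
    qed
    then show "AE x in lborel. x \<in> {0<..<a} \<longrightarrow> norm (x\<^sup>2 * gig_kernel w x) \<le> 1" by auto
  qed (use fin in auto)
qed

lemma nn_integral_atMost_eq_LBINT:
  fixes f :: "real \<Rightarrow> real"
  assumes f: "set_integrable lborel {0<..<a} f" "\<And>x. x \<in> {0<..<a} \<Longrightarrow> f x \<ge> 0" "\<And>x. x \<le> 0 \<Longrightarrow> f x = 0"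
  shows "(\<integral>\<^sup>+x. ennreal (f x) * indicator {..a} x \<partial>lborel) = ennreal (LBINT x:{0<..<a}. f x)"
proof -
  have "(\<integral>\<^sup>+x. ennreal (f x) * indicator {..a} x \<partial>lborel) = (\<integral>\<^sup>+x. ennreal (indicator {0<..<a} x *\<^sub>R f x) \<partial>lborel)"
  proof (rule nn_integral_cong_AE)
    have "AE x in lborel. x \<noteq> a" by (rule AE_lborel_singleton)
    then show "AE x in lborel. ennreal (f x) * indicator {..a} x = ennreal (indicator {0<..<a} x *\<^sub>R f x)"
      by eventually_elim (use f(3) in \<open>auto simp: indicator_def not_le less_le\<close>)
  qed
  also have "\<dots> = ennreal (LBINT x:{0<..<a}. f x)"
    unfolding set_lebesgue_integral_def using f
    by (intro nn_integral_eq_integral) (auto simp: set_integrable_def indicator_def)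
  finally show ?thesis .
qed

text \<open>The function \<open>exp (- 2 * w * x - 2 / x)\<close>, which is \<open>x\<^sup>2\<close>
  times the kernel, has derivative
  \<open>2 * gig_kernel w x - 2 * w * x\<^sup>2 * gig_kernel w x\<close> and tends to 0 at the
  origin. The sum form avoids subtraction of nonnegative extended reals; the boundary term will
  become the density.\<close>

lemma gig_kernel_fundamental_theorem:
  assumes w: "w > 0" and a: "a > 0"
  shows "(\<integral>\<^sup>+x. ennreal (2 * gig_kernel w x) * indicator {..a} x \<partial>lborel) =
    ennreal (a\<^sup>2 * gig_kernel w a) + (\<integral>\<^sup>+x. ennreal (2 * (w * x\<^sup>2 * gig_kernel w x)) * indicator {..a} x \<partial>lborel)"
proof -
  define F where "F x = exp (- 2 * w * x - 2 / x)" for x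
  define f where "f x = 2 * gig_kernel w x - 2 * w * (x\<^sup>2 * gig_kernel w x)" for x
  have f_eq: "f x = F x * (- 2 * w + 2 / x\<^sup>2)" if "x > 0" for x
    using that by (simp add: f_def gig_kernel_def F_def field_simps)
  note int = set_integrable_kernel[OF w a]
  have int1: "set_integrable lborel {0<..<a} (\<lambda>x. 2 * gig_kernel w x)"
    and int2: "set_integrable lborel {0<..<a} (\<lambda>x. 2 * w * (x\<^sup>2 * gig_kernel w x))"
    using int by auto
  have "(LBINT x=ereal 0..ereal a. f x) = F a - 0"
  proof (rule interval_integral_FTC_integrable)
    show "ereal 0 < ereal a" using a by simp
    show "set_integrable lborel (einterval (ereal 0) (ereal a)) f"
      unfolding f_def einterval_eq using int1 int2 by (rule set_integral_diff)
    fix x assume "ereal 0 < ereal x" "ereal x < ereal a"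
    then have x: "x > 0" by simp
    have "(F has_real_derivative F x * (- 2 * w + 2 / x\<^sup>2)) (at x)"
      unfolding F_def using x by (auto intro!: derivative_eq_intros simp: power2_eq_square)
    then show "(F has_vector_derivative f x) (at x)"
      by (simp add: f_eq[OF x] has_real_derivative_iff_has_vector_derivative)
    have cont: "isCont (\<lambda>x. F x * (- 2 * w + 2 / x\<^sup>2)) x"
      unfolding F_def using x by (intro continuous_intros) auto
    have "\<forall>\<^sub>F y in nhds x. f y = F y * (- 2 * w + 2 / y\<^sup>2)"
      using eventually_nhds_in_open[of "{0<..}" x] x by (auto elim!: eventually_mono simp: f_eq)
    from isCont_cong[OF this] show "isCont f x" using cont by simp
  next
    have "((\<lambda>x. exp (- (2 * w * x + 2 / x))) \<longlongrightarrow> 0) (at_right 0)"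
      using w by real_asymp
    then show "((F \<circ> real_of_ereal) \<longlongrightarrow> 0) (at_right (ereal 0))"
      unfolding ereal_tendsto_simps by (simp add: F_def[abs_def])
    have "isCont F a" unfolding F_def using a by (intro continuous_intros) auto
    then show "((F \<circ> real_of_ereal) \<longlongrightarrow> F a) (at_left (ereal a))"
      unfolding ereal_tendsto_simps by (simp add: isCont_def filterlim_at_split)
  qed
  then have "(LBINT x:{0<..<a}. 2 * gig_kernel w x) - (LBINT x:{0<..<a}. 2 * w * (x\<^sup>2 * gig_kernel w x)) = F a"
    using a set_integral_diff(2)[OF int1 int2] by (simp add: interval_lebesgue_integral_def f_def)
  moreover have "a\<^sup>2 * gig_kernel w a = F a" using a by (simp add: gig_kernel_def F_def)
  ultimately have eq: "(LBINT x:{0<..<a}. 2 * gig_kernel w x) = a\<^sup>2 * gig_kernel w a + (LBINT x:{0<..<a}. 2 * w * (x\<^sup>2 * gig_kernel w x))"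
    by simp
  have n1: "(\<integral>\<^sup>+x. ennreal (2 * gig_kernel w x) * indicator {..a} x \<partial>lborel) = ennreal (LBINT x:{0<..<a}. 2 * gig_kernel w x)"
    using int1 by (rule nn_integral_atMost_eq_LBINT) (auto simp: gig_kernel_def)
  have "(\<integral>\<^sup>+x. ennreal (2 * w * (x\<^sup>2 * gig_kernel w x)) * indicator {..a} x \<partial>lborel) =
      ennreal (LBINT x:{0<..<a}. 2 * w * (x\<^sup>2 * gig_kernel w x))"
    using int2 by (rule nn_integral_atMost_eq_LBINT) (use w in \<open>auto simp: gig_kernel_def\<close>)
  moreover have "(LBINT x:{0<..<a}. 2 * w * (x\<^sup>2 * gig_kernel w x)) \<ge> 0"
    unfolding set_lebesgue_integral_def using w by (intro Bochner_Integration.integral_nonneg) auto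
  ultimately show ?thesis
    unfolding n1 eq by (simp add: mult.assoc ennreal_plus)
qed

text \<open>The substitution \<open>1 / y = 1 / x + 1 / a\<close>.\<close>
lemma gig_kernel_substitution:
  assumes w: "w > 0" and a: "a > 0"
  shows "(\<integral>\<^sup>+x. ennreal (exp (2 * (w * x\<^sup>2) / (a + x))) * ennreal (gig_kernel w x) \<partial>lborel) =
    ennreal (exp (2 / a)) * (\<integral>\<^sup>+x. indicator {..a} x * ennreal (gig_kernel w x) \<partial>lborel)"
proof -
  \<comment> \<open>\<open>g\<close> is \<open>x\<close> as a function of \<open>y\<close>. Then
    \<open>2 * w * x\<^sup>2 / (a + x) - 2 * w * x\<close> becomes \<open>- 2 * w * y\<close>, while
    \<open>- 2 / a - 2 / x\<close> becomes \<open>- 2 / y\<close> and \<open>dx / x\<^sup>2\<close>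
    becomes \<open>dy / y\<^sup>2\<close>. The term \<open>- 2 / a\<close> is paid for by the factor
    \<open>exp (2 / a)\<close> outside the integral.\<close>
  define f where "f x = exp (2 * (w * x\<^sup>2) / (a + x) - 2 / a - 2 * w * x - 2 / x) / x\<^sup>2" for x
  define g where "g y = a * y / (a - y)" for y
  define g' where "g' y = a\<^sup>2 / (a - y)\<^sup>2" for y
  have fg: "f (g y) * g' y = gig_kernel w y" if y: "0 < y" "y < a" for y
  proof -
    have g0: "g y > 0" using y by (simp add: g_def)
    have ag: "a + g y = a\<^sup>2 / (a - y)" using y by (simp add: g_def field_simps power2_eq_square)
    have "2 * (w * (g y)\<^sup>2) / (a + g y) = 2 * w * (y\<^sup>2 / (a - y))"
      unfolding ag using y a by (simp add: g_def power_divide power_mult_distrib power2_eq_square)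
    moreover have "2 * w * g y = 2 * w * (a * y / (a - y))" by (simp add: g_def)
    moreover have "y\<^sup>2 / (a - y) - a * y / (a - y) = - y"
      using y by (simp add: diff_divide_distrib[symmetric] divide_eq_eq power2_eq_square algebra_simps)
    then have "2 * w * (y\<^sup>2 / (a - y)) - 2 * w * (a * y / (a - y)) = - 2 * w * y"
      by (metis mult_minus_left mult_minus_right right_diff_distrib)
    moreover have "2 / g y = 2 / y - 2 / a" using y a by (simp add: g_def field_simps)
    ultimately have e: "2 * (w * (g y)\<^sup>2) / (a + g y) - 2 / a - 2 * w * g y - 2 / g y = - 2 * w * y - 2 / y"
      by linarith
    have "g' y / (g y)\<^sup>2 = 1 / y\<^sup>2"
      using y a by (simp add: g_def g'_def power_divide power_mult_distrib)
    moreover have "f (g y) * g' y = exp (- 2 * w * y - 2 / y) * (g' y / (g y)\<^sup>2)"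
      unfolding f_def e by simp
    ultimately show ?thesis using y
      by (simp add: gig_kernel_def)
  qed
  have DERIV_g: "(g has_real_derivative g' y) (at y)" if "y < a" for y
    unfolding g_def g'_def using that
    by (auto intro!: derivative_eq_intros simp: power2_eq_square algebra_simps)
  have lim0: "(g \<longlongrightarrow> 0) (at_right 0)"
  proof -
    have "isCont g 0" using DERIV_g[of 0] a by (intro DERIV_isCont) auto
    then show ?thesis by (simp add: isCont_def filterlim_at_split g_def)
  qed
  have limInf: "filterlim g at_top (at_left a)"
    unfolding g_def[abs_def] using a by real_asymp
  have a0: "ereal 0 < ereal a" using a by simp
  have DERIV: "DERIV g y :> g' y" if "ereal 0 < ereal y" "ereal y < ereal a" for y
    using that by (auto intro: DERIV_g)
  have cont_f: "isCont f (g y)" if "ereal 0 < ereal y" "ereal y < ereal a" for y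
  proof -
    have "g y > 0" using that by (simp add: g_def)
    then show ?thesis unfolding f_def using a by (intro continuous_intros) auto
  qed
  have cont_g': "isCont g' y" if "ereal 0 < ereal y" "ereal y < ereal a" for y
    unfolding g'_def using that by (auto intro!: continuous_intros)
  have nonneg: "0 \<le> f (g y)" "0 \<le> g' y" for y by (auto simp: f_def g'_def)
  have lims: "((ereal \<circ> g \<circ> real_of_ereal) \<longlongrightarrow> ereal 0) (at_right (ereal 0))"
    "((ereal \<circ> g \<circ> real_of_ereal) \<longlongrightarrow> \<infinity>) (at_left (ereal a))"
    unfolding ereal_tendsto_simps using lim0 limInf by auto
  have "set_integrable lborel {0<..<a} (\<lambda>y. f (g y) * g' y)"
    using set_integrable_kernel(1)[OF w a] by (rule set_integrable_cong[THEN iffD1, rotated 3]) (auto simp: fg)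
  then have int_fg: "set_integrable lborel (einterval (ereal 0) (ereal a)) (\<lambda>y. f (g y) * g' y)"
    by auto
  have sub: "set_integrable lborel (einterval (ereal 0) \<infinity>) f"
    by (rule interval_integral_substitution_nonneg(1)[OF a0 DERIV cont_f cont_g' nonneg lims int_fg])
  have sub_eq: "(LBINT x=ereal 0..\<infinity>. f x) = (LBINT y=ereal 0..ereal a. f (g y) * g' y)"
    by (rule interval_integral_substitution_nonneg(2)[OF a0 DERIV cont_f cont_g' nonneg lims int_fg])
  have eq: "(LBINT x:{0<..}. f x) = (LBINT x:{0<..<a}. gig_kernel w x)"
  proof -
    have "(LBINT x:{0<..<a}. f (g x) * g' x) = (LBINT x:{0<..<a}. gig_kernel w x)"
      by (rule set_lebesgue_integral_cong) (auto simp: fg)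
    then show ?thesis using sub_eq a by (simp add: interval_lebesgue_integral_def)
  qed
  have "(\<integral>\<^sup>+x. ennreal (exp (2 * (w * x\<^sup>2) / (a + x))) * ennreal (gig_kernel w x) \<partial>lborel) =
      (\<integral>\<^sup>+x. ennreal (exp (2 / a)) * ennreal (indicator {0<..} x *\<^sub>R f x) \<partial>lborel)"
  proof (rule nn_integral_cong)
    fix x :: real
    have "exp (2 * (w * x\<^sup>2) / (a + x)) * exp (- 2 * w * x - 2 / x) =
        exp (2 / a) * exp (2 * (w * x\<^sup>2) / (a + x) - 2 / a - 2 * w * x - 2 / x)"
      unfolding exp_add[symmetric] by (simp add: algebra_simps)
    then show "ennreal (exp (2 * (w * x\<^sup>2) / (a + x))) * ennreal (gig_kernel w x) =
        ennreal (exp (2 / a)) * ennreal (indicator {0<..} x *\<^sub>R f x)"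
      by (simp add: f_def gig_kernel_def indicator_def flip: ennreal_mult)
  qed
  also have "\<dots> = ennreal (exp (2 / a)) * (\<integral>\<^sup>+x. ennreal (indicator {0<..} x *\<^sub>R f x) \<partial>lborel)"
    using sub by (intro nn_integral_cmult) (auto simp: set_integrable_def)
  also have "(\<integral>\<^sup>+x. ennreal (indicator {0<..} x *\<^sub>R f x) \<partial>lborel) = ennreal (LBINT x:{0<..}. f x)"
    unfolding set_lebesgue_integral_def using sub
    by (intro nn_integral_eq_integral) (auto simp: set_integrable_def f_def)
  also have "\<dots> = (\<integral>\<^sup>+x. ennreal (gig_kernel w x) * indicator {..a} x \<partial>lborel)"
    unfolding eq
    by (rule nn_integral_atMost_eq_LBINT[symmetric, OF set_integrable_kernel(1)[OF w a]]) (simp_all add: gig_kernel_def)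
  finally show ?thesis by (simp add: mult.commute)
qed

section \<open>Distribution function and density\<close>

context standard_brownian_motion
begin

text \<open>The reversal formula holds for bounded continuous functions. Ramps equal to 1 up to
  \<open>a\<close> converge to the indicator of \<open>{..a}\<close> at every point, including
  \<open>a\<close>, so atoms cause no difficulty.\<close>

lemma reversed_cdf:
  assumes t: "t > 0"
  shows "expectation (\<lambda>\<omega>. geometric_bm B t \<omega> * indicator {..a} (integrated_gbm B t \<omega>)) =
    prob {\<omega> \<in> space M. integrated_gbm B t \<omega> / geometric_bm B t \<omega> \<le> a}"
proof -
  let ?M = "geometric_bm B t" and ?A = "integrated_gbm B t"
  have t0 [simp]: "0 \<le> t" using t by simp
  note [measurable] = measurable_integrated_gbm[OF t] measurable_geometric_bm[OF t0]
  define f where "f n x = max 0 (min 1 (1 + real n * (a - x)))" for n :: nat and x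
  have f_cont: "continuous_on UNIV (f n)" for n
    unfolding f_def[abs_def] by (intro continuous_intros)
  have f_bound: "\<bar>f n x\<bar> \<le> 1" for n x by (simp add: f_def)
  have [measurable]: "f n \<in> borel_measurable borel" for n
    using f_cont by (rule borel_measurable_continuous_onI)
  have f_lim: "(\<lambda>n. f n x) \<longlonglongrightarrow> indicator {..a} x" for x
  proof (cases "x \<le> a")
    case True
    then show ?thesis by (simp add: f_def)
  next
    case False
    obtain N :: nat where N: "1 / (x - a) < real N" using reals_Archimedean2 by blast
    have "\<forall>\<^sub>F n in sequentially. f n x = indicator {..a} x"
      using eventually_ge_at_top[of N]
    proof eventually_elim
      fix n assume "N \<le> n"
      then have "1 / (x - a) < real n" using N by simp
      then have "1 < real n * (x - a)" using False by (simp add: divide_less_eq)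
      then have "1 + real n * (a - x) \<le> 0" by (simp add: algebra_simps)
      then show "f n x = indicator {..a} x" using False by (simp add: f_def)
    qed
    then show ?thesis by (rule tendsto_eventually)
  qed
  have "(\<lambda>n. expectation (\<lambda>\<omega>. ?M \<omega> * f n (?A \<omega>))) \<longlonglongrightarrow> expectation (\<lambda>\<omega>. ?M \<omega> * indicator {..a} (?A \<omega>))"
  proof (rule tendsto_integral_bounded_by_integrable[THEN conjunct1, OF _ _ integrable_geometric_bm[OF t]])
    show "\<bar>?M \<omega> * f n (?A \<omega>)\<bar> \<le> ?M \<omega>" for n \<omega>
      using mult_left_mono[OF f_bound[of n "?A \<omega>"], of "?M \<omega>"] by (simp add: abs_mult less_imp_le)
  qed (measurable, intro tendsto_intros f_lim)
  moreover have "(\<lambda>n. expectation (\<lambda>\<omega>. f n (?A \<omega> / ?M \<omega>))) \<longlonglongrightarrow> expectation (\<lambda>\<omega>. indicator {..a} (?A \<omega> / ?M \<omega>))"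
    by (rule tendsto_integral_bounded_by_integrable[where w = "\<lambda>_. 1", THEN conjunct1]) (measurable, simp_all add: f_lim f_bound)
  ultimately have "expectation (\<lambda>\<omega>. ?M \<omega> * indicator {..a} (?A \<omega>)) = expectation (\<lambda>\<omega>. indicator {..a} (?A \<omega> / ?M \<omega>))"
    unfolding expectation_reversal[OF t f_cont f_bound] by (rule LIMSEQ_unique)
  also have "\<dots> = expectation (indicator {\<omega> \<in> space M. ?A \<omega> / ?M \<omega> \<le> a})"
    by (intro Bochner_Integration.integral_cong) (auto simp: indicator_def)
  also have "\<dots> = prob {\<omega> \<in> space M. ?A \<omega> / ?M \<omega> \<le> a}" by simp
  finally show ?thesis .
qed

text \<open>Everything is read off from the disintegration. Fubini gives the mixed kernel as density
  of the integral, the kernel identity evaluates it through two distribution functions, and the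
  substitution evaluates the exponential moment.\<close>

lemma integrated_gbm_law:
  assumes t: "t > 0"
  defines "g \<equiv> \<lambda>a. 2 / a\<^sup>2 * prob {\<omega> \<in> space M. integrated_gbm B t \<omega> \<le> a} -
      2 / a\<^sup>2 * prob {\<omega> \<in> space M. integrated_gbm B t \<omega> / geometric_bm B t \<omega> \<le> a}"
  shows "\<And>a. a > 0 \<Longrightarrow> integrable M (\<lambda>\<omega>. exp (2 * geometric_bm B t \<omega> / (a + integrated_gbm B t \<omega>)))"
    and "\<And>a. a > 0 \<Longrightarrow> prob {\<omega> \<in> space M. integrated_gbm B t \<omega> \<le> a} =
      exp (- 2 / a) * expectation (\<lambda>\<omega>. exp (2 * geometric_bm B t \<omega> / (a + integrated_gbm B t \<omega>)))"
    and "\<And>a. a > 0 \<Longrightarrow> g a > 0"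
    and "distributed M lborel (integrated_gbm B t) (\<lambda>a. if a > 0 then ennreal (g a) else 0)"
    and "continuous_on {0<..} g"
proof -
  let ?M = "geometric_bm B t" and ?A = "integrated_gbm B t"
  let ?W = "\<lambda>\<omega>. ?M \<omega> / (?A \<omega>)\<^sup>2"
  have t0 [simp]: "0 \<le> t" using t by simp
  note [measurable] = measurable_integrated_gbm[OF t] measurable_geometric_bm[OF t0]
  have A_pos: "?A \<omega> > 0" if "\<omega> \<in> space M" for \<omega> by (rule integrated_gbm_pos[OF t that])
  have M_eq: "?W \<omega> * (?A \<omega>)\<^sup>2 = ?M \<omega>" if "\<omega> \<in> space M" for \<omega> using A_pos[OF that] by simp
  obtain \<eta> :: "real measure" where "sigma_finite_measure \<eta>" and [measurable_cong, simp]: "sets \<eta> = sets borel"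
    and w_pos: "AE w in \<eta>. w > 0"
    and dis: "\<And>\<Psi>. \<Psi> \<in> borel_measurable borel \<Longrightarrow>
      (\<integral>\<^sup>+\<omega>. \<Psi> (?W \<omega>, ?A \<omega>) \<partial>M) = (\<integral>\<^sup>+w. \<integral>\<^sup>+x. \<Psi> (w, x) * ennreal (gig_kernel w x) \<partial>lborel \<partial>\<eta>)"
    by (rule disintegration[OF t]) blast
  interpret E: sigma_finite_measure \<eta> by fact
  interpret pair_sigma_finite \<eta> lborel ..
  have dis': "(\<integral>\<^sup>+\<omega>. \<Psi> (?W \<omega>) (?A \<omega>) \<partial>M) = (\<integral>\<^sup>+w. \<integral>\<^sup>+x. \<Psi> w x * ennreal (gig_kernel w x) \<partial>lborel \<partial>\<eta>)"
    if "(\<lambda>p. \<Psi> (fst p) (snd p)) \<in> borel_measurable (borel \<Otimes>\<^sub>M borel)" for \<Psi>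
    using dis[of "\<lambda>p. \<Psi> (fst p) (snd p)"] that by (simp add: borel_prod)
  have event: "{\<omega> \<in> space M. ?A \<omega> \<le> a} \<in> events" for a by measurable
  define F where "F a = prob {\<omega> \<in> space M. ?A \<omega> \<le> a}" for a
  define H where "H a = expectation (\<lambda>\<omega>. ?M \<omega> * indicator {..a} (?A \<omega>))" for a
  have H: "H a = prob {\<omega> \<in> space M. ?A \<omega> / ?M \<omega> \<le> a}" for a
    unfolding H_def by (rule reversed_cdf[OF t])
  have g: "g a = 2 / a\<^sup>2 * F a - 2 / a\<^sup>2 * H a" for a by (simp add: g_def F_def H)
  have F_nn: "ennreal (F a) = (\<integral>\<^sup>+w. \<integral>\<^sup>+x. indicator {..a} x * ennreal (gig_kernel w x) \<partial>lborel \<partial>\<eta>)" for a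
  proof -
    have "ennreal (F a) = (\<integral>\<^sup>+\<omega>. indicator {\<omega> \<in> space M. ?A \<omega> \<le> a} \<omega> \<partial>M)"
      using event by (simp add: F_def emeasure_eq_measure)
    also have "\<dots> = (\<integral>\<^sup>+\<omega>. indicator {..a} (?A \<omega>) \<partial>M)"
      by (intro nn_integral_cong) (simp add: indicator_def)
    also have "\<dots> = (\<integral>\<^sup>+w. \<integral>\<^sup>+x. indicator {..a} x * ennreal (gig_kernel w x) \<partial>lborel \<partial>\<eta>)"
      by (rule dis') measurable
    finally show ?thesis .
  qed
  \<comment> \<open>In the variables of the disintegration the value of the process at
    \<open>t\<close> is \<open>w * x\<^sup>2\<close>, the factor that appears in the kernel
    identity.\<close>
  have H_nn: "ennreal (H a) = (\<integral>\<^sup>+w. \<integral>\<^sup>+x. ennreal (w * x\<^sup>2) * indicator {..a} x * ennreal (gig_kernel w x) \<partial>lborel \<partial>\<eta>)" for a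
  proof -
    have "integrable M (\<lambda>\<omega>. ?M \<omega> * indicator {..a} (?A \<omega>))"
    proof (rule Bochner_Integration.integrable_bound[OF integrable_geometric_bm[OF t]])
      show "AE \<omega> in M. norm (?M \<omega> * indicator {..a} (?A \<omega>)) \<le> norm (?M \<omega>)"
        by (intro AE_I2) (simp add: indicator_def)
    qed measurable
    then have "ennreal (H a) = (\<integral>\<^sup>+\<omega>. ennreal (?M \<omega> * indicator {..a} (?A \<omega>)) \<partial>M)"
      unfolding H_def by (intro nn_integral_eq_integral[symmetric]) (auto simp: less_imp_le)
    also have "\<dots> = (\<integral>\<^sup>+\<omega>. ennreal (?W \<omega> * (?A \<omega>)\<^sup>2) * indicator {..a} (?A \<omega>) \<partial>M)"
      by (intro nn_integral_cong) (simp only: M_eq, simp add: indicator_def)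
    also have "\<dots> = (\<integral>\<^sup>+w. \<integral>\<^sup>+x. ennreal (w * x\<^sup>2) * indicator {..a} x * ennreal (gig_kernel w x) \<partial>lborel \<partial>\<eta>)"
      by (rule dis'[of "\<lambda>w x. ennreal (w * x\<^sup>2) * indicator {..a} x"]) measurable
    finally show ?thesis .
  qed
  \<comment> \<open>The kernel mixed over \<open>\<eta>\<close>: the candidate density, kept as an
    extended real until its finiteness is known.\<close>
  define G where "G a = (\<integral>\<^sup>+w. ennreal (gig_kernel w a) \<partial>\<eta>)" for a
  have FG: "2 * ennreal (F a) = ennreal (a\<^sup>2) * G a + 2 * ennreal (H a)" if a: "a > 0" for a
  proof -
    have "2 * ennreal (F a) = (\<integral>\<^sup>+w. 2 * (\<integral>\<^sup>+x. indicator {..a} x * ennreal (gig_kernel w x) \<partial>lborel) \<partial>\<eta>)"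
      unfolding F_nn by (intro nn_integral_cmult[symmetric]) measurable
    also have "\<dots> = (\<integral>\<^sup>+w. ennreal (a\<^sup>2) * ennreal (gig_kernel w a) +
        2 * (\<integral>\<^sup>+x. ennreal (w * x\<^sup>2) * indicator {..a} x * ennreal (gig_kernel w x) \<partial>lborel) \<partial>\<eta>)"
      using w_pos
    proof (intro nn_integral_cong_AE, eventually_elim)
      fix w :: real assume w: "w > 0"
      have "2 * (\<integral>\<^sup>+x. indicator {..a} x * ennreal (gig_kernel w x) \<partial>lborel) =
          (\<integral>\<^sup>+x. ennreal (2 * gig_kernel w x) * indicator {..a} x \<partial>lborel)"
        by (subst nn_integral_cmult[symmetric], measurable)
          (intro nn_integral_cong, simp add: ennreal_mult mult_ac)
      also have "\<dots> = ennreal (a\<^sup>2 * gig_kernel w a) +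
          (\<integral>\<^sup>+x. ennreal (2 * (w * x\<^sup>2 * gig_kernel w x)) * indicator {..a} x \<partial>lborel)"
        by (rule gig_kernel_fundamental_theorem[OF w a])
      also have "(\<integral>\<^sup>+x. ennreal (2 * (w * x\<^sup>2 * gig_kernel w x)) * indicator {..a} x \<partial>lborel) =
          2 * (\<integral>\<^sup>+x. ennreal (w * x\<^sup>2) * indicator {..a} x * ennreal (gig_kernel w x) \<partial>lborel)"
        by (subst nn_integral_cmult[symmetric], measurable)
          (intro nn_integral_cong, use w in \<open>simp add: ennreal_mult mult_ac\<close>)
      finally show "2 * (\<integral>\<^sup>+x. indicator {..a} x * ennreal (gig_kernel w x) \<partial>lborel) =
        ennreal (a\<^sup>2) * ennreal (gig_kernel w a) +
        2 * (\<integral>\<^sup>+x. ennreal (w * x\<^sup>2) * indicator {..a} x * ennreal (gig_kernel w x) \<partial>lborel)"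
        by (simp add: ennreal_mult)
    qed
    also have "\<dots> = ennreal (a\<^sup>2) * G a + 2 * ennreal (H a)"
      unfolding G_def H_nn
      by (subst nn_integral_add, measurable, subst nn_integral_cmult, measurable, subst nn_integral_cmult, measurable)
    finally show ?thesis .
  qed
  have FH0: "0 \<le> F a" "0 \<le> H a" for a
    by (auto simp: F_def H)
  have G_eq: "G a = ennreal (g a)" and g_nonneg: "g a \<ge> 0" if a: "a > 0" for a
  proof -
    have F2: "2 * ennreal (F a) = ennreal (2 * F a)" and H2: "2 * ennreal (H a) = ennreal (2 * H a)"
      by (simp_all add: ennreal_mult FH0)
    \<comment> \<open>This finite bound turns the additive identity \<open>FG\<close> into a
      subtraction of reals, which is the stated formula for \<open>g\<close>.\<close>
    have "ennreal (a\<^sup>2) * G a \<le> ennreal (2 * F a)"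
      using FG[OF a] unfolding F2 by simp
    then have "ennreal (a\<^sup>2) * G a \<noteq> \<top>" by (auto simp: top_unique)
    then obtain r where r: "r \<ge> 0" "ennreal (a\<^sup>2) * G a = ennreal r" by (cases "ennreal (a\<^sup>2) * G a") auto
    have "ennreal (2 * F a) = ennreal (r + 2 * H a)"
      using FG[OF a] r FH0 unfolding F2 H2 by (simp add: ennreal_plus)
    then have "2 * F a = r + 2 * H a" using r FH0[of a] by (subst (asm) ennreal_inj) auto
    then have "g a = r / a\<^sup>2" using a by (simp add: g field_simps)
    then show "g a \<ge> 0" using r by simp
    have "G a = ennreal (1 / a\<^sup>2) * (ennreal (a\<^sup>2) * G a)"
      using a by (simp flip: ennreal_mult mult.assoc)
    then show "G a = ennreal (g a)"
      unfolding r \<open>g a = r / a\<^sup>2\<close> using r by (simp flip: ennreal_mult)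
  qed
  have G0: "G a = 0" if "a \<le> 0" for a using that by (simp add: G_def gig_kernel_def)
  have [measurable]: "G \<in> borel_measurable borel"
    unfolding G_def[abs_def] by measurable
  have law: "distr M lborel ?A = density lborel G"
  proof (rule measure_eqI)
    fix X assume "X \<in> sets (distr M lborel ?A)"
    then have X [measurable]: "X \<in> sets borel" by simp
    have "emeasure (distr M lborel ?A) X = emeasure M {\<omega> \<in> space M. ?A \<omega> \<in> X}"
      by (subst emeasure_distr) (auto intro!: arg_cong[of _ _ "emeasure M"])
    also have "\<dots> = (\<integral>\<^sup>+\<omega>. indicator {\<omega> \<in> space M. ?A \<omega> \<in> X} \<omega> \<partial>M)"
      by simp
    also have "\<dots> = (\<integral>\<^sup>+\<omega>. indicator X (?A \<omega>) \<partial>M)"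
      by (intro nn_integral_cong) (simp add: indicator_def)
    also have "\<dots> = (\<integral>\<^sup>+w. \<integral>\<^sup>+x. indicator X x * ennreal (gig_kernel w x) \<partial>lborel \<partial>\<eta>)"
      by (rule dis') measurable
    also have "\<dots> = (\<integral>\<^sup>+x. \<integral>\<^sup>+w. indicator X x * ennreal (gig_kernel w x) \<partial>\<eta> \<partial>lborel)"
      by (rule Fubini'[symmetric]) (simp add: split_beta')
    also have "\<dots> = (\<integral>\<^sup>+x. G x * indicator X x \<partial>lborel)"
      unfolding G_def by (intro nn_integral_cong, subst nn_integral_cmult) (auto simp: mult.commute)
    also have "\<dots> = emeasure (density lborel G) X" by (subst emeasure_density) auto
    finally show "emeasure (distr M lborel ?A) X = emeasure (density lborel G) X" .
  qed simp
  have dist: "distributed M lborel ?A G"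
    unfolding distributed_def using law by auto
  have "G = (\<lambda>a. if a > 0 then ennreal (g a) else 0)"
    using G_eq G0 by (auto simp: fun_eq_iff)
  with dist show "distributed M lborel ?A (\<lambda>a. if a > 0 then ennreal (g a) else 0)" by simp
  \<comment> \<open>Without atoms the indicator of \<open>{..a}\<close> at the integral is almost
    surely continuous in \<open>a\<close>, so dominated convergence yields continuity of
    \<open>F\<close> and \<open>H\<close>.\<close>
  have no_atom: "AE \<omega> in M. ?A \<omega> \<noteq> a" for a
  proof -
    have "AE x in density lborel G. x \<noteq> a"
      using AE_lborel_singleton[of a] by (subst AE_density) auto
    then have "AE x in distr M lborel ?A. x \<noteq> a" by (simp only: law)
    then show ?thesis by (subst (asm) AE_distr_iff) auto
  qed
  have ind_lim: "(\<lambda>n. indicator {..X n} y) \<longlonglongrightarrow> (indicator {..a} y :: real)" if X: "X \<longlonglongrightarrow> a" and "y \<noteq> a" for X y and a :: real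
  proof (rule tendsto_eventually)
    consider "y < a" | "a < y" using \<open>y \<noteq> a\<close> by linarith
    then show "\<forall>\<^sub>F n in sequentially. indicator {..X n} y = (indicator {..a} y :: real)"
    proof cases
      case 1
      show ?thesis using order_tendstoD(1)[OF X 1] by eventually_elim (use 1 in \<open>simp add: indicator_def\<close>)
    next
      case 2
      show ?thesis using order_tendstoD(2)[OF X 2] by eventually_elim (use 2 in \<open>simp add: indicator_def\<close>)
    qed
  qed
  have F_exp: "F a = expectation (\<lambda>\<omega>. indicator {..a} (?A \<omega>))" for a
  proof -
    have "F a = expectation (indicator {\<omega> \<in> space M. ?A \<omega> \<le> a})" using event by (simp add: F_def)
    also have "\<dots> = expectation (\<lambda>\<omega>. indicator {..a} (?A \<omega>))"
      by (intro Bochner_Integration.integral_cong) (auto simp: indicator_def)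
    finally show ?thesis .
  qed
  have FH_lim: "(\<lambda>n. F (X n)) \<longlonglongrightarrow> F a" "(\<lambda>n. H (X n)) \<longlonglongrightarrow> H a" if X: "X \<longlonglongrightarrow> a" for X a
  proof -
    show "(\<lambda>n. F (X n)) \<longlonglongrightarrow> F a"
      unfolding F_exp
    proof (rule integral_dominated_convergence[where w = "\<lambda>_. 1"])
      show "AE \<omega> in M. (\<lambda>n. indicator {..X n} (?A \<omega>)) \<longlonglongrightarrow> (indicator {..a} (?A \<omega>) :: real)"
        using no_atom[of a] by eventually_elim (rule ind_lim[OF X])
    qed (auto simp: indicator_def)
    show "(\<lambda>n. H (X n)) \<longlonglongrightarrow> H a"
      unfolding H_def
    proof (rule integral_dominated_convergence[OF _ _ integrable_geometric_bm[OF t]])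
      show "AE \<omega> in M. (\<lambda>n. ?M \<omega> * indicator {..X n} (?A \<omega>)) \<longlonglongrightarrow> ?M \<omega> * indicator {..a} (?A \<omega>)"
        using no_atom[of a] by eventually_elim (intro tendsto_intros ind_lim[OF X])
      show "AE \<omega> in M. norm (?M \<omega> * indicator {..X n} (?A \<omega>)) \<le> ?M \<omega>" for n
        by (intro AE_I2) (simp add: indicator_def less_imp_le)
    qed measurable
  qed
  have "continuous_on {0<..} F" "continuous_on {0<..} H"
    unfolding continuous_on_sequentially by (auto simp: comp_def intro: FH_lim)
  then show "continuous_on {0<..} g"
    unfolding g[abs_def] by (intro continuous_intros) auto
  show "g a > 0" if a: "a > 0" for a
  \<comment> \<open>For \<open>a > 0\<close> the kernel is strictly positive at every
    \<open>w\<close>, so a zero of the density would make \<open>\<eta>\<close> the null measure,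
    and the total probability would be 0.\<close>
  proof (rule ccontr)
    assume "\<not> g a > 0"
    then have "g a = 0" using g_nonneg[OF a] by simp
    then have "(\<integral>\<^sup>+w. ennreal (gig_kernel w a) \<partial>\<eta>) = 0" using G_eq[OF a] by (simp add: G_def)
    then have "AE w in \<eta>. ennreal (gig_kernel w a) = 0"
      by (subst (asm) nn_integral_0_iff_AE) auto
    then have False_AE: "AE w in \<eta>. False"
      by eventually_elim (use a in \<open>simp add: gig_kernel_def\<close>)
    have "(\<integral>\<^sup>+\<omega>. 1 \<partial>M) = (\<integral>\<^sup>+w. \<integral>\<^sup>+x. 1 * ennreal (gig_kernel w x) \<partial>lborel \<partial>\<eta>)"
      by (rule dis'[of "\<lambda>w x. 1"]) simp
    also have "\<dots> = (\<integral>\<^sup>+w. 0 \<partial>\<eta>)"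
      using False_AE by (intro nn_integral_cong_AE) auto
    finally show False by (simp add: emeasure_space_1)
  qed
  \<comment> \<open>Evaluated as a nonnegative integral, so that integrability of the exponential
    follows from the finite value on the right.\<close>
  have key: "(\<integral>\<^sup>+\<omega>. ennreal (exp (2 * ?M \<omega> / (a + ?A \<omega>))) \<partial>M) = ennreal (exp (2 / a) * F a)" if a: "a > 0" for a
  proof -
    have "(\<integral>\<^sup>+\<omega>. ennreal (exp (2 * ?M \<omega> / (a + ?A \<omega>))) \<partial>M) =
        (\<integral>\<^sup>+\<omega>. ennreal (exp (2 * (?W \<omega> * (?A \<omega>)\<^sup>2) / (a + ?A \<omega>))) \<partial>M)"
      by (intro nn_integral_cong) (simp only: M_eq)
    also have "\<dots> = (\<integral>\<^sup>+w. \<integral>\<^sup>+x. ennreal (exp (2 * (w * x\<^sup>2) / (a + x))) * ennreal (gig_kernel w x) \<partial>lborel \<partial>\<eta>)"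
      by (rule dis'[of "\<lambda>w x. ennreal (exp (2 * (w * x\<^sup>2) / (a + x)))"]) measurable
    also have "\<dots> = (\<integral>\<^sup>+w. ennreal (exp (2 / a)) * (\<integral>\<^sup>+x. indicator {..a} x * ennreal (gig_kernel w x) \<partial>lborel) \<partial>\<eta>)"
      using w_pos by (intro nn_integral_cong_AE, eventually_elim) (rule gig_kernel_substitution[OF _ a])
    also have "\<dots> = ennreal (exp (2 / a)) * ennreal (F a)"
      unfolding F_nn by (intro nn_integral_cmult) measurable
    finally show ?thesis by (simp add: ennreal_mult FH0)
  qed
  show int: "integrable M (\<lambda>\<omega>. exp (2 * ?M \<omega> / (a + ?A \<omega>)))" if a: "a > 0" for a
    using key[OF a] by (intro integrableI_nonneg) auto
  show "prob {\<omega> \<in> space M. ?A \<omega> \<le> a} = exp (- 2 / a) * expectation (\<lambda>\<omega>. exp (2 * ?M \<omega> / (a + ?A \<omega>)))"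
    if a: "a > 0" for a
  proof -
    have "expectation (\<lambda>\<omega>. exp (2 * ?M \<omega> / (a + ?A \<omega>))) = exp (2 / a) * F a"
      using key[OF a] FH0 by (subst integral_eq_nn_integral) auto
    then have "exp (- 2 / a) * expectation (\<lambda>\<omega>. exp (2 * ?M \<omega> / (a + ?A \<omega>))) = (exp (- 2 / a) * exp (2 / a)) * F a"
      by simp
    then show ?thesis by (simp add: F_def flip: exp_add)
  qed
qed

end

theorem theorem4p1:
  fixes P :: "'a measure" and B :: "real \<Rightarrow> 'a \<Rightarrow> real" and t :: real
  assumes "standard_brownian_motion P B" and "t > 0"
  shows "(\<forall>a>0.
            integrable P (\<lambda>\<omega>. exp (2 * geometric_bm B t \<omega> / (a + integrated_gbm B t \<omega>))) \<and>
            \<P>(\<omega> in P. integrated_gbm B t \<omega> \<le> a) =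
              exp (- 2 / a) *
              (\<integral>\<omega>. exp (2 * geometric_bm B t \<omega> / (a + integrated_gbm B t \<omega>)) \<partial>P)) \<and>
         (let g = (\<lambda>a::real. 2 / a\<^sup>2 * \<P>(\<omega> in P. integrated_gbm B t \<omega> \<le> a) -
                        2 / a\<^sup>2 * \<P>(\<omega> in P. integrated_gbm B t \<omega> / geometric_bm B t \<omega> \<le> a))
          in continuous_on {0<..} g \<and> (\<forall>a>0. g a > 0) \<and>
             distributed P lborel (integrated_gbm B t)
               (\<lambda>a. if a > 0 then ennreal (g a) else 0))"
proof -
  interpret standard_brownian_motion P B by fact
  show ?thesis
    unfolding Let_def by (intro conjI allI impI integrated_gbm_law assms(2))
qed

end
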